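(* Let $n,m\ge 2$ and $$d=\frac{n^2m^2}{2}-\frac{n^2}{2}-\frac{m^2}{2}-\frac{nm}{2}-\frac n2-\frac m2+2=\binom{nm}{2}-\binom n2-\binom m2-(n+m-2).$$ Then the Kronecker function $\kappa_{n,m,nm}$ is a piecewise quasipolynomial of degree at most $d$.
   Context: For partitions $\mu,\nu,\lambda$ of the same integer with $\ell(\mu)\le n$, $\ell(\nu)\le m$, $\ell(\lambda)\le nm$, the Kronecker coefficient $g_{\mu,\nu,\lambda}$ is defined by $s_\lambda(x_1y_1,x_1y_2,\dots,x_ny_m)=\sum_{\mu,\nu}g_{\mu,\nu,\lambda}\,s_\mu(x_1,\dots,x_n)s_\nu(y_1,\dots,y_m)$, with $s$ the Schur polynomials. The Kronecker function $\kappa_{n,m,nm}$ is the function $(\mu_1,\dots,\mu_n,\nu_1,\dots,\nu_m,\lambda_1,\dots,\lambda_{nm})\mapsto g_{\mu,\nu,\lambda}$ on such triples. A multivariate quasipolynomial is a function $g:\mathbb{Z}^N\to\mathbb{Q}$ for which there is a full-rank lattice $\Lambda\subseteq\mathbb{Z}^N$ and polynomials $p_i$, one for each coset $\lambda_i+\Lambda$, with $g=p_i$ on $\lambda_i+\Lambda$; its degree is the maximum degree of the $p_i$. A piecewise quasipolynomial is a function whose domain admits a finite decomposition into (polyhedral) pieces on each of which it agrees with a quasipolynomial. *)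

theory Defs
  imports Complex_Main
begin

text \<open>A partition is a weakly decreasing list of naturals (trailing zeros allowed).
  Cells of the Young diagram are pairs (row, column), 0-indexed.\<close>

definition cells :: "nat list \<Rightarrow> (nat \<times> nat) set" where
  "cells lam = {(i, j). i < length lam \<and> j < lam ! i}"

text \<open>Semistandard Young tableaux of shape lam with entries in {0..<N}
  (extended by 0 outside the diagram, so that the set is finite).\<close>
definition ssyt :: "nat list \<Rightarrow> nat \<Rightarrow> (nat \<times> nat \<Rightarrow> nat) set" where
  "ssyt lam N = {T. (\<forall>c. c \<notin> cells lam \<longrightarrow> T c = 0)
      \<and> (\<forall>c \<in> cells lam. T c < N)
      \<and> (\<forall>i j. i < length lam \<and> Suc j < lam ! i \<longrightarrow> T (i, j) \<le> T (i, Suc j))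
      \<and> (\<forall>i j. Suc i < length lam \<and> j < lam ! Suc i \<longrightarrow> T (i, j) < T (Suc i, j))}"

definition schur :: "nat list \<Rightarrow> nat \<Rightarrow> (nat \<Rightarrow> real) \<Rightarrow> real" where
  "schur lam N x = (\<Sum>T\<in>ssyt lam N. \<Prod>c\<in>cells lam. x (T c))"

definition partitions_len :: "nat \<Rightarrow> nat \<Rightarrow> nat list set" where
  "partitions_len n k = {p. length p = n \<and> sorted_wrt (\<ge>) p \<and> sum_list p = k}"

text \<open>Kronecker coefficient g_{mu,nu,lam}: the coefficients in
  s_lam(x_1y_1,...,x_ny_m) = sum g s_mu(x) s_nu(y), the variable x_i y_j being
  indexed by i*m+j; mu, nu range over partitions of |lam| with at most n resp. m parts
  (written as lists of length n resp. m).\<close>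
definition kron :: "nat \<Rightarrow> nat \<Rightarrow> nat list \<Rightarrow> nat list \<Rightarrow> nat list \<Rightarrow> real" where
  "kron n m mu nu lam =
    (THE c. (\<forall>a b. (a, b) \<notin> partitions_len n (sum_list lam) \<times> partitions_len m (sum_list lam)
                  \<longrightarrow> c a b = 0)
      \<and> (\<forall>x y. schur lam (n * m) (\<lambda>k. x (k div m) * y (k mod m))
            = (\<Sum>(a, b)\<in>partitions_len n (sum_list lam) \<times> partitions_len m (sum_list lam).
                  c a b * schur a n x * schur b m y))) mu nu"

definition is_partition_vec :: "int list \<Rightarrow> bool" where
  "is_partition_vec xs \<longleftrightarrow> (\<forall>v\<in>set xs. 0 \<le> v) \<and> sorted_wrt (\<ge>) xs"

definition kron_domain :: "nat \<Rightarrow> nat \<Rightarrow> int list set" where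
  "kron_domain n m = {xs. length xs = n + m + n * m
      \<and> is_partition_vec (take n xs) \<and> is_partition_vec (take m (drop n xs))
      \<and> is_partition_vec (drop (n + m) xs)
      \<and> sum_list (take n xs) = sum_list (drop (n + m) xs)
      \<and> sum_list (take m (drop n xs)) = sum_list (drop (n + m) xs)}"

definition kron_fun :: "nat \<Rightarrow> nat \<Rightarrow> int list \<Rightarrow> real" where
  "kron_fun n m xs = kron n m (map nat (take n xs)) (map nat (take m (drop n xs)))
                               (map nat (drop (n + m) xs))"

definition poly_fun_deg_le :: "nat \<Rightarrow> int \<Rightarrow> (int list \<Rightarrow> real) \<Rightarrow> bool" where
  "poly_fun_deg_le N d p \<longleftrightarrow>
    (\<exists>(c :: (nat \<Rightarrow> nat) \<Rightarrow> rat) S. finite S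
       \<and> (\<forall>\<alpha>\<in>S. (\<forall>i\<ge>N. \<alpha> i = 0) \<and> int (\<Sum>i<N. \<alpha> i) \<le> d)
       \<and> (\<forall>xs. length xs = N \<longrightarrow>
            p xs = (\<Sum>\<alpha>\<in>S. of_rat (c \<alpha>) * (\<Prod>i<N. of_int (xs ! i) ^ \<alpha> i))))"

text \<open>Full-rank lattice in Z^N: an additive subgroup of finite index, i.e. containing
  k*Z^N for some k > 0.\<close>
definition full_rank_lattice :: "nat \<Rightarrow> int list set \<Rightarrow> bool" where
  "full_rank_lattice N L \<longleftrightarrow>
     L \<subseteq> {v. length v = N} \<and> replicate N 0 \<in> L
     \<and> (\<forall>u\<in>L. \<forall>v\<in>L. map2 (+) u v \<in> L) \<and> (\<forall>u\<in>L. map uminus u \<in> L)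
     \<and> (\<exists>k>0. \<forall>v. length v = N \<longrightarrow> map ((*) k) v \<in> L)"

definition quasipoly_deg_le :: "nat \<Rightarrow> int \<Rightarrow> (int list \<Rightarrow> real) \<Rightarrow> bool" where
  "quasipoly_deg_le N d g \<longleftrightarrow>
    (\<exists>L. full_rank_lattice N L \<and>
       (\<forall>a. length a = N \<longrightarrow>
          (\<exists>p. poly_fun_deg_le N d p \<and> (\<forall>v\<in>L. g (map2 (+) a v) = p (map2 (+) a v)))))"

text \<open>Integer points of a rational polyhedron {x. A x \<le> b} (integer data w.l.o.g.).\<close>
definition int_polyhedron :: "nat \<Rightarrow> (int list \<times> int) list \<Rightarrow> int list set" where
  "int_polyhedron N ineqs = {xs. length xs = N \<and>
      (\<forall>(a, b)\<in>set ineqs. length a = N \<and> (\<Sum>i<N. a ! i * xs ! i) \<le> b)}"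

definition piecewise_quasipoly_deg_le ::
    "nat \<Rightarrow> int \<Rightarrow> int list set \<Rightarrow> (int list \<Rightarrow> real) \<Rightarrow> bool" where
  "piecewise_quasipoly_deg_le N d D f \<longleftrightarrow>
    (\<exists>P :: (int list \<times> int) list list.
       (\<Union>q\<in>set P. int_polyhedron N q) = D
       \<and> (\<forall>i<length P. \<forall>j<length P. i \<noteq> j \<longrightarrow>
             int_polyhedron N (P ! i) \<inter> int_polyhedron N (P ! j) = {})
       \<and> (\<forall>q\<in>set P. \<exists>g. quasipoly_deg_le N d g \<and>
             (\<forall>xs\<in>int_polyhedron N q. f xs = g xs)))"

end

theory Submission
  imports Defs "Jordan_Normal_Form.Determinant"
begin

text \<open>Write \<open>V\<close> for Vandermonde products and \<open>z\<close> for the \<open>n m\<close> variables \<open>x i * y j\<close>. The bialternant formula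
  turns the definition of the Kronecker coefficients into
  \<open>(\<Sum>a b. g a b * alternant (a + \<delta>) x * alternant (b + \<delta>) y) * (V z / (V x * V y)) = alternant (\<lambda> + \<delta>) z\<close>,
  where the quotient is a monomial times a product of binomials \<open>z k - z l\<close>. Comparing coefficients,
  \<open>g\<close> is a signed sum, over permutations of \<open>\<lambda> + \<delta>\<close>, of the number of ways to write a vector depending
  affinely on \<open>(\<mu>, \<nu>, \<lambda>)\<close> as a nonnegative combination of the exponent differences of these binomials.
  There are \<open>(nm choose 2) - (n choose 2) - (m choose 2)\<close> of them, and among them are the \<open>n + m - 2\<close>
  simple roots of \<open>GL n\<close> and \<open>GL m\<close>, a lattice basis of the span of all. So only the
  coefficients of the others are free, subject to linear inequalities, and each summation over one of
  them raises the degree by one.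

  Sums over one variable are performed in a class of functions built from floors: there the set of
  polyhedral pieces and residue classes need not be tracked, and is recovered at the very end.\<close>

section \<open>Quasi-affine functions and step polynomials\<close>

text \<open>Inverting the binomials of the quotient \<open>V z / (V x * V y)\<close> would need
  infinite series. Duality keeps every sum finite: a Laurent polynomial is represented by the
  functional pairing its coefficients with arbitrary test functions. Multiplication by a binomial
  then acts on test functions as a difference operator, and a suitable partition function is the
  test function which these operators reduce, one binomial after the other, to the indicator of a
  single exponent. The quotient is explicit because two variables in row 0 of the grid give the
  factor \<open>x 0 * (y k - y l)\<close> and two in column 0 give \<open>y 0 * (x i - x j)\<close>:
  together these exhaust both Vandermonde products and leave only a monomial. The row-major order of
  the grid admits a linear form that decreases by one from each variable to the next; it is positive
  on all exponent differences that occur and bounds the summations. \<open>kron\<close> is a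
  definite description, so existence of the Schur expansion has to be proved too. Uniqueness is a
  by-product: the formula for a coefficient does not mention the expansion it was derived
  from.\<close>

inductive_set quasi_affine :: "nat \<Rightarrow> ((nat \<Rightarrow> int) \<Rightarrow> int) set" for N where
  qa_const: "(\<lambda>x. c) \<in> quasi_affine N"
| qa_coord: "i < N \<Longrightarrow> (\<lambda>x. x i) \<in> quasi_affine N"
| qa_add: "p \<in> quasi_affine N \<Longrightarrow> q \<in> quasi_affine N \<Longrightarrow> (\<lambda>x. p x + q x) \<in> quasi_affine N"
| qa_smult: "p \<in> quasi_affine N \<Longrightarrow> (\<lambda>x. c * p x) \<in> quasi_affine N"
| qa_div: "p \<in> quasi_affine N \<Longrightarrow> 0 < c \<Longrightarrow> (\<lambda>x. p x div c) \<in> quasi_affine N"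

lemma qa_uminus: "p \<in> quasi_affine N \<Longrightarrow> (\<lambda>x. - p x) \<in> quasi_affine N"
  using qa_smult[of p N "-1"] by simp

lemma qa_diff:
  "p \<in> quasi_affine N \<Longrightarrow> q \<in> quasi_affine N \<Longrightarrow> (\<lambda>x. p x - q x) \<in> quasi_affine N"
  using qa_add[OF _ qa_uminus, of p N q] by simp

lemma qa_sum:
  "finite I \<Longrightarrow> (\<And>i. i \<in> I \<Longrightarrow> p i \<in> quasi_affine N) \<Longrightarrow> (\<lambda>x. \<Sum>i\<in>I. p i x) \<in> quasi_affine N"
proof (induction I rule: finite_induct)
  case empty
  then show ?case using qa_const[of 0] by simp
next
  case (insert i I)
  then show ?case using qa_add[of "p i" N "\<lambda>x. \<Sum>i\<in>I. p i x"] by simp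
qed

lemma qa_subst:
  assumes "p \<in> quasi_affine N" and "\<And>i. i < N \<Longrightarrow> (\<lambda>x. s x i) \<in> quasi_affine M"
  shows "(\<lambda>x. p (s x)) \<in> quasi_affine M"
  using assms(1)
  by (induction) (auto intro: quasi_affine.intros assms(2))

lemma qa_cong:
  assumes "p \<in> quasi_affine N" and "\<And>i. i < N \<Longrightarrow> x i = y i"
  shows "p x = p y"
  using assms(1)
  by (induction) (auto simp: assms(2))

abbreviation affine_in_last :: "nat \<Rightarrow> int \<Rightarrow> int \<Rightarrow> ((nat \<Rightarrow> int) \<Rightarrow> int) \<Rightarrow> bool" where
  "affine_in_last N K r p \<equiv> \<exists>q\<in>quasi_affine N. \<exists>c. \<forall>x s. p (x(N := K * s + r)) = q x + c * s"

text \<open>Along an arithmetic progression with suitable step, the last variable leaves every floor.\<close>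

lemma qa_last_variable:
  assumes "p \<in> quasi_affine (Suc N)"
  shows "\<exists>K>0. \<forall>r. affine_in_last N K r p"
  using assms
proof (induction)
  case (qa_const c)
  show ?case
    by (rule exI[of _ 1]) (use quasi_affine.qa_const[of c N] in \<open>auto intro!: bexI exI[of _ 0]\<close>)
next
  case (qa_coord i)
  show ?case
  proof (cases "i = N")
    case True
    show ?thesis
    proof (intro exI[of _ 1] conjI allI)
      fix r :: int
      show "\<exists>q\<in>quasi_affine N. \<exists>c. \<forall>x s. (x(N := 1 * s + r)) i = q x + c * s"
        using True by (intro bexI[OF _ quasi_affine.qa_const[of r N]] exI[of _ 1]) simp
    qed simp
  next
    case False
    then have "i < N" using qa_coord by simp
    show ?thesis
    proof (intro exI[of _ 1] conjI allI)
      fix r :: int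
      show "\<exists>q\<in>quasi_affine N. \<exists>c. \<forall>x s. (x(N := 1 * s + r)) i = q x + c * s"
        using False by (intro bexI[OF _ quasi_affine.qa_coord[OF \<open>i < N\<close>]] exI[of _ 0]) simp
    qed simp
  qed
next
  case (qa_add p q)
  obtain K L where K: "K > 0" "\<And>r. affine_in_last N K r p"
    and L: "L > 0" "\<And>r. affine_in_last N L r q"
    using qa_add.IH by metis
  show ?case
  proof (intro exI[of _ "K * L"] conjI allI)
    fix r :: int
    obtain p' c where p: "p' \<in> quasi_affine N" "\<And>x s. p (x(N := K * s + r)) = p' x + c * s"
      using K(2)[of r] by blast
    obtain q' d where q: "q' \<in> quasi_affine N" "\<And>x s. q (x(N := L * s + r)) = q' x + d * s"
      using L(2)[of r] by blast
    have "p (x(N := K * L * s + r)) + q (x(N := K * L * s + r)) = (p' x + q' x) + (c * L + d * K) * s"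
      for x s
      using p(2)[of x "L * s"] q(2)[of x "K * s"] by (simp add: algebra_simps)
    then show "\<exists>q'\<in>quasi_affine N. \<exists>c. \<forall>x s.
      p (x(N := K * L * s + r)) + q (x(N := K * L * s + r)) = q' x + c * s"
      by (intro bexI[OF _ quasi_affine.qa_add[OF p(1) q(1)]] exI[of _ "c * L + d * K"]) blast
  qed (use K L in simp)
next
  case (qa_smult p e)
  obtain K where K: "K > 0" "\<And>r. affine_in_last N K r p"
    using qa_smult.IH by metis
  show ?case
  proof (intro exI[of _ K] conjI allI)
    fix r :: int
    obtain p' c where p: "p' \<in> quasi_affine N" "\<And>x s. p (x(N := K * s + r)) = p' x + c * s"
      using K(2)[of r] by blast
    have "e * p (x(N := K * s + r)) = e * p' x + (e * c) * s" for x s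
      using p(2)[of x s] by (simp add: algebra_simps)
    then show "\<exists>q'\<in>quasi_affine N. \<exists>c. \<forall>x s. e * p (x(N := K * s + r)) = q' x + c * s"
      by (intro bexI[OF _ quasi_affine.qa_smult[OF p(1)]] exI[of _ "e * c"]) blast
  qed (use K in simp)
next
  case (qa_div p e)
  obtain K where K: "K > 0" "\<And>r. affine_in_last N K r p"
    using qa_div.IH by metis
  show ?case
  proof (intro exI[of _ "K * e"] conjI allI)
    fix r :: int
    obtain p' c where p: "p' \<in> quasi_affine N" "\<And>x s. p (x(N := K * s + r)) = p' x + c * s"
      using K(2)[of r] by blast
    \<comment> \<open>The factor \<open>e\<close> in the step turns the increment into
      \<open>e * (c * s)\<close>, a multiple of the divisor, which passes through the floor.\<close>
    have "p (x(N := K * e * s + r)) div e = p' x div e + c * s" for x s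
    proof -
      have "p (x(N := K * e * s + r)) = p' x + e * (c * s)"
        using p(2)[of x "e * s"] by (simp add: algebra_simps)
      then show ?thesis using \<open>0 < e\<close> by simp
    qed
    then show "\<exists>q'\<in>quasi_affine N. \<exists>c. \<forall>x s. p (x(N := K * e * s + r)) div e = q' x + c * s"
      by (intro bexI[OF _ quasi_affine.qa_div[OF p(1) \<open>0 < e\<close>]] exI[of _ c]) blast
  qed (use K \<open>0 < e\<close> in simp)
qed

lemma qa_last_variable_common:
  assumes "finite Q" and "Q \<subseteq> quasi_affine (Suc N)"
  shows "\<exists>K>0. \<forall>p\<in>Q. \<forall>r. affine_in_last N K r p"
  using assms
proof (induction Q rule: finite_induct)
  case empty
  then show ?case by (auto intro: exI[of _ 1])
next
  case (insert p Q)
  obtain K where K: "K > 0"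
    "\<And>p r. p \<in> Q \<Longrightarrow> affine_in_last N K r p"
    using insert by blast
  obtain L where L: "L > 0" "\<And>r. affine_in_last N L r p"
    using qa_last_variable[of p N] insert.prems by blast
  have mult: "affine_in_last N (K * L) r p"
    if h: "affine_in_last N M r p" "M * M' = K * L"
    for p M M' r
  proof -
    obtain p' c where p: "p' \<in> quasi_affine N" "\<And>x s. p (x(N := M * s + r)) = p' x + c * s"
      using h(1) by blast
    have "p (x(N := K * L * s + r)) = p' x + (c * M') * s" for x s
      using p(2)[of x "M' * s"] by (simp add: h(2)[symmetric] algebra_simps)
    then show ?thesis using p(1) by blast
  qed
  show ?case
  proof (intro exI[of _ "K * L"] conjI ballI allI)
    fix p' r assume "p' \<in> insert p Q"
    then show "affine_in_last N (K * L) r p'"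
      using mult[OF L(2) mult.commute, of r] mult[OF K(2) refl, of p' r] by blast
  qed (use K L in simp)
qed

text \<open>Degree counts only the factors in \<open>Qs\<close>; indicators are free. Hence chambers
  may be cut as finely as needed without affecting the degree. Coefficients are rational because the
  target notion of polynomial requires it.\<close>

inductive_set step_poly :: "nat \<Rightarrow> nat \<Rightarrow> ((nat \<Rightarrow> int) \<Rightarrow> real) set" for N d where
  sp_term: "set Cs \<subseteq> quasi_affine N \<Longrightarrow> set Qs \<subseteq> quasi_affine N \<Longrightarrow> length Qs \<le> d \<Longrightarrow>
    (\<lambda>x. of_rat c * of_bool (\<forall>q\<in>set Cs. 0 \<le> q x) * (\<Prod>q\<leftarrow>Qs. of_int (q x))) \<in> step_poly N d"
| sp_add: "f \<in> step_poly N d \<Longrightarrow> g \<in> step_poly N d \<Longrightarrow> (\<lambda>x. f x + g x) \<in> step_poly N d"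

lemma sp_const: "(\<lambda>x. of_rat c) \<in> step_poly N d"
  using sp_term[of "[]" N "[]" d c] by simp

lemma sp_zero: "(\<lambda>x. 0) \<in> step_poly N d"
  using sp_const[of 0 N d] by simp

lemma sp_mono: "f \<in> step_poly N d \<Longrightarrow> d \<le> e \<Longrightarrow> f \<in> step_poly N e"
  by (induction rule: step_poly.induct) (auto intro: step_poly.intros)

lemma sp_smult: "f \<in> step_poly N d \<Longrightarrow> (\<lambda>x. of_rat a * f x) \<in> step_poly N d"
proof (induction rule: step_poly.induct)
  case (sp_term Cs Qs c)
  then show ?case using step_poly.sp_term[of Cs N Qs d "a * c"] by (simp add: of_rat_mult mult.assoc)
next
  case (sp_add f g)
  then show ?case using step_poly.sp_add by (fastforce simp: distrib_left)
qed

lemma sp_uminus: "f \<in> step_poly N d \<Longrightarrow> (\<lambda>x. - f x) \<in> step_poly N d"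
  using sp_smult[of f N d "-1"] by simp

lemma sp_diff: "f \<in> step_poly N d \<Longrightarrow> g \<in> step_poly N d \<Longrightarrow> (\<lambda>x. f x - g x) \<in> step_poly N d"
  using sp_add[OF _ sp_uminus, of f N d g] by simp

lemma sp_int_mult: "f \<in> step_poly N d \<Longrightarrow> (\<lambda>x. of_int a * f x) \<in> step_poly N d"
  using sp_smult[of f N d "of_int a"] by simp

lemma sp_sum:
  "finite I \<Longrightarrow> (\<And>i. i \<in> I \<Longrightarrow> f i \<in> step_poly N d) \<Longrightarrow> (\<lambda>x. \<Sum>i\<in>I. f i x) \<in> step_poly N d"
proof (induction I rule: finite_induct)
  case empty
  then show ?case by (simp add: sp_zero)
next
  case (insert i I)
  then show ?case using sp_add[of "f i" N d "\<lambda>x. \<Sum>i\<in>I. f i x"] by simp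
qed

lemma sp_indicator_mult:
  assumes "q \<in> quasi_affine N" and "f \<in> step_poly N d"
  shows "(\<lambda>x. of_bool (0 \<le> q x) * f x) \<in> step_poly N d"
  using assms(2)
proof (induction rule: step_poly.induct)
  case (sp_term Cs Qs c)
  have "(\<lambda>x. of_rat c * of_bool (\<forall>q\<in>set (q # Cs). 0 \<le> q x) * (\<Prod>q\<leftarrow>Qs. of_int (q x)))
      \<in> step_poly N d"
    by (rule step_poly.sp_term) (use assms sp_term in auto)
  moreover have "(\<lambda>x. of_rat c * of_bool (\<forall>q\<in>set (q # Cs). 0 \<le> q x) * (\<Prod>q\<leftarrow>Qs. real_of_int (q x)))
    = (\<lambda>x. of_bool (0 \<le> q x) * (of_rat c * of_bool (\<forall>q\<in>set Cs. 0 \<le> q x) * (\<Prod>q\<leftarrow>Qs. of_int (q x))))"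
    by (auto simp: fun_eq_iff)
  ultimately show ?case by simp
next
  case (sp_add f g)
  then show ?case using step_poly.sp_add by (fastforce simp: distrib_left)
qed

lemma sp_qa_mult:
  assumes "q \<in> quasi_affine N" and "f \<in> step_poly N d"
  shows "(\<lambda>x. of_int (q x) * f x) \<in> step_poly N (Suc d)"
  using assms(2)
proof (induction rule: step_poly.induct)
  case (sp_term Cs Qs c)
  have "(\<lambda>x. of_rat c * of_bool (\<forall>q\<in>set Cs. 0 \<le> q x) * (\<Prod>q\<leftarrow>q # Qs. of_int (q x)))
      \<in> step_poly N (Suc d)"
    by (rule step_poly.sp_term) (use assms sp_term in auto)
  then show ?case by (simp add: mult_ac)
next
  case (sp_add f g)
  then show ?case using step_poly.sp_add by (fastforce simp: distrib_left)
qed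

lemma sp_qa_power:
  assumes "q \<in> quasi_affine N"
  shows "(\<lambda>x. of_int (q x) ^ k) \<in> step_poly N k"
proof (induction k)
  case 0
  then show ?case using sp_const[of 1 N 0] by simp
next
  case (Suc k)
  then show ?case using sp_qa_mult[OF assms Suc] by simp
qed

lemma sp_subst:
  assumes "f \<in> step_poly N d" and s: "\<And>i. i < N \<Longrightarrow> (\<lambda>x. s x i) \<in> quasi_affine M"
  shows "(\<lambda>x. f (s x)) \<in> step_poly M d"
  using assms(1)
proof (induction rule: step_poly.induct)
  case (sp_term Cs Qs c)
  have "(\<lambda>x. of_rat c * of_bool (\<forall>q\<in>set (map (\<lambda>q x. q (s x)) Cs). 0 \<le> q x)
      * (\<Prod>q\<leftarrow>map (\<lambda>q x. q (s x)) Qs. of_int (q x))) \<in> step_poly M d"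
    by (rule step_poly.sp_term) (use sp_term in \<open>auto intro!: qa_subst[OF _ s]\<close>)
  then show ?case by (simp add: comp_def)
next
  case (sp_add f g)
  then show ?case by (auto intro: step_poly.intros)
qed

section \<open>Summation of step polynomials over integer intervals\<close>

lemma sum_int_telescope:
  fixes f :: "int \<Rightarrow> real"
  assumes "L \<le> U + 1"
  shows "(\<Sum>s\<in>{L..U}. f (s + 1) - f s) = f (U + 1) - f L"
proof -
  define k where "k = nat (U + 1 - L)"
  have "(\<Sum>s\<in>{L..L + int k - 1}. f (s + 1) - f s) = f (L + int k) - f L"
  proof (induction k)
    case (Suc k)
    have "{L..L + int (Suc k) - 1} = insert (L + int k) {L..L + int k - 1}" by auto
    then show ?case using Suc by (simp add: algebra_simps)
  qed simp
  then show ?thesis using assms by (simp add: k_def)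
qed

text \<open>Faulhaber's recursion: summing \<open>(s + 1) ^ Suc j - s ^ Suc j\<close> telescopes,
  and the binomial theorem expresses it through the power sums of exponent at most
  \<open>j\<close>.\<close>

lemma sp_sum_powers:
  assumes "L \<in> quasi_affine N" and "U \<in> quasi_affine N"
  shows "(\<lambda>x. \<Sum>s\<in>{L x..U x}. of_int s ^ j) \<in> step_poly N (Suc j)"
proof (induction j rule: less_induct)
  case (less j)
  let ?S = "\<lambda>i x. \<Sum>s\<in>{L x..U x}. real_of_int s ^ i"
  \<comment> \<open>The summed recursion solved for the power sum of exponent \<open>j\<close>. The
    indicator is needed since the boundary terms of an empty interval need not cancel.\<close>
  define g where "g = (\<lambda>x. of_rat (1 / of_nat (Suc j)) *
    (of_bool (0 \<le> U x - L x) * (of_int (U x + 1) ^ Suc j - of_int (L x) ^ Suc j)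
      - (\<Sum>i<j. of_int (int (Suc j choose i)) * ?S i x)))"
  have "g \<in> step_poly N (Suc j)" unfolding g_def
  proof (intro sp_smult sp_diff sp_indicator_mult sp_sum sp_int_mult sp_qa_power qa_diff qa_add qa_const assms)
    fix i assume "i \<in> {..<j}"
    then show "?S i \<in> step_poly N (Suc j)" using less sp_mono by (meson lessThan_iff less_SucI nat_less_le Suc_le_mono)
  qed simp
  moreover have "?S j x = g x" for x
  proof (cases "L x \<le> U x")
    case True
    have "real_of_int (s + 1) ^ Suc j - of_int s ^ Suc j
        = of_nat (Suc j) * of_int s ^ j + (\<Sum>i<j. real (Suc j choose i) * of_int s ^ i)" for s
      using binomial_ring[of "real_of_int s" 1 "Suc j"]
      by (simp add: lessThan_Suc_atMost[symmetric] add.commute)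
    then have "(\<Sum>s\<in>{L x..U x}. real_of_int (s + 1) ^ Suc j - of_int s ^ Suc j)
        = of_nat (Suc j) * ?S j x + (\<Sum>s\<in>{L x..U x}. \<Sum>i<j. real (Suc j choose i) * of_int s ^ i)"
      by (simp add: sum.distrib sum_distrib_left del: power_Suc)
    also have "(\<Sum>s\<in>{L x..U x}. \<Sum>i<j. real (Suc j choose i) * of_int s ^ i)
        = (\<Sum>i<j. real (Suc j choose i) * ?S i x)"
      by (subst sum.swap) (simp add: sum_distrib_left)
    finally have "of_nat (Suc j) * ?S j x = of_int (U x + 1) ^ Suc j - of_int (L x) ^ Suc j
        - (\<Sum>i<j. real (Suc j choose i) * ?S i x)"
      using sum_int_telescope[of "L x" "U x" "\<lambda>s. of_int s ^ Suc j"] True by simp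
    then show ?thesis using True
      by (simp add: g_def of_rat_divide divide_simps mult.commute del: power_Suc of_nat_Suc)
  next
    case False
    then show ?thesis by (simp add: g_def)
  qed
  ultimately show ?case by (metis (no_types, lifting) ext)
qed

text \<open>A factor \<open>q x + c * s\<close> splits the sum into \<open>q x\<close> times a
  shorter one and \<open>c\<close> times one with a further power of \<open>s\<close>; the exponent
  \<open>j\<close> makes this induction close.\<close>

lemma sp_sum_product:
  assumes L: "L \<in> quasi_affine N" and U: "U \<in> quasi_affine N"
    and "\<forall>(q, c)\<in>set Qs. q \<in> quasi_affine N"
  shows "(\<lambda>x. \<Sum>s\<in>{L x..U x}. of_int s ^ j * (\<Prod>(q, c)\<leftarrow>Qs. of_int (q x + c * s)))
    \<in> step_poly N (Suc (length Qs + j))"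
  using assms(3)
proof (induction Qs arbitrary: j)
  case Nil
  then show ?case using sp_sum_powers[OF L U] by simp
next
  case (Cons a Qs)
  obtain q c where a: "a = (q, c)" by (cases a)
  let ?S = "\<lambda>j x. \<Sum>s\<in>{L x..U x}. real_of_int s ^ j * (\<Prod>(q, c)\<leftarrow>Qs. of_int (q x + c * s))"
  have q: "q \<in> quasi_affine N" using Cons a by auto
  have "?S j \<in> step_poly N (Suc (length Qs + j))" "?S (Suc j) \<in> step_poly N (Suc (length Qs + Suc j))"
    by (rule Cons.IH; use Cons.prems in auto)+
  then have "(\<lambda>x. of_int (q x) * ?S j x + of_int c * ?S (Suc j) x) \<in> step_poly N (Suc (Suc (length Qs + j)))"
    by (intro sp_add sp_int_mult sp_qa_mult q) simp_all
  moreover have "of_int (q x) * ?S j x + of_int c * ?S (Suc j) x =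
    (\<Sum>s\<in>{L x..U x}. of_int s ^ j * (\<Prod>(q, c)\<leftarrow>a # Qs. of_int (q x + c * s)))" for x
    by (simp add: a sum_distrib_left sum.distrib[symmetric] algebra_simps)
  ultimately show ?case by simp
qed

text \<open>Each constraint is an indicator free of \<open>s\<close> (if \<open>c = 0\<close>) or a
  bound on \<open>s\<close> that is a floor, which is why \<open>quasi_affine\<close> is closed
  under \<open>div\<close>. Whether the new bound or the old one is active is decided by two
  complementary indicators; the \<open>- 1\<close> in the second expresses strictness over the
  integers. The degree does not depend on the number of constraints.\<close>

lemma sp_sum_constrained:
  assumes "L \<in> quasi_affine N" and "U \<in> quasi_affine N"
    and "\<forall>(q, c)\<in>set Qs. q \<in> quasi_affine N" and "\<forall>(q, c)\<in>set Cs. q \<in> quasi_affine N"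
  shows "(\<lambda>x. \<Sum>s\<in>{L x..U x}. of_bool (\<forall>(q, c)\<in>set Cs. 0 \<le> q x + c * s)
      * (\<Prod>(q, c)\<leftarrow>Qs. of_int (q x + c * s)))
    \<in> step_poly N (Suc (length Qs))"
  using assms
proof (induction Cs arbitrary: L U)
  case Nil
  then show ?case using sp_sum_product[of L N U Qs 0] by simp
next
  case (Cons a Cs)
  obtain q c where a: "a = (q, c)" by (cases a)
  have q: "q \<in> quasi_affine N" using Cons a by auto
  define f where "f = (\<lambda>x s. of_bool (\<forall>(q, c)\<in>set Cs. 0 \<le> q x + c * s)
      * (\<Prod>(q, c)\<leftarrow>Qs. real_of_int (q x + c * s)))"
  have IH: "(\<lambda>x. \<Sum>s\<in>{L x..U x}. f x s) \<in> step_poly N (Suc (length Qs))"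
    if "L \<in> quasi_affine N" "U \<in> quasi_affine N" for L U
    unfolding f_def by (rule Cons.IH) (use that Cons.prems in auto)
  have split: "of_bool (\<forall>(q, c)\<in>set (a # Cs). 0 \<le> q x + c * s)
      * (\<Prod>(q, c)\<leftarrow>Qs. real_of_int (q x + c * s)) = of_bool (0 \<le> q x + c * s) * f x s" for x s
    by (auto simp: f_def a)
  consider "c = 0" | "c > 0" | "c < 0" by linarith
  then have "(\<lambda>x. \<Sum>s\<in>{L x..U x}. of_bool (0 \<le> q x + c * s) * f x s)
      \<in> step_poly N (Suc (length Qs))"
  proof cases
    case 1
    then show ?thesis
      using sp_indicator_mult[OF q IH[OF Cons.prems(1,2)]] by (simp add: sum_distrib_left)
  next
    case 2
    \<comment> \<open>The ceiling of \<open>- q x / c\<close>, written as a negated floor.\<close>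
    define M where "M = (\<lambda>x. - (q x div c))"
    have M: "M \<in> quasi_affine N" unfolding M_def by (intro qa_uminus qa_div q 2)
    have "0 \<le> q x + c * s \<longleftrightarrow> M x \<le> s" for x s
    proof -
      have "0 \<le> q x + c * s \<longleftrightarrow> 0 \<le> (q x + c * s) div c"
        using 2 by (subst pos_imp_zdiv_nonneg_iff) auto
      also have "(q x + c * s) div c = s - M x" using 2 by (simp add: M_def)
      finally show ?thesis by simp
    qed
    then have "(\<Sum>s\<in>{L x..U x}. of_bool (0 \<le> q x + c * s) * f x s)
      = of_bool (0 \<le> L x - M x) * (\<Sum>s\<in>{L x..U x}. f x s)
        + of_bool (0 \<le> M x - L x - 1) * (\<Sum>s\<in>{M x..U x}. f x s)" for x
    proof (cases "M x \<le> L x")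
      case False
      have "(\<Sum>s\<in>{L x..U x}. of_bool (M x \<le> s) * f x s) = (\<Sum>s\<in>{M x..U x}. f x s)"
        by (rule sum.mono_neutral_cong_right) (use False in auto)
      then show ?thesis using False \<open>\<And>x s. 0 \<le> q x + c * s \<longleftrightarrow> M x \<le> s\<close> by simp
    qed (auto intro!: sum.cong)
    moreover have "(\<lambda>x. of_bool (0 \<le> L x - M x) * (\<Sum>s\<in>{L x..U x}. f x s)
        + of_bool (0 \<le> M x - L x - 1) * (\<Sum>s\<in>{M x..U x}. f x s)) \<in> step_poly N (Suc (length Qs))"
      by (intro sp_add sp_indicator_mult IH qa_diff qa_const M Cons.prems)
    ultimately show ?thesis by simp
  next
    case 3
    define M where "M = (\<lambda>x. q x div (- c))"
    have M: "M \<in> quasi_affine N" unfolding M_def by (intro qa_div q) (use 3 in simp)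
    have "0 \<le> q x + c * s \<longleftrightarrow> s \<le> M x" for x s
    proof -
      have "0 \<le> q x + c * s \<longleftrightarrow> 0 \<le> (q x + (- c) * (- s)) div (- c)"
        using 3 by (subst pos_imp_zdiv_nonneg_iff) auto
      also have "(q x + (- c) * (- s)) div (- c) = M x - s"
        using 3 div_mult_self2[of "- c" "q x" "- s"] by (simp add: M_def)
      finally show ?thesis by simp
    qed
    then have "(\<Sum>s\<in>{L x..U x}. of_bool (0 \<le> q x + c * s) * f x s)
      = of_bool (0 \<le> M x - U x) * (\<Sum>s\<in>{L x..U x}. f x s)
        + of_bool (0 \<le> U x - M x - 1) * (\<Sum>s\<in>{L x..M x}. f x s)" for x
    proof (cases "U x \<le> M x")
      case False
      have "(\<Sum>s\<in>{L x..U x}. of_bool (s \<le> M x) * f x s) = (\<Sum>s\<in>{L x..M x}. f x s)"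
        by (rule sum.mono_neutral_cong_right) (use False in auto)
      then show ?thesis using False \<open>\<And>x s. 0 \<le> q x + c * s \<longleftrightarrow> s \<le> M x\<close> by simp
    qed (auto intro!: sum.cong)
    moreover have "(\<lambda>x. of_bool (0 \<le> M x - U x) * (\<Sum>s\<in>{L x..U x}. f x s)
        + of_bool (0 \<le> U x - M x - 1) * (\<Sum>s\<in>{L x..M x}. f x s)) \<in> step_poly N (Suc (length Qs))"
      by (intro sp_add sp_indicator_mult IH qa_diff qa_const M Cons.prems)
    ultimately show ?thesis by simp
  qed
  then show ?case unfolding split .
qed

lemma sum_residues:
  fixes f :: "int \<Rightarrow> real"
  assumes "0 < K"
  shows "(\<Sum>t\<in>{0..u}. f t) = (\<Sum>r\<in>{0..<K}. \<Sum>s\<in>{0..(u - r) div K}. f (K * s + r))"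
proof -
  have "(\<Sum>t\<in>{0..u}. f t)
      = (\<Sum>(r, s)\<in>(SIGMA r:{0..<K}. {0..(u - r) div K}). f (K * s + r))"
  proof (rule sum.reindex_bij_witness[of _ "\<lambda>(r, s). K * s + r" "\<lambda>t. (t mod K, t div K)"])
    fix t assume t: "t \<in> {0..u}"
    then have "t - t mod K \<le> u - t mod K" by simp
    then have "(t - t mod K) div K \<le> (u - t mod K) div K" using assms zdiv_mono1 by blast
    then show "(t mod K, t div K) \<in> (SIGMA r:{0..<K}. {0..(u - r) div K})"
      using t assms by (auto simp: pos_imp_zdiv_nonneg_iff minus_mod_eq_mult_div)
  next
    fix a assume a: "a \<in> (SIGMA r:{0..<K}. {0..(u - r) div K})"
    obtain r s where rs: "a = (r, s)" by (cases a)
    have "K * s \<le> K * ((u - r) div K)" using a rs assms by simp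
    also have "\<dots> \<le> u - r" using assms
      by (metis mult.commute mult_div_mod_eq le_add_same_cancel1 pos_mod_sign)
    finally show "(case a of (r, s) \<Rightarrow> K * s + r) \<in> {0..u}" using a rs assms by auto
    show "((case a of (r, s) \<Rightarrow> K * s + r) mod K, (case a of (r, s) \<Rightarrow> K * s + r) div K) = a"
      using a rs assms by auto
  qed auto
  then show ?thesis by (simp add: sum.Sigma)
qed

text \<open>With \<open>t = K * s + r\<close> for one \<open>K\<close> common to all functions
  involved, every function becomes affine in \<open>s\<close> on each residue class, and the sum
  over \<open>s\<close> is of the constrained form. This is the single place where the degree
  grows.\<close>

lemma sp_sum_last_variable:
  assumes "f \<in> step_poly (Suc N) d" and U: "U \<in> quasi_affine N"
  shows "(\<lambda>x. \<Sum>t\<in>{0..U x}. f (x(N := t))) \<in> step_poly N (Suc d)"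
  using assms(1)
proof (induction rule: step_poly.induct)
  case (sp_term Cs Qs a)
  obtain K where K: "K > 0" "\<And>p r. p \<in> set Cs \<union> set Qs \<Longrightarrow>
      affine_in_last N K r p"
    using qa_last_variable_common[of "set Cs \<union> set Qs" N] sp_term by auto
  then obtain Q C where QC: "\<And>p r. p \<in> set Cs \<union> set Qs \<Longrightarrow> Q p r \<in> quasi_affine N"
      "\<And>p r x s. p \<in> set Cs \<union> set Qs \<Longrightarrow> p (x(N := K * s + r)) = Q p r x + C p r * s"
    by metis
  let ?c = "\<lambda>r. map (\<lambda>p. (Q p r, C p r)) Cs"
  let ?q = "\<lambda>r. map (\<lambda>p. (Q p r, C p r)) Qs"
  define F where "F = (\<lambda>x. of_rat a * (\<Sum>r\<in>{0..<K}. \<Sum>s\<in>{0..(U x - r) div K}.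
     of_bool (\<forall>(q, c)\<in>set (?c r). 0 \<le> q x + c * s) * (\<Prod>(q, c)\<leftarrow>?q r. real_of_int (q x + c * s))))"
  have "F \<in> step_poly N (Suc d)" unfolding F_def
  proof (intro sp_smult sp_sum)
    fix r
    have "(\<lambda>x. \<Sum>s\<in>{0..(U x - r) div K}. of_bool (\<forall>(q, c)\<in>set (?c r). 0 \<le> q x + c * s)
        * (\<Prod>(q, c)\<leftarrow>?q r. real_of_int (q x + c * s))) \<in> step_poly N (Suc (length (?q r)))"
      by (rule sp_sum_constrained) (use K(1) QC(1) in \<open>auto intro!: qa_div qa_diff qa_const U\<close>)
    then show "(\<lambda>x. \<Sum>s\<in>{0..(U x - r) div K}. of_bool (\<forall>(q, c)\<in>set (?c r). 0 \<le> q x + c * s)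
        * (\<Prod>(q, c)\<leftarrow>?q r. real_of_int (q x + c * s))) \<in> step_poly N (Suc d)"
      by (rule sp_mono) (use sp_term in simp)
  qed simp
  moreover have "F = (\<lambda>x. \<Sum>t\<in>{0..U x}. of_rat a * of_bool (\<forall>q\<in>set Cs. 0 \<le> q (x(N := t)))
      * (\<Prod>q\<leftarrow>Qs. of_int (q (x(N := t)))))"
  proof
    fix x
    have "(\<forall>q\<in>set Cs. 0 \<le> q (x(N := K * s + r))) \<longleftrightarrow> (\<forall>(q, c)\<in>set (?c r). 0 \<le> q x + c * s)" for r s
      using QC(2) by auto
    moreover have "map (\<lambda>q. real_of_int (q (x(N := K * s + r)))) Qs
        = map (\<lambda>(q, c). real_of_int (q x + c * s)) (?q r)" for r s
      unfolding map_map by (rule map_cong[OF refl]) (simp add: QC(2))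
    ultimately show "F x = (\<Sum>t\<in>{0..U x}. of_rat a * of_bool (\<forall>q\<in>set Cs. 0 \<le> q (x(N := t)))
      * (\<Prod>q\<leftarrow>Qs. of_int (q (x(N := t)))))"
      by (subst sum_residues[OF K(1)]) (simp only: F_def sum_distrib_left mult.assoc)
  qed
  ultimately show ?case by (simp only:)
next
  case (sp_add f g)
  then show ?case using step_poly.sp_add by (fastforce simp: sum.distrib)
qed

section \<open>From step polynomials to piecewise quasipolynomials\<close>

lemma poly_fun_zero: "poly_fun_deg_le N d (\<lambda>xs. 0)"
  unfolding poly_fun_deg_le_def by (intro exI[of _ "\<lambda>_. 0"] exI[of _ "{}"]) simp

lemma poly_fun_const: "poly_fun_deg_le N (int d) (\<lambda>xs. of_rat c)"
  unfolding poly_fun_deg_le_def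
  by (intro exI[of _ "\<lambda>_. c"] exI[of _ "{\<lambda>_. 0}"]) simp

lemma poly_fun_mono: "poly_fun_deg_le N d p \<Longrightarrow> d \<le> e \<Longrightarrow> poly_fun_deg_le N e p"
  unfolding poly_fun_deg_le_def by (meson order_trans)

lemma poly_fun_add:
  assumes "poly_fun_deg_le N d p" and "poly_fun_deg_le N d q"
  shows "poly_fun_deg_le N d (\<lambda>xs. p xs + q xs)"
proof -
  obtain c S where S: "finite S" "\<forall>\<alpha>\<in>S. (\<forall>i\<ge>N. \<alpha> i = 0) \<and> int (\<Sum>i<N. \<alpha> i) \<le> d"
    "\<And>xs. length xs = N \<Longrightarrow> p xs = (\<Sum>\<alpha>\<in>S. of_rat (c \<alpha>) * (\<Prod>i<N. of_int (xs ! i) ^ \<alpha> i))"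
    using assms(1) unfolding poly_fun_deg_le_def by blast
  obtain c' S' where S': "finite S'" "\<forall>\<alpha>\<in>S'. (\<forall>i\<ge>N. \<alpha> i = 0) \<and> int (\<Sum>i<N. \<alpha> i) \<le> d"
    "\<And>xs. length xs = N \<Longrightarrow> q xs = (\<Sum>\<alpha>\<in>S'. of_rat (c' \<alpha>) * (\<Prod>i<N. of_int (xs ! i) ^ \<alpha> i))"
    using assms(2) unfolding poly_fun_deg_le_def by blast
  define e where "e \<alpha> = of_bool (\<alpha> \<in> S) * c \<alpha> + of_bool (\<alpha> \<in> S') * c' \<alpha>" for \<alpha>
  have "p xs + q xs = (\<Sum>\<alpha>\<in>S \<union> S'. of_rat (e \<alpha>) * (\<Prod>i<N. of_int (xs ! i) ^ \<alpha> i))"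
    if "length xs = N" for xs
  proof -
    let ?m = "\<lambda>\<alpha>. \<Prod>i<N. real_of_int (xs ! i) ^ \<alpha> i"
    have "p xs = (\<Sum>\<alpha>\<in>S \<union> S'. of_rat (of_bool (\<alpha> \<in> S) * c \<alpha>) * ?m \<alpha>)"
      unfolding S(3)[OF that] by (rule sum.mono_neutral_cong_left) (use S S' in auto)
    moreover have "q xs = (\<Sum>\<alpha>\<in>S \<union> S'. of_rat (of_bool (\<alpha> \<in> S') * c' \<alpha>) * ?m \<alpha>)"
      unfolding S'(3)[OF that] by (rule sum.mono_neutral_cong_left) (use S S' in auto)
    ultimately show ?thesis
      by (simp only: e_def of_rat_add distrib_right sum.distrib)
  qed
  moreover have "\<forall>\<alpha>\<in>S \<union> S'. (\<forall>i\<ge>N. \<alpha> i = 0) \<and> int (\<Sum>i<N. \<alpha> i) \<le> d" "finite (S \<union> S')"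
    using S S' by auto
  ultimately show ?thesis unfolding poly_fun_deg_le_def by (intro exI[of _ e] exI[of _ "S \<union> S'"]) blast
qed

lemma poly_fun_smult:
  assumes "poly_fun_deg_le N d p"
  shows "poly_fun_deg_le N d (\<lambda>xs. of_rat a * p xs)"
proof -
  obtain c S where S: "finite S" "\<forall>\<alpha>\<in>S. (\<forall>i\<ge>N. \<alpha> i = 0) \<and> int (\<Sum>i<N. \<alpha> i) \<le> d"
    "\<And>xs. length xs = N \<Longrightarrow> p xs = (\<Sum>\<alpha>\<in>S. of_rat (c \<alpha>) * (\<Prod>i<N. of_int (xs ! i) ^ \<alpha> i))"
    using assms(1) unfolding poly_fun_deg_le_def by blast
  then show ?thesis unfolding poly_fun_deg_le_def
    by (intro exI[of _ "\<lambda>\<alpha>. a * c \<alpha>"] exI[of _ S])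
      (auto simp: sum_distrib_left of_rat_mult mult.assoc)
qed

lemma poly_fun_coord_mult:
  assumes "poly_fun_deg_le N d p" and i: "i < N"
  shows "poly_fun_deg_le N (d + 1) (\<lambda>xs. of_int (xs ! i) * p xs)"
proof -
  obtain c S where S: "finite S" "\<forall>\<alpha>\<in>S. (\<forall>i\<ge>N. \<alpha> i = 0) \<and> int (\<Sum>i<N. \<alpha> i) \<le> d"
    "\<And>xs. length xs = N \<Longrightarrow> p xs = (\<Sum>\<alpha>\<in>S. of_rat (c \<alpha>) * (\<Prod>i<N. of_int (xs ! i) ^ \<alpha> i))"
    using assms(1) unfolding poly_fun_deg_le_def by blast
  define u where "u \<alpha> = \<alpha>(i := Suc (\<alpha> i))" for \<alpha> :: "nat \<Rightarrow> nat"
  have inj: "inj_on u S"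
    by (rule inj_onI) (auto simp: u_def fun_eq_iff split: if_splits)
  have rem: "{..<N} = insert i ({..<N} - {i})" using i by auto
  have sum_u: "(\<Sum>j<N. u \<alpha> j) = Suc (\<Sum>j<N. \<alpha> j)" for \<alpha>
  proof -
    have "(\<Sum>j<N. u \<alpha> j) = Suc (\<alpha> i) + (\<Sum>j\<in>{..<N} - {i}. \<alpha> j)"
      by (subst rem, subst sum.insert) (auto simp: u_def intro!: sum.cong)
    also have "\<dots> = Suc (\<Sum>j\<in>insert i ({..<N} - {i}). \<alpha> j)" by (subst sum.insert) auto
    finally show ?thesis using rem by simp
  qed
  have prod_u: "(\<Prod>j<N. real_of_int (xs ! j) ^ u \<alpha> j) = of_int (xs ! i) * (\<Prod>j<N. of_int (xs ! j) ^ \<alpha> j)"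
    for \<alpha> xs
  proof -
    have "(\<Prod>j<N. real_of_int (xs ! j) ^ u \<alpha> j)
        = of_int (xs ! i) ^ Suc (\<alpha> i) * (\<Prod>j\<in>{..<N} - {i}. of_int (xs ! j) ^ \<alpha> j)"
      by (subst rem, subst prod.insert) (auto simp: u_def intro!: prod.cong)
    also have "\<dots> = of_int (xs ! i) * (\<Prod>j\<in>insert i ({..<N} - {i}). of_int (xs ! j) ^ \<alpha> j)"
      by (subst prod.insert) auto
    finally show ?thesis using rem by simp
  qed
  have "of_int (xs ! i) * p xs
      = (\<Sum>\<alpha>\<in>u ` S. of_rat (c (\<alpha>(i := \<alpha> i - 1))) * (\<Prod>i<N. of_int (xs ! i) ^ \<alpha> i))"
    if "length xs = N" for xs
  proof -
    have "(u \<alpha>)(i := u \<alpha> i - 1) = \<alpha>" for \<alpha> by (simp add: u_def)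
    then show ?thesis
      unfolding sum.reindex[OF inj] S(3)[OF that] comp_def prod_u
      by (simp add: sum_distrib_left mult_ac)
  qed
  moreover have "\<forall>\<alpha>\<in>u ` S. (\<forall>i\<ge>N. \<alpha> i = 0) \<and> int (\<Sum>i<N. \<alpha> i) \<le> d + 1"
  proof
    fix \<beta> assume "\<beta> \<in> u ` S"
    then obtain \<alpha> where "\<alpha> \<in> S" "\<beta> = u \<alpha>" by blast
    then show "(\<forall>i\<ge>N. \<beta> i = 0) \<and> int (\<Sum>i<N. \<beta> i) \<le> d + 1"
      using S(2) i sum_u[of \<alpha>] by (auto simp: u_def simp del: of_nat_sum)
  qed
  ultimately show ?thesis unfolding poly_fun_deg_le_def
    by (intro exI[of _ "\<lambda>\<alpha>. c (\<alpha>(i := \<alpha> i - 1))"] exI[of _ "u ` S"]) (use S(1) in blast)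
qed

section \<open>Affine forms, residue classes and sign chambers\<close>

definition affine_form :: "nat \<Rightarrow> (nat \<Rightarrow> int) \<times> int \<Rightarrow> (nat \<Rightarrow> int) \<Rightarrow> int" where
  "affine_form N l x = (\<Sum>i<N. fst l i * x i) + snd l"

lemma poly_fun_affine_mult:
  assumes "poly_fun_deg_le N d p"
  shows "poly_fun_deg_le N (d + 1) (\<lambda>xs. of_int (affine_form N l (nth xs)) * p xs)"
proof -
  have "poly_fun_deg_le N (d + 1) (\<lambda>xs. \<Sum>i<M. of_rat (of_int (fst l i)) * (of_int (xs ! i) * p xs))"
    if "M \<le> N" for M
    using that
  proof (induction M)
    case 0
    then show ?case by (simp add: poly_fun_zero)
  next
    case (Suc M)
    then show ?case unfolding sum.lessThan_Suc
      by (intro poly_fun_add poly_fun_smult poly_fun_coord_mult assms) simp_all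
  qed
  from poly_fun_add[OF this[OF order_refl] poly_fun_smult[OF poly_fun_mono[OF assms], of "d + 1" "of_int (snd l)"]]
  show ?thesis
    by (simp add: affine_form_def sum_distrib_right distrib_right mult.assoc)
qed

text \<open>A floor is the quotient minus a remainder, and the remainder is constant once the
  coordinates are fixed modulo a sufficiently divisible \<open>K\<close>. Neither \<open>K\<close>
  nor the denominator \<open>c\<close> depends on the class \<open>r\<close>, so finitely many forms
  describe \<open>q\<close> everywhere.\<close>

lemma qa_affine_on_residue_class:
  assumes "q \<in> quasi_affine N"
  shows "\<exists>K>0. \<exists>c>0. \<forall>r. \<exists>l. \<forall>x. (\<forall>i<N. x i mod K = r i mod K) \<longrightarrow> c * q x = affine_form N l x"
  using assms
proof (induction)
  case (qa_const a)
  show ?case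
    by (intro exI[of _ 1] conjI allI exI[of _ "(\<lambda>_. 0, a)"]) (simp_all add: affine_form_def)
next
  case (qa_coord j)
  then show ?case
    by (intro exI[of _ 1] conjI allI exI[of _ "(\<lambda>i. of_bool (i = j), 0)"])
      (simp_all add: affine_form_def of_bool_def if_distrib[of "\<lambda>a. a * _"] cong: if_cong)
next
  case (qa_add p q)
  obtain K c where K: "K > 0" "c > 0"
    "\<And>r. \<exists>l. \<forall>x. (\<forall>i<N. x i mod K = r i mod K) \<longrightarrow> c * p x = affine_form N l x"
    using qa_add.IH by blast
  obtain K' c' where K': "K' > 0" "c' > 0"
    "\<And>r. \<exists>l. \<forall>x. (\<forall>i<N. x i mod K' = r i mod K') \<longrightarrow> c' * q x = affine_form N l x"
    using qa_add.IH by blast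
  show ?case
  proof (rule exI[of _ "K * K'"], rule conjI[OF _ exI[of _ "c * c'", OF conjI[OF _ allI]]])
    fix r :: "nat \<Rightarrow> int"
    obtain l where l: "\<And>x. (\<forall>i<N. x i mod K = r i mod K) \<Longrightarrow> c * p x = affine_form N l x"
      using K(3) by blast
    obtain l' where l': "\<And>x. (\<forall>i<N. x i mod K' = r i mod K') \<Longrightarrow> c' * q x = affine_form N l' x"
      using K'(3) by blast
    show "\<exists>l. \<forall>x. (\<forall>i<N. x i mod (K * K') = r i mod (K * K')) \<longrightarrow> c * c' * (p x + q x) = affine_form N l x"
    proof (intro exI[of _ "(\<lambda>i. c' * fst l i + c * fst l' i, c' * snd l + c * snd l')"] allI impI)
      fix x :: "nat \<Rightarrow> int" assume "\<forall>i<N. x i mod (K * K') = r i mod (K * K')"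
      then have "\<forall>i<N. x i mod K = r i mod K" "\<forall>i<N. x i mod K' = r i mod K'"
        by (metis mod_mod_cancel dvd_triv_left) (metis \<open>\<forall>i<N. _\<close> mod_mod_cancel dvd_triv_right)
      then have "c * p x = affine_form N l x" "c' * q x = affine_form N l' x"
        using l l' by blast+
      moreover have "c * c' * (p x + q x) = c' * (c * p x) + c * (c' * q x)"
        by (simp add: algebra_simps)
      ultimately have "c * c' * (p x + q x) = c' * affine_form N l x + c * affine_form N l' x"
        by (simp only:)
      then show "c * c' * (p x + q x)
          = affine_form N (\<lambda>i. c' * fst l i + c * fst l' i, c' * snd l + c * snd l') x"
        by (simp add: affine_form_def sum_distrib_left sum.distrib algebra_simps)
    qed
  qed (use K K' in auto)
next
  case (qa_smult p a)
  obtain K c where K: "K > 0" "c > 0"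
    "\<And>r. \<exists>l. \<forall>x. (\<forall>i<N. x i mod K = r i mod K) \<longrightarrow> c * p x = affine_form N l x"
    using qa_smult.IH by blast
  show ?case
  proof (rule exI[of _ K], rule conjI[OF _ exI[of _ c, OF conjI[OF _ allI]]])
    fix r :: "nat \<Rightarrow> int"
    obtain l where l: "\<And>x. (\<forall>i<N. x i mod K = r i mod K) \<Longrightarrow> c * p x = affine_form N l x"
      using K(3) by blast
    show "\<exists>l. \<forall>x. (\<forall>i<N. x i mod K = r i mod K) \<longrightarrow> c * (a * p x) = affine_form N l x"
    proof (intro exI[of _ "(\<lambda>i. a * fst l i, a * snd l)"] allI impI)
      fix x :: "nat \<Rightarrow> int" assume "\<forall>i<N. x i mod K = r i mod K"
      then have "c * (a * p x) = a * affine_form N l x" using l[of x] by (simp add: mult.left_commute)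
      then show "c * (a * p x) = affine_form N (\<lambda>i. a * fst l i, a * snd l) x"
        by (simp add: affine_form_def sum_distrib_left algebra_simps)
    qed
  qed (use K in auto)
next
  case (qa_div p e)
  obtain K c where K: "K > 0" "c > 0"
    "\<And>r. \<exists>l. \<forall>x. (\<forall>i<N. x i mod K = r i mod K) \<longrightarrow> c * p x = affine_form N l x"
    using qa_div.IH by blast
  show ?case
  proof (rule exI[of _ "K * (c * e)"], rule conjI[OF _ exI[of _ "c * e", OF conjI[OF _ allI]]])
    fix r :: "nat \<Rightarrow> int"
    obtain l where l: "\<And>x. (\<forall>i<N. x i mod K = r i mod K) \<Longrightarrow> c * p x = affine_form N l x"
      using K(3) by blast
    show "\<exists>l. \<forall>x. (\<forall>i<N. x i mod (K * (c * e)) = r i mod (K * (c * e)))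
        \<longrightarrow> c * e * (p x div e) = affine_form N l x"
    \<comment> \<open>On the class of \<open>r\<close>, \<open>e * (p x div e)\<close> equals
      \<open>p x - p r mod e\<close>; multiplying by \<open>c\<close> gives this constant
      term.\<close>
    proof (intro exI[of _ "(fst l, snd l - c * (p r mod e))"] allI impI)
      fix x :: "nat \<Rightarrow> int" assume x: "\<forall>i<N. x i mod (K * (c * e)) = r i mod (K * (c * e))"
      then have px: "c * p x = affine_form N l x"
        by (intro l) (metis mod_mod_cancel dvd_triv_left)
      have "c * e dvd x i - r i" if "i < N" for i
        using x that by (metis mod_eq_dvd_iff dvd_mult_right)
      then have "c * e dvd (\<Sum>i<N. fst l i * (x i - r i))"
        by (intro dvd_sum) auto
      also have "(\<Sum>i<N. fst l i * (x i - r i)) = c * p x - c * p r"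
        using px l[of r] by (simp add: affine_form_def sum_subtractf right_diff_distrib)
      finally have "c * e dvd c * (p x - p r)" by (simp add: right_diff_distrib)
      then have "p x mod e = p r mod e" using K(2) by (simp add: mod_eq_dvd_iff)
      then have "e * (p x div e) = p x - p r mod e"
        by (metis minus_mod_eq_mult_div)
      then have "c * e * (p x div e) = c * p x - c * (p r mod e)"
        by (simp add: mult.assoc right_diff_distrib)
      then show "c * e * (p x div e) = affine_form N (fst l, snd l - c * (p r mod e)) x"
        using px by (simp add: affine_form_def)
    qed
  qed (use K \<open>0 < e\<close> in auto)
qed

abbreviation agrees_on_chamber :: "nat \<Rightarrow> ((nat \<Rightarrow> int) \<Rightarrow> real) \<Rightarrow> int \<Rightarrow> (nat \<Rightarrow> int)
    \<Rightarrow> ((nat \<Rightarrow> int) \<times> int) set \<Rightarrow> ((nat \<Rightarrow> int) \<times> int) set \<Rightarrow> (int list \<Rightarrow> real) \<Rightarrow> bool" where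
  "agrees_on_chamber N f K r E W p \<equiv> \<forall>xs. length xs = N \<longrightarrow> (\<forall>i<N. xs ! i mod K = r i mod K) \<longrightarrow>
     (\<forall>l\<in>E. 0 \<le> affine_form N l (nth xs) \<longleftrightarrow> l \<in> W) \<longrightarrow> f (nth xs) = p xs"

text \<open>\<open>f\<close> is one polynomial on each residue class modulo \<open>K\<close>
  intersected with each sign pattern on \<open>E\<close>; \<open>W\<close> records the nonnegative
  forms. \<open>W\<close> ranges over all sets: patterns realised by no point impose nothing, so
  functions are combined simply by passing to a common modulus and the union of the form
  sets.\<close>

definition chamber_poly ::
  "nat \<Rightarrow> nat \<Rightarrow> ((nat \<Rightarrow> int) \<Rightarrow> real) \<Rightarrow> int \<Rightarrow> ((nat \<Rightarrow> int) \<times> int) set \<Rightarrow> bool" where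
  "chamber_poly N d f K E \<longleftrightarrow> 0 < K \<and> finite E \<and> (\<forall>r W. \<exists>p. poly_fun_deg_le N (int d) p \<and> agrees_on_chamber N f K r E W p)"

lemma chamber_polyD:
  assumes "chamber_poly N d f K E"
  shows "\<exists>p. poly_fun_deg_le N (int d) p \<and> agrees_on_chamber N f K r E W p"
  using assms by (simp add: chamber_poly_def)

lemma chamber_poly_refine:
  assumes "chamber_poly N d f K E" and "0 < K'" "K dvd K'" "E \<subseteq> E'" "finite E'"
  shows "chamber_poly N d f K' E'"
  unfolding chamber_poly_def
proof (intro conjI allI assms)
  fix r W
  obtain p where p: "poly_fun_deg_le N (int d) p"
    "\<And>xs. length xs = N \<Longrightarrow> (\<forall>i<N. xs ! i mod K = r i mod K) \<Longrightarrow>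
        (\<forall>l\<in>E. 0 \<le> affine_form N l (nth xs) \<longleftrightarrow> l \<in> W) \<Longrightarrow> f (nth xs) = p xs"
    using chamber_polyD[OF assms(1), of r W] by blast
  have "f (nth xs) = p xs" if "length xs = N" "\<forall>i<N. xs ! i mod K' = r i mod K'"
    "\<forall>l\<in>E'. 0 \<le> affine_form N l (nth xs) \<longleftrightarrow> l \<in> W" for xs
    by (rule p(2)[OF that(1)]) (use that(2,3) assms(3,4) in \<open>auto simp: mod_eq_dvd_iff intro: dvd_trans\<close>)
  then show "\<exists>p. poly_fun_deg_le N (int d) p \<and> agrees_on_chamber N f K' r E' W p"
    using p(1) by blast
qed

lemma chamber_poly_mono:
  assumes "chamber_poly N d f K E" and "d \<le> e"
  shows "chamber_poly N e f K E"
  using assms(1) poly_fun_mono[of N "int d" _ "int e"] assms(2)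
  unfolding chamber_poly_def by (simp, blast)

lemma chamber_poly_add:
  assumes "chamber_poly N d f K E" and "chamber_poly N d g K' E'"
  shows "\<exists>K E. chamber_poly N d (\<lambda>x. f x + g x) K E"
proof -
  have pos: "0 < K" "0 < K'" "finite E" "finite E'" using assms by (auto simp: chamber_poly_def)
  have f: "chamber_poly N d f (K * K') (E \<union> E')"
    by (rule chamber_poly_refine[OF assms(1)]) (use pos in auto)
  have g: "chamber_poly N d g (K * K') (E \<union> E')"
    by (rule chamber_poly_refine[OF assms(2)]) (use pos in auto)
  have "chamber_poly N d (\<lambda>x. f x + g x) (K * K') (E \<union> E')"
    unfolding chamber_poly_def
  proof (intro conjI allI)
    fix r W
    obtain p q where "poly_fun_deg_le N (int d) p" "poly_fun_deg_le N (int d) q"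
      "agrees_on_chamber N f (K * K') r (E \<union> E') W p"
      "agrees_on_chamber N g (K * K') r (E \<union> E') W q"
      using chamber_polyD[OF f, of r W] chamber_polyD[OF g, of r W] by blast
    then show "\<exists>p. poly_fun_deg_le N (int d) p \<and> agrees_on_chamber N (\<lambda>x. f x + g x) (K * K') r (E \<union> E') W p"
      by (intro exI[of _ "\<lambda>xs. p xs + q xs"] conjI poly_fun_add) auto
  qed (use pos in auto)
  then show ?thesis by blast
qed

lemma chamber_poly_qa_mult:
  assumes f: "chamber_poly N d f K E" and q: "q \<in> quasi_affine N"
  shows "\<exists>K E. chamber_poly N (Suc d) (\<lambda>x. of_int (q x) * f x) K E"
proof -
  have pos: "0 < K" "finite E" using assms by (auto simp: chamber_poly_def)
  obtain K' c where K': "K' > 0" "c > 0"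
    "\<And>r. \<exists>l. \<forall>x. (\<forall>i<N. x i mod K' = r i mod K') \<longrightarrow> c * q x = affine_form N l x"
    using qa_affine_on_residue_class[OF q] by blast
  have "chamber_poly N (Suc d) (\<lambda>x. of_int (q x) * f x) (K * K') E"
    unfolding chamber_poly_def
  proof (intro conjI allI)
    fix r W
    obtain p where p: "poly_fun_deg_le N (int d) p"
      "\<And>xs. length xs = N \<Longrightarrow> (\<forall>i<N. xs ! i mod K = r i mod K) \<Longrightarrow>
        (\<forall>l\<in>E. 0 \<le> affine_form N l (nth xs) \<longleftrightarrow> l \<in> W) \<Longrightarrow> f (nth xs) = p xs"
      using chamber_polyD[OF f, of r W] by blast
    obtain l where l: "\<And>x. (\<forall>i<N. x i mod K' = r i mod K') \<Longrightarrow> c * q x = affine_form N l x"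
      using K'(3) by blast
    show "\<exists>p. poly_fun_deg_le N (int (Suc d)) p \<and> agrees_on_chamber N (\<lambda>x. of_int (q x) * f x) (K * K') r E W p"
    proof (intro exI[of _ "\<lambda>xs. of_rat (1 / of_int c) * (of_int (affine_form N l (nth xs)) * p xs)"]
        conjI allI impI)
      show "poly_fun_deg_le N (int (Suc d))
          (\<lambda>xs. of_rat (1 / of_int c) * (of_int (affine_form N l (nth xs)) * p xs))"
        using poly_fun_smult[OF poly_fun_affine_mult[OF p(1)], of "1 / of_int c" l]
        by (simp add: add.commute)
    next
      fix xs assume len: "length xs = N" and r: "\<forall>i<N. xs ! i mod (K * K') = r i mod (K * K')"
        and W: "\<forall>l\<in>E. 0 \<le> affine_form N l (nth xs) \<longleftrightarrow> l \<in> W"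
      have "c * q (nth xs) = affine_form N l (nth xs)"
        by (rule l) (use r in \<open>metis mod_mod_cancel dvd_triv_right\<close>)
      then have "real_of_int c * of_int (q (nth xs)) = of_int (affine_form N l (nth xs))"
        by (metis of_int_mult)
      then have "real_of_int (q (nth xs)) = of_rat (1 / of_int c) * of_int (affine_form N l (nth xs))"
        using K'(2) by (simp add: of_rat_divide field_simps)
      moreover have "f (nth xs) = p xs"
        by (rule p(2)[OF len _ W]) (use r in \<open>metis mod_mod_cancel dvd_triv_left\<close>)
      ultimately show "of_int (q (nth xs)) * f (nth xs)
          = of_rat (1 / of_int c) * (of_int (affine_form N l (nth xs)) * p xs)"
        by simp
    qed
  qed (use pos K' in auto)
  then show ?thesis by blast
qed

lemma finite_residue_vectors: "finite {r :: nat \<Rightarrow> int. (\<forall>i<N. r i \<in> {0..<K}) \<and> (\<forall>i\<ge>N. r i = 0)}"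
  using finite_set_of_finite_funs[of "{..<N}" "{0..<K}" "0 :: int"]
  by (rule rev_finite_subset) (auto simp: not_less)

text \<open>On a residue class a positive multiple of \<open>q\<close> is an affine form, so the
  indicator is constant on chambers once that form belongs to \<open>E\<close>. One form per residue
  class is added.\<close>

lemma chamber_poly_indicator_mult:
  assumes f: "chamber_poly N d f K E" and q: "q \<in> quasi_affine N"
  shows "\<exists>K E. chamber_poly N d (\<lambda>x. of_bool (0 \<le> q x) * f x) K E"
proof -
  have pos: "0 < K" "finite E" using assms by (auto simp: chamber_poly_def)
  obtain K' c where K': "K' > 0" "c > 0"
    "\<And>r. \<exists>l. \<forall>x. (\<forall>i<N. x i mod K' = r i mod K') \<longrightarrow> c * q x = affine_form N l x"
    using qa_affine_on_residue_class[OF q] by blast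
  then obtain l where l: "\<And>r x. (\<forall>i<N. x i mod K' = r i mod K') \<Longrightarrow> c * q x = affine_form N (l r) x"
    by metis
  define R where "R = {r :: nat \<Rightarrow> int. (\<forall>i<N. r i \<in> {0..<K'}) \<and> (\<forall>i\<ge>N. r i = 0)}"
  define \<rho> where "\<rho> r = (\<lambda>i. if i < N then r i mod K' else 0)" for r :: "nat \<Rightarrow> int"
  have \<rho>: "\<rho> r \<in> R" for r using K'(1) by (simp add: \<rho>_def R_def)
  have "finite (l ` R)" unfolding R_def by (intro finite_imageI finite_residue_vectors)
  then have "chamber_poly N d f (K * K') (E \<union> l ` R)"
    by (intro chamber_poly_refine[OF f]) (use pos K' in auto)
  note f' = chamber_polyD[OF this]
  have "chamber_poly N d (\<lambda>x. of_bool (0 \<le> q x) * f x) (K * K') (E \<union> l ` R)"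
    unfolding chamber_poly_def
  proof (intro conjI allI)
    fix r W
    obtain p where p: "poly_fun_deg_le N (int d) p"
      "\<And>xs. length xs = N \<Longrightarrow> (\<forall>i<N. xs ! i mod (K * K') = r i mod (K * K')) \<Longrightarrow>
        (\<forall>l\<in>E \<union> l ` R. 0 \<le> affine_form N l (nth xs) \<longleftrightarrow> l \<in> W) \<Longrightarrow> f (nth xs) = p xs"
      using f'[of r W] by blast
    show "\<exists>p. poly_fun_deg_le N (int d) p \<and> agrees_on_chamber N (\<lambda>x. of_bool (0 \<le> q x) * f x) (K * K') r (E \<union> l ` R) W p"
    proof (intro exI[of _ "\<lambda>xs. of_rat (of_bool (l (\<rho> r) \<in> W)) * p xs"] conjI allI impI)
      fix xs assume len: "length xs = N" and r: "\<forall>i<N. xs ! i mod (K * K') = r i mod (K * K')"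
        and W: "\<forall>l\<in>E \<union> l ` R. 0 \<le> affine_form N l (nth xs) \<longleftrightarrow> l \<in> W"
      have "\<forall>i<N. xs ! i mod K' = r i mod K'" using r by (metis mod_mod_cancel dvd_triv_right)
      then have "c * q (nth xs) = affine_form N (l (\<rho> r)) (nth xs)"
        by (intro l) (simp add: \<rho>_def)
      then have "0 \<le> q (nth xs) \<longleftrightarrow> 0 \<le> affine_form N (l (\<rho> r)) (nth xs)"
        using K'(2) by (metis zero_le_mult_iff not_less order_less_le)
      also have "\<dots> \<longleftrightarrow> l (\<rho> r) \<in> W" using W \<rho>[of r] by blast
      finally have "0 \<le> q (nth xs) \<longleftrightarrow> l (\<rho> r) \<in> W" .
      then show "of_bool (0 \<le> q (nth xs)) * f (nth xs) = of_rat (of_bool (l (\<rho> r) \<in> W)) * p xs"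
        using p(2)[OF len r W] by simp
    qed (intro poly_fun_smult p)
  qed (use pos K' \<open>finite (l ` R)\<close> in auto)
  then show ?thesis by blast
qed

lemma step_poly_chamber_poly:
  assumes "f \<in> step_poly N d"
  shows "\<exists>K E. chamber_poly N d f K E"
  using assms
proof (induction rule: step_poly.induct)
  case (sp_term Cs Qs c)
  have "\<exists>K E. chamber_poly N (length Qs) (\<lambda>x. of_rat c * (\<Prod>q\<leftarrow>Qs. of_int (q x))) K E"
    using sp_term(2)
  proof (induction Qs)
    case Nil
    have "chamber_poly N 0 (\<lambda>x. of_rat c) 1 {}"
      unfolding chamber_poly_def using poly_fun_const[of N 0 c] by auto
    then show ?case by auto
  next
    case (Cons q Qs)
    then obtain K E where "chamber_poly N (length Qs) (\<lambda>x. of_rat c * (\<Prod>q\<leftarrow>Qs. of_int (q x))) K E"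
      by auto
    from chamber_poly_qa_mult[OF this, of q] Cons.prems show ?case
      by (simp add: mult.left_commute)
  qed
  then have start: "\<exists>K E. chamber_poly N d (\<lambda>x. of_rat c * (\<Prod>q\<leftarrow>Qs. of_int (q x))) K E"
    using chamber_poly_mono[OF _ sp_term(3)] by blast
  have "\<exists>K E. chamber_poly N d
      (\<lambda>x. of_bool (\<forall>q\<in>set Cs. 0 \<le> q x) * (of_rat c * (\<Prod>q\<leftarrow>Qs. of_int (q x)))) K E"
    using sp_term(1)
  proof (induction Cs)
    case Nil
    then show ?case using start by simp
  next
    case (Cons q Cs)
    then obtain K E where "chamber_poly N d
      (\<lambda>x. of_bool (\<forall>q\<in>set Cs. 0 \<le> q x) * (of_rat c * (\<Prod>q\<leftarrow>Qs. of_int (q x)))) K E"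
      by auto
    from chamber_poly_indicator_mult[OF this, of q] Cons.prems show ?case
      by (simp add: of_bool_conj mult.assoc)
  qed
  then show ?case by (simp add: mult_ac)
next
  case (sp_add f g)
  then show ?case using chamber_poly_add by blast
qed

section \<open>Polyhedral pieces and lattice cosets\<close>

lemma full_rank_lattice_multiples:
  assumes "0 < K"
  shows "full_rank_lattice N {v. length v = N \<and> (\<forall>i<N. K dvd v ! i)}"
  unfolding full_rank_lattice_def using assms by (auto intro!: exI[of _ K])

text \<open>Sign patterns on \<open>E\<close> become disjoint polyhedra, one for each subset of
  \<open>E\<close>; residue classes modulo \<open>K\<close> become the cosets of the lattice of
  multiples of \<open>K\<close>.\<close>

lemma chamber_poly_piecewise:
  assumes "chamber_poly N d f K E"
  shows "piecewise_quasipoly_deg_le N (int d) (int_polyhedron N A) (\<lambda>xs. f (nth xs))"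
proof -
  have pos: "0 < K" "finite E" using assms by (auto simp: chamber_poly_def)
  obtain P where P: "\<And>r W. poly_fun_deg_le N (int d) (P r W)"
    "\<And>r W xs. length xs = N \<Longrightarrow> (\<forall>i<N. xs ! i mod K = r i mod K) \<Longrightarrow>
        (\<forall>l\<in>E. 0 \<le> affine_form N l (nth xs) \<longleftrightarrow> l \<in> W) \<Longrightarrow> f (nth xs) = P r W xs"
    using chamber_polyD[OF assms] by metis
  obtain es where es: "set es = E" using finite_list[OF pos(2)] by blast
  obtain Ws where Ws: "set Ws = Pow E" "distinct Ws"
    using finite_distinct_list[of "Pow E"] pos(2) by auto
  \<comment> \<open>Over the integers the negation of \<open>0 \<le> l\<close> is
    \<open>l \<le> - 1\<close>, a closed inequality again; this makes the pieces disjoint and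
    polyhedral.\<close>
  define ineq where "ineq W l = (if l \<in> W then (map (\<lambda>i. - fst l i) [0..<N], snd l)
    else (map (fst l) [0..<N], - snd l - 1))" for W and l :: "(nat \<Rightarrow> int) \<times> int"
  define piece where "piece W = A @ map (ineq W) es" for W
  have ineq: "length (fst (ineq W l)) = N \<and>
      ((\<Sum>i<N. fst (ineq W l) ! i * xs ! i) \<le> snd (ineq W l) \<longleftrightarrow>
       (0 \<le> affine_form N l (nth xs) \<longleftrightarrow> l \<in> W))" for W l and xs :: "int list"
    by (auto simp: ineq_def affine_form_def sum_negf)
  have piece: "int_polyhedron N (piece W)
      = {xs \<in> int_polyhedron N A. \<forall>l\<in>E. 0 \<le> affine_form N l (nth xs) \<longleftrightarrow> l \<in> W}" for W
  proof -
    have "int_polyhedron N (piece W) = {xs \<in> int_polyhedron N A. \<forall>l\<in>set es.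
       length (fst (ineq W l)) = N \<and> (\<Sum>i<N. fst (ineq W l) ! i * xs ! i) \<le> snd (ineq W l)}"
      by (auto simp: int_polyhedron_def piece_def case_prod_beta)
    then show ?thesis using ineq es by simp
  qed
  have "(\<Union>q\<in>set (map piece Ws). int_polyhedron N q) = int_polyhedron N A"
  proof -
    have "xs \<in> (\<Union>q\<in>set (map piece Ws). int_polyhedron N q)" if "xs \<in> int_polyhedron N A" for xs
    proof -
      have "xs \<in> int_polyhedron N (piece {l \<in> E. 0 \<le> affine_form N l (nth xs)})"
        using that by (simp add: piece)
      then show ?thesis using Ws(1) by auto
    qed
    then show ?thesis using piece by auto
  qed
  moreover have "\<forall>i<length (map piece Ws). \<forall>j<length (map piece Ws). i \<noteq> j \<longrightarrow>
      int_polyhedron N (map piece Ws ! i) \<inter> int_polyhedron N (map piece Ws ! j) = {}"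
  proof (intro allI impI)
    fix i j assume ij: "i < length (map piece Ws)" "j < length (map piece Ws)" "i \<noteq> j"
    have "Ws ! i \<in> set Ws" "Ws ! j \<in> set Ws" using ij by auto
    then have "Ws ! i \<subseteq> E" "Ws ! j \<subseteq> E" unfolding Ws(1) by auto
    moreover have "Ws ! i \<noteq> Ws ! j" using Ws(2) ij by (simp add: nth_eq_iff_index_eq)
    ultimately obtain l where "l \<in> E" "l \<in> Ws ! i \<longleftrightarrow> l \<notin> Ws ! j" by blast
    then show "int_polyhedron N (map piece Ws ! i) \<inter> int_polyhedron N (map piece Ws ! j) = {}"
      using ij by (auto simp: piece)
  qed
  moreover have "\<forall>q\<in>set (map piece Ws). \<exists>g. quasipoly_deg_le N (int d) g \<and>
      (\<forall>xs\<in>int_polyhedron N q. f (nth xs) = g xs)"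
  proof
    fix q assume "q \<in> set (map piece Ws)"
    then obtain W where W: "q = piece W" by auto
    define \<rho> where "\<rho> xs = (\<lambda>i. if i < N then xs ! i mod K else 0)" for xs
    define g where "g xs = P (\<rho> xs) W xs" for xs
    have "f (nth xs) = g xs" if "xs \<in> int_polyhedron N q" for xs
    proof -
      have "length xs = N" using that by (simp add: int_polyhedron_def)
      then show ?thesis
        unfolding g_def by (rule P(2)) (use that[unfolded W piece] in \<open>auto simp: \<rho>_def\<close>)
    qed
    moreover have "quasipoly_deg_le N (int d) g"
      unfolding quasipoly_deg_le_def
    proof (intro exI conjI allI impI)
      show "full_rank_lattice N {v. length v = N \<and> (\<forall>i<N. K dvd v ! i)}"
        by (rule full_rank_lattice_multiples[OF pos(1)])
    next
      fix a :: "int list" assume a: "length a = N"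
      show "poly_fun_deg_le N (int d) (P (\<rho> a) W)" by (rule P(1))
      show "\<forall>v\<in>{v. length v = N \<and> (\<forall>i<N. K dvd v ! i)}.
          g (map2 (+) a v) = P (\<rho> a) W (map2 (+) a v)"
      proof
        fix v assume "v \<in> {v. length v = N \<and> (\<forall>i<N. K dvd v ! i)}"
        then have "\<rho> (map2 (+) a v) = \<rho> a"
          using a by (auto simp: \<rho>_def fun_eq_iff mod_eq_dvd_iff)
        then show "g (map2 (+) a v) = P (\<rho> a) W (map2 (+) a v)" by (simp add: g_def)
      qed
    qed
    ultimately show "\<exists>g. quasipoly_deg_le N (int d) g \<and> (\<forall>xs\<in>int_polyhedron N q. f (nth xs) = g xs)"
      by blast
  qed
  ultimately show ?thesis
    unfolding piecewise_quasipoly_deg_le_def by blast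
qed

lemma piecewise_quasipoly_cong:
  assumes "piecewise_quasipoly_deg_le N d D f" and "\<And>xs. xs \<in> D \<Longrightarrow> g xs = f xs"
  shows "piecewise_quasipoly_deg_le N d D g"
proof -
  obtain P where P: "(\<Union>q\<in>set P. int_polyhedron N q) = D"
    "\<forall>i<length P. \<forall>j<length P. i \<noteq> j \<longrightarrow> int_polyhedron N (P ! i) \<inter> int_polyhedron N (P ! j) = {}"
    "\<forall>q\<in>set P. \<exists>g. quasipoly_deg_le N d g \<and> (\<forall>xs\<in>int_polyhedron N q. f xs = g xs)"
    using assms(1) unfolding piecewise_quasipoly_deg_le_def by blast
  have "\<forall>q\<in>set P. \<exists>h. quasipoly_deg_le N d h \<and> (\<forall>xs\<in>int_polyhedron N q. g xs = h xs)"
  proof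
    fix q assume q: "q \<in> set P"
    then have "\<forall>xs\<in>int_polyhedron N q. g xs = f xs" using assms(2) P(1) by blast
    then show "\<exists>h. quasipoly_deg_le N d h \<and> (\<forall>xs\<in>int_polyhedron N q. g xs = h xs)"
      using P(3) q by (metis (no_types, lifting))
  qed
  with P(1,2) show ?thesis unfolding piecewise_quasipoly_deg_le_def by blast
qed

section \<open>Schur polynomials as quotients of alternants\<close>

lemma cells_conv_Sigma: "cells lam = (SIGMA i:{..<length lam}. {..<lam ! i})"
  by (auto simp: cells_def)

lemma finite_cells: "finite (cells lam)"
  by (simp add: cells_conv_Sigma)

lemma card_cells: "card (cells lam) = (\<Sum>i<length lam. lam ! i)"
  by (simp add: cells_conv_Sigma)

lemma card_cells_sum_list: "card (cells lam) = sum_list lam"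
  by (simp add: card_cells sum_list_sum_nth atLeast0LessThan)

lemma finite_ssyt: "finite (ssyt lam N)"
  using finite_set_of_finite_funs[of "cells lam" "{..<N}" 0]
  by (rule rev_finite_subset) (auto simp: ssyt_def finite_cells)

lemma ssyt_row_mono:
  assumes "T \<in> ssyt lam N" and "i < length lam" and "j \<le> j'" and "j' < lam ! i"
  shows "T (i, j) \<le> T (i, j')"
  using assms(3,4)
proof (induction j' rule: dec_induct)
  case (step k)
  then have "T (i, k) \<le> T (i, Suc k)" using assms(1,2) by (auto simp: ssyt_def)
  then show ?case using step by simp
qed simp

lemma ssyt_ge_row:
  assumes "T \<in> ssyt lam N" and "sorted_wrt (\<ge>) lam" and "(i, j) \<in> cells lam"
  shows "i \<le> T (i, j)"
  using assms(3)
proof (induction i)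
  case (Suc i)
  then have "lam ! Suc i \<le> lam ! i" "Suc i < length lam" "j < lam ! Suc i"
    using assms(2) by (auto simp: sorted_wrt_iff_nth_less cells_def)
  moreover have "T (i, j) < T (Suc i, j)"
    using assms(1) \<open>Suc i < length lam\<close> \<open>j < lam ! Suc i\<close> by (auto simp: ssyt_def)
  ultimately show ?case using Suc.IH by (auto simp: cells_def)
qed simp

text \<open>Shapes left after removing a horizontal strip. One row disappears: with
  \<open>Suc N\<close> rows and entries below \<open>Suc N\<close>, strict columns force every entry
  of the last row to be \<open>N\<close>.\<close>

definition interlacing :: "nat list \<Rightarrow> nat list set" where
  "interlacing lam = {mu. length mu = length lam - 1 \<and>
     (\<forall>i<length lam - 1. lam ! Suc i \<le> mu ! i \<and> mu ! i \<le> lam ! i)}"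

lemma initial_segment_card:
  fixes A :: "nat set"
  assumes "finite A" and "\<And>i j. j \<in> A \<Longrightarrow> i \<le> j \<Longrightarrow> i \<in> A"
  shows "A = {..<card A}"
proof (cases "A = {}")
  case False
  have "A = {..Max A}" using assms(1) assms(2)[OF Max_in[OF assms(1) False]] by auto
  then show ?thesis by (metis card_atMost lessThan_Suc_atMost)
qed simp

definition branch_shape :: "nat list \<Rightarrow> nat \<Rightarrow> (nat \<times> nat \<Rightarrow> nat) \<Rightarrow> nat list" where
  "branch_shape lam N T = map (\<lambda>i. card {j. j < lam ! i \<and> T (i, j) < N}) [0..<N]"

text \<open>Weakly increasing rows make the entries below \<open>N\<close> an initial segment of
  each row, and row \<open>N\<close> has none since entries in row \<open>i\<close> are at least
  \<open>i\<close>. So the row counts describe the cells exactly.\<close>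

lemma cells_branch_shape:
  assumes T: "T \<in> ssyt lam (Suc N)" and len: "length lam = Suc N" and "sorted_wrt (\<ge>) lam"
  shows "cells (branch_shape lam N T) = {c \<in> cells lam. T c < N}"
proof -
  have row: "{j. j < lam ! i \<and> T (i, j) < N} = {..<branch_shape lam N T ! i}" if "i < N" for i
  proof -
    have "{j. j < lam ! i \<and> T (i, j) < N} = {..<card {j. j < lam ! i \<and> T (i, j) < N}}"
    proof (rule initial_segment_card)
      fix j k assume k: "k \<in> {j. j < lam ! i \<and> T (i, j) < N}" and "j \<le> k"
      then have "T (i, j) \<le> T (i, k)" using ssyt_row_mono[OF T, of i j k] that len by simp
      then show "j \<in> {j. j < lam ! i \<and> T (i, j) < N}" using k \<open>j \<le> k\<close> by simp
    qed simp
    then show ?thesis using that by (simp add: branch_shape_def)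
  qed
  have "T (i, j) < N \<Longrightarrow> (i, j) \<in> cells lam \<Longrightarrow> i < N" for i j
    using ssyt_ge_row[OF T assms(3), of i j] by simp
  moreover have "(i, j) \<in> cells (branch_shape lam N T) \<longleftrightarrow> i < N \<and> j < lam ! i \<and> T (i, j) < N" for i j
  proof -
    have "(i, j) \<in> cells (branch_shape lam N T) \<longleftrightarrow> i < N \<and> j \<in> {..<branch_shape lam N T ! i}"
      by (simp add: cells_def branch_shape_def)
    then show ?thesis using row[of i] by blast
  qed
  ultimately have "(i, j) \<in> cells (branch_shape lam N T) \<longleftrightarrow> (i, j) \<in> cells lam \<and> T (i, j) < N" for i j
    using len by (force simp: cells_def)
  then show ?thesis by auto
qed

text \<open>The cells with entry \<open>N\<close> form a horizontal strip. Deleting them is a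
  bijection onto the tableaux of interlacing shape, with inverse given by filling the strip with
  \<open>N\<close>.\<close>

lemma schur_branching:
  assumes len: "length lam = Suc N" and dec: "sorted_wrt (\<ge>) lam"
  shows "schur lam (Suc N) x
    = (\<Sum>mu\<in>interlacing lam. schur mu N x * x N ^ (sum_list lam - sum_list mu))"
proof -
  define restr where "restr T = (branch_shape lam N T,
    \<lambda>c. if c \<in> cells (branch_shape lam N T) then T c else 0)" for T
  define ext where "ext = (\<lambda>(mu, T') c. if c \<in> cells mu then T' c else if c \<in> cells lam then N else (0::nat))"
  have fin: "finite (interlacing lam)"
  proof (rule finite_subset)
    show "interlacing lam \<subseteq> {mu. set mu \<subseteq> {..sum_list lam} \<and> length mu = N}"
    proof
      fix mu assume mu: "mu \<in> interlacing lam"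
      have "mu ! i \<le> sum_list lam" if "i < N" for i
        using mu that len elem_le_sum_list[of i lam] by (force simp: interlacing_def)
      then show "mu \<in> {mu. set mu \<subseteq> {..sum_list lam} \<and> length mu = N}"
        using mu len by (auto simp: interlacing_def in_set_conv_nth)
    qed
  qed (simp add: finite_lists_length_eq)
  have sub: "cells mu \<subseteq> cells lam" if "mu \<in> interlacing lam" for mu
    using that len by (fastforce simp: interlacing_def cells_def)
  have "schur lam (Suc N) x = (\<Sum>(mu, T')\<in>(SIGMA mu:interlacing lam. ssyt mu N).
      (\<Prod>c\<in>cells mu. x (T' c)) * x N ^ (sum_list lam - sum_list mu))"
    unfolding schur_def
  proof (rule sum.reindex_bij_witness[of _ ext restr])
    fix T assume T: "T \<in> ssyt lam (Suc N)"
    let ?mu = "branch_shape lam N T"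
    note cells = cells_branch_shape[OF T len dec]
    have len': "length ?mu = N" by (simp add: branch_shape_def)
    have "?mu ! i \<le> lam ! i" "lam ! Suc i \<le> ?mu ! i" if "i < N" for i
    proof -
      have "?mu ! i \<le> card {..<lam ! i}"
        using that card_mono[of "{..<lam ! i}" "{j. j < lam ! i \<and> T (i, j) < N}"]
        by (auto simp: branch_shape_def)
      then show "?mu ! i \<le> lam ! i" by simp
      \<comment> \<open>A cell with another one below it carries an entry smaller than
        \<open>N\<close>, hence survives the deletion: the lower interlacing bound.\<close>
      have "j < ?mu ! i" if j: "j < lam ! Suc i" for j
      proof -
        have "(Suc i, j) \<in> cells lam" "(i, j) \<in> cells lam"
          using j \<open>i < N\<close> len dec by (auto simp: cells_def sorted_wrt_iff_nth_less order_less_le_trans)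
        moreover have "T (i, j) < T (Suc i, j)" "T (Suc i, j) < Suc N"
          using T j \<open>i < N\<close> len by (auto simp: ssyt_def cells_def)
        ultimately have "(i, j) \<in> cells ?mu" using cells by auto
        then show ?thesis by (simp add: cells_def)
      qed
      then show "lam ! Suc i \<le> ?mu ! i" by (meson not_le less_irrefl)
    qed
    then have inter: "?mu \<in> interlacing lam" using len len' by (simp add: interlacing_def)
    have "(\<lambda>c. if c \<in> cells ?mu then T c else 0) \<in> ssyt ?mu N"
    proof -
      have row: "T (i, j) \<le> T (i, Suc j)" if "i < length ?mu" "Suc j < ?mu ! i" for i j
        using that T ssyt_row_mono[OF T, of i j "Suc j"] len len' \<open>\<And>i. i < N \<Longrightarrow> ?mu ! i \<le> lam ! i\<close>[of i]
        by auto
      have col: "T (i, j) < T (Suc i, j)" if "Suc i < length ?mu" "j < ?mu ! Suc i" for i j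
        using that T len len' \<open>\<And>i. i < N \<Longrightarrow> ?mu ! i \<le> lam ! i\<close>[of "Suc i"] by (auto simp: ssyt_def)
      have up: "(i, j) \<in> cells ?mu" if "Suc i < length ?mu" "j < ?mu ! Suc i" for i j
      proof -
        have "?mu ! Suc i \<le> lam ! Suc i" "lam ! Suc i \<le> ?mu ! i"
          using inter that len' len by (auto simp: interlacing_def)
        then show ?thesis using that by (auto simp: cells_def)
      qed
      have "\<forall>i j. i < length ?mu \<and> Suc j < ?mu ! i \<longrightarrow> (i, j) \<in> cells ?mu \<and> (i, Suc j) \<in> cells ?mu"
        "\<forall>i j. Suc i < length ?mu \<and> j < ?mu ! Suc i \<longrightarrow> (Suc i, j) \<in> cells ?mu"
        by (auto simp: cells_def)
      moreover have "\<forall>c\<in>cells ?mu. T c < N" using cells by simp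
      ultimately show ?thesis using row col up unfolding ssyt_def by simp
    qed
    with inter show "restr T \<in> (SIGMA mu:interlacing lam. ssyt mu N)" by (simp add: restr_def)
    show "ext (restr T) = T"
    proof
      fix c
      have "T c = N" if "c \<in> cells lam" "c \<notin> cells ?mu"
        using that T cells by (auto simp: ssyt_def less_Suc_eq)
      moreover have "T c = 0" if "c \<notin> cells lam" using that T by (cases c) (simp add: ssyt_def)
      ultimately show "ext (restr T) c = T c" using cells by (auto simp: ext_def restr_def)
    qed
    have "(\<Prod>c\<in>cells lam. x (T c)) = (\<Prod>c\<in>cells ?mu. x (T c)) * (\<Prod>c\<in>cells lam - cells ?mu. x (T c))"
      using prod.subset_diff[OF sub[OF inter] finite_cells, of "\<lambda>c. x (T c)"] by (simp add: mult.commute)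
    also have "(\<Prod>c\<in>cells lam - cells ?mu. x (T c)) = (\<Prod>c\<in>cells lam - cells ?mu. x N)"
      using T cells by (intro prod.cong) (auto simp: ssyt_def less_Suc_eq)
    also have "\<dots> = x N ^ (sum_list lam - sum_list ?mu)"
      by (simp add: card_Diff_subset[OF finite_cells sub[OF inter]] card_cells_sum_list)
    finally show "(case restr T of (mu, T') \<Rightarrow> (\<Prod>c\<in>cells mu. x (T' c)) * x N ^ (sum_list lam - sum_list mu))
        = (\<Prod>c\<in>cells lam. x (T c))"
      by (simp add: restr_def)
  next
    fix a assume "a \<in> (SIGMA mu:interlacing lam. ssyt mu N)"
    then obtain mu T' where a: "a = (mu, T')" and mu: "mu \<in> interlacing lam" and T': "T' \<in> ssyt mu N"
      by auto
    define T where "T = ext a"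
    have len': "length mu = N" using mu len by (simp add: interlacing_def)
    have le: "mu ! i \<le> lam ! i" "lam ! Suc i \<le> mu ! i" if "i < N" for i
      using mu that len by (auto simp: interlacing_def)
    have T_mu: "T c = T' c" "T c < N" if "c \<in> cells mu" for c
      using that T' by (auto simp: T_def ext_def a ssyt_def)
    have T_out: "T c = N" if "c \<in> cells lam" "c \<notin> cells mu" for c
      using that by (simp add: T_def ext_def a)
    have T_le: "T c \<le> N" for c using T' by (auto simp: T_def ext_def a ssyt_def less_imp_le)
    have "T \<in> ssyt lam (Suc N)"
    proof -
      have "T c = 0" if "c \<notin> cells lam" for c
        using that sub[OF mu] by (auto simp: T_def ext_def a)
      moreover have "T (i, j) \<le> T (i, Suc j)" if "i < length lam" "Suc j < lam ! i" for i j
      proof (cases "(i, Suc j) \<in> cells mu")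
        case True
        then have "i < length mu" "Suc j < mu ! i" "(i, j) \<in> cells mu" by (auto simp: cells_def)
        then show ?thesis using T' True T_mu by (auto simp: ssyt_def)
      next
        case False
        then show ?thesis using T_out[of "(i, Suc j)"] T_le that by (simp add: cells_def)
      qed
      moreover have "T (i, j) < T (Suc i, j)" if "Suc i < length lam" "j < lam ! Suc i" for i j
      proof -
        have ij: "(i, j) \<in> cells mu" using le(2)[of i] that len len' by (simp add: cells_def)
        show ?thesis
        proof (cases "(Suc i, j) \<in> cells mu")
          case True
          then have "Suc i < length mu" "j < mu ! Suc i" by (auto simp: cells_def)
          then show ?thesis using T' True T_mu(1)[OF True] T_mu(1)[OF ij] by (auto simp: ssyt_def)
        next
          case False
          then show ?thesis using T_out[of "(Suc i, j)"] T_mu(2)[OF ij] that by (simp add: cells_def)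
        qed
      qed
      ultimately show ?thesis using T_le by (auto simp: ssyt_def less_Suc_eq_le)
    qed
    then show "ext a \<in> ssyt lam (Suc N)" by (simp add: T_def)
    have "branch_shape lam N T = mu"
    proof (rule nth_equalityI)
      fix i assume "i < length (branch_shape lam N T)"
      then have i: "i < N" by (simp add: branch_shape_def)
      have "{j. j < lam ! i \<and> T (i, j) < N} = {..<mu ! i}"
      proof (intro Set.set_eqI iffI)
        fix j assume "j \<in> {j. j < lam ! i \<and> T (i, j) < N}"
        then show "j \<in> {..<mu ! i}" using T_out[of "(i, j)"] i len len' by (force simp: cells_def)
      next
        fix j assume "j \<in> {..<mu ! i}"
        then show "j \<in> {j. j < lam ! i \<and> T (i, j) < N}"
          using T_mu[of "(i, j)"] i len' le(1)[of i] by (auto simp: cells_def)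
      qed
      then show "branch_shape lam N T ! i = mu ! i" using i by (simp add: branch_shape_def)
    qed (simp add: branch_shape_def len')
    moreover have "(\<lambda>c. if c \<in> cells mu then T c else 0) = T'"
      using T' T_mu by (auto simp: ssyt_def)
    ultimately show "restr (ext a) = a" unfolding T_def[symmetric] restr_def by (simp add: a)
  qed
  also have "\<dots> = (\<Sum>mu\<in>interlacing lam. \<Sum>T'\<in>ssyt mu N.
      (\<Prod>c\<in>cells mu. x (T' c)) * x N ^ (sum_list lam - sum_list mu))"
    by (rule sum.Sigma[symmetric]) (use fin in \<open>auto simp: finite_ssyt\<close>)
  finally show ?thesis by (simp add: schur_def sum_distrib_right)
qed

section \<open>Alternants and their branching rule\<close>

definition alternant :: "nat \<Rightarrow> (nat \<Rightarrow> nat) \<Rightarrow> (nat \<Rightarrow> real) \<Rightarrow> real" where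
  "alternant N e x = (\<Sum>p | p permutes {..<N}. of_int (sign p) * (\<Prod>i<N. x i ^ e (p i)))"

definition vandermonde :: "nat \<Rightarrow> (nat \<Rightarrow> real) \<Rightarrow> real" where
  "vandermonde N x = (\<Prod>(i, j)\<in>{(i, j). i < j \<and> j < N}. x i - x j)"

definition staircase :: "nat \<Rightarrow> nat list \<Rightarrow> nat \<Rightarrow> nat" where
  "staircase N lam j = lam ! j + (N - 1 - j)"

lemma det_leibniz:
  "det (mat N N (\<lambda>(i, j). f i j)) = (\<Sum>p | p permutes {..<N}. of_int (sign p) * (\<Prod>i<N. f i (p i)))"
proof -
  have "p i < N" if "p permutes {..<N}" "i < N" for p i using permutes_in_image[OF that(1)] that(2) by auto
  then show ?thesis
    by (subst det_def'[of _ N]) (auto simp: atLeast0LessThan intro!: sum.cong prod.cong)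
qed

lemma alternant_det: "alternant N e x = det (mat N N (\<lambda>(i, j). x i ^ e j))"
  by (simp add: alternant_def det_leibniz[of N "\<lambda>i j. x i ^ e j"])

lemma geometric_sum_product:
  fixes a b :: real
  assumes "p \<le> q"
  shows "(a - b) * (\<Sum>u=p..q. a ^ u * b ^ (q - u)) = a ^ Suc q - a ^ p * b ^ (Suc q - p)"
  using assms
proof (induction q rule: dec_induct)
  case base
  show ?case by (simp add: algebra_simps)
next
  case (step q)
  have "(\<Sum>u=p..Suc q. a ^ u * b ^ (Suc q - u)) = b * (\<Sum>u=p..q. a ^ u * b ^ (q - u)) + a ^ Suc q"
    using step.hyps by (simp add: sum_distrib_left Suc_diff_le mult_ac)
  then have "(a - b) * (\<Sum>u=p..Suc q. a ^ u * b ^ (Suc q - u))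
      = b * ((a - b) * (\<Sum>u=p..q. a ^ u * b ^ (q - u))) + (a - b) * a ^ Suc q"
    by (simp add: algebra_simps)
  also have "\<dots> = a ^ Suc (Suc q) - a ^ p * b ^ Suc (Suc q - p)"
    unfolding step.IH by (simp add: algebra_simps)
  finally show ?case using step.hyps by (simp add: Suc_diff_le)
qed

text \<open>The interlacing bounds on different rows are independent of each other, so the set is a
  product of intervals.\<close>

lemma sum_interlacing_prod:
  fixes k :: "nat \<Rightarrow> nat \<Rightarrow> real"
  assumes "length lam = Suc N"
  shows "(\<Sum>mu\<in>interlacing lam. \<Prod>j<N. k j (mu ! j)) = (\<Prod>j<N. \<Sum>u=lam ! Suc j..lam ! j. k j u)"
proof -
  have "(\<Sum>mu\<in>interlacing lam. \<Prod>j<N. k j (mu ! j))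
      = (\<Sum>g\<in>PiE {..<N} (\<lambda>j. {lam ! Suc j..lam ! j}). \<Prod>j<N. k j (g j))"
    by (rule sum.reindex_bij_witness[of _ "\<lambda>g. map g [0..<N]" "\<lambda>mu. restrict (nth mu) {..<N}"])
      (use assms in \<open>auto simp: interlacing_def PiE_iff extensional_def fun_eq_iff intro!: nth_equalityI prod.cong\<close>)
  then show ?thesis by (simp add: prod_sum_PiE)
qed

text \<open>Subtracting multiples of the next column clears the last row.\<close>

lemma alternant_last_row:
  assumes "\<And>j. j < N \<Longrightarrow> L (Suc j) \<le> L j"
  shows "alternant (Suc N) L x
    = x N ^ L N * det (mat N N (\<lambda>(i, j). x i ^ L j - x i ^ L (Suc j) * x N ^ (L j - L (Suc j))))"
proof -
  define A where "A = mat (Suc N) (Suc N) (\<lambda>(i, j). x i ^ L j)"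
  define U where "U = mat (Suc N) (Suc N)
    (\<lambda>(k, j). if k = j then 1 else if k = Suc j then - (x N ^ (L j - L (Suc j))) else 0)"
  define B where "B = A * U"
  have [simp]: "A \<in> carrier_mat (Suc N) (Suc N)" "U \<in> carrier_mat (Suc N) (Suc N)"
    "B \<in> carrier_mat (Suc N) (Suc N)"
    by (auto simp: A_def U_def B_def)
  have B: "B $$ (i, j) = x i ^ L j - (if j < N then x i ^ L (Suc j) * x N ^ (L j - L (Suc j)) else 0)"
    if "i < Suc N" "j < Suc N" for i j
  proof -
    have "B $$ (i, j) = (\<Sum>k=0..<Suc N. A $$ (i, k) * U $$ (k, j))"
      using that by (auto simp: B_def A_def U_def scalar_prod_def)
    also have "\<dots> = (\<Sum>k<Suc N. (if k = j then x i ^ L k else 0)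
        + (if k = Suc j then - (x i ^ L k * x N ^ (L j - L (Suc j))) else 0))"
      unfolding atLeast0LessThan by (rule sum.cong) (use that in \<open>auto simp: A_def U_def\<close>)
    also have "\<dots> = x i ^ L j - (if j < N then x i ^ L (Suc j) * x N ^ (L j - L (Suc j)) else 0)"
      using that by (simp add: sum.distrib del: sum.lessThan_Suc)
    finally show ?thesis .
  qed
  have "det U = prod_list (diag_mat U)"
    by (rule det_lower_triangular[of "Suc N"]) (auto simp: U_def)
  also have "diag_mat U = map (\<lambda>_. 1) [0..<Suc N]"
    unfolding diag_mat_def by (rule map_cong) (auto simp: U_def)
  also have "prod_list \<dots> = 1" by (simp add: map_replicate_const)
  finally have "det U = 1" .
  then have "det A = det B" unfolding B_def by (subst det_mult[of _ "Suc N"]) auto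
  also have "\<dots> = (\<Sum>j<Suc N. B $$ (N, j) * cofactor B N j)"
    by (rule laplace_expansion_row) auto
  also have "\<dots> = B $$ (N, N) * cofactor B N N"
  proof -
    have "B $$ (N, j) = 0" if "j < N" for j
      using that assms[OF that] by (simp add: B power_add[symmetric])
    then show ?thesis by simp
  qed
  also have "\<dots> = x N ^ L N * det (mat_delete B N N)"
    by (simp add: B cofactor_def flip: mult_2)
  also have "mat_delete B N N
      = mat N N (\<lambda>(i, j). x i ^ L j - x i ^ L (Suc j) * x N ^ (L j - L (Suc j)))"
    by (rule eq_matI) (auto simp: mat_delete_def B carrier_matD[of B "Suc N" "Suc N"])
  finally show ?thesis by (simp add: alternant_det A_def)
qed

lemma sum_list_interlacing_diff:
  assumes "length lam = Suc N" and "mu \<in> interlacing lam"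
  shows "sum_list lam - sum_list mu = lam ! N + (\<Sum>j<N. lam ! j - mu ! j)"
proof -
  have mu: "length mu = N" "\<And>j. j < N \<Longrightarrow> mu ! j \<le> lam ! j"
    using assms by (auto simp: interlacing_def)
  have "sum_list lam = lam ! N + (\<Sum>j<N. lam ! j)" "sum_list mu = (\<Sum>j<N. mu ! j)"
    using assms(1) mu(1) by (auto simp: sum_list_sum_nth atLeast0LessThan)
  moreover have "(\<Sum>j<N. lam ! j - mu ! j) = (\<Sum>j<N. lam ! j) - (\<Sum>j<N. mu ! j)"
    by (rule sum_subtractf_nat) (use mu in auto)
  moreover have "(\<Sum>j<N. mu ! j) \<le> (\<Sum>j<N. lam ! j)" by (rule sum_mono) (use mu in auto)
  ultimately show ?thesis by simp
qed

text \<open>In each Leibniz term the sum over \<open>mu\<close> factors into geometric sums, one per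
  row. Multiplied by \<open>x i - x N\<close> they collapse to two-term entries, which are exactly
  those of the determinant obtained by clearing the last row.\<close>

lemma alternant_branching:
  assumes len: "length lam = Suc N" and dec: "sorted_wrt (\<ge>) lam"
  shows "(\<Prod>i<N. x i - x N)
      * (\<Sum>mu\<in>interlacing lam. alternant N (staircase N mu) x * x N ^ (sum_list lam - sum_list mu))
    = alternant (Suc N) (staircase (Suc N) lam) x"
proof -
  let ?L = "staircase (Suc N) lam"
  have step: "lam ! Suc j \<le> lam ! j" if "j < N" for j
    using dec len that by (simp add: sorted_wrt_iff_nth_less)
  \<comment> \<open>The power of \<open>x N\<close> is spread over the rows,
    \<open>lam ! j - mu ! j\<close> for row \<open>j\<close>; the part \<open>lam ! N\<close> of the
    removed row stays in front.\<close>
  define h where "h i j u = x i ^ (u + (N - 1 - j)) * x N ^ (lam ! j - u)" for i j u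
  define H where "H i j = (\<Sum>u=lam ! Suc j..lam ! j. h i j u)" for i j
  have expand: "alternant N (staircase N mu) x * x N ^ (sum_list lam - sum_list mu)
      = x N ^ (lam ! N) * (\<Sum>p | p permutes {..<N}. of_int (sign p) * (\<Prod>i<N. h i (p i) (mu ! p i)))"
    if "mu \<in> interlacing lam" for mu
  proof -
    have "of_int (sign p) * (\<Prod>i<N. x i ^ staircase N mu (p i)) * (\<Prod>j<N. x N ^ (lam ! j - mu ! j))
        = of_int (sign p) * (\<Prod>i<N. h i (p i) (mu ! p i))" if "p permutes {..<N}" for p
      using prod.permute[OF that, of "\<lambda>j. x N ^ (lam ! j - mu ! j)"]
      by (simp add: h_def prod.distrib staircase_def mult.assoc)
    then show ?thesis
      by (simp add: sum_list_interlacing_diff[OF len that] power_add power_sum alternant_def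
          sum_distrib_left sum_distrib_right mult_ac)
  qed
  have swap: "(\<Sum>mu\<in>interlacing lam. \<Prod>i<N. h i (p i) (mu ! p i)) = (\<Prod>i<N. H i (p i))"
    if p: "p permutes {..<N}" for p
  proof -
    have "(\<Prod>i<N. h i (p i) (mu ! p i)) = (\<Prod>j<N. h (inv_into UNIV p j) j (mu ! j))" for mu
      using prod.permute[OF p, of "\<lambda>j. h (inv_into UNIV p j) j (mu ! j)"] by (simp add: permutes_inverses[OF p])
    moreover have "(\<Prod>i<N. H i (p i)) = (\<Prod>j<N. H (inv_into UNIV p j) j)"
      using prod.permute[OF p, of "\<lambda>j. H (inv_into UNIV p j) j"] by (simp add: permutes_inverses[OF p])
    ultimately show ?thesis
      by (simp add: sum_interlacing_prod[OF len, of "\<lambda>j u. h (inv_into UNIV p j) j u"] H_def)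
  qed
  have "(\<Sum>mu\<in>interlacing lam. alternant N (staircase N mu) x * x N ^ (sum_list lam - sum_list mu))
      = x N ^ (lam ! N) * (\<Sum>p | p permutes {..<N}. of_int (sign p) *
          (\<Sum>mu\<in>interlacing lam. \<Prod>i<N. h i (p i) (mu ! p i)))"
  proof -
    have "(\<Sum>mu\<in>interlacing lam. \<Sum>p | p permutes {..<N}. of_int (sign p) * (\<Prod>i<N. h i (p i) (mu ! p i)))
        = (\<Sum>p | p permutes {..<N}. of_int (sign p) * (\<Sum>mu\<in>interlacing lam. \<Prod>i<N. h i (p i) (mu ! p i)))"
      by (subst sum.swap) (simp add: sum_distrib_left)
    then show ?thesis by (simp add: expand sum_distrib_left[symmetric] cong: sum.cong)
  qed
  also have "\<dots> = x N ^ (lam ! N) * (\<Sum>p | p permutes {..<N}. of_int (sign p) * (\<Prod>i<N. H i (p i)))"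
    by (intro arg_cong2[where f = "(*)"] refl sum.cong swap) simp
  finally have "(\<Prod>i<N. x i - x N)
      * (\<Sum>mu\<in>interlacing lam. alternant N (staircase N mu) x * x N ^ (sum_list lam - sum_list mu))
    = x N ^ (lam ! N) * (\<Sum>p | p permutes {..<N}. of_int (sign p) * (\<Prod>i<N. (x i - x N) * H i (p i)))"
    by (simp add: prod.distrib sum_distrib_left mult_ac)
  also have "(\<Sum>p | p permutes {..<N}. of_int (sign p) * (\<Prod>i<N. (x i - x N) * H i (p i)))
    = det (mat N N (\<lambda>(i, j). x i ^ ?L j - x i ^ ?L (Suc j) * x N ^ (?L j - ?L (Suc j))))"
    unfolding det_leibniz
  proof (intro sum.cong refl arg_cong2[where f = "(*)"] prod.cong)
    fix p i assume "p \<in> {p. p permutes {..<N}}" "i \<in> {..<N}"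
    then have j: "p i < N" using permutes_in_image[of p "{..<N}" i] by simp
    define j where "j = p i"
    have jN: "j < N" using j by (simp add: j_def)
    have L: "?L j = (N - 1 - j) + Suc (lam ! j)" "?L (Suc j) = (N - 1 - j) + lam ! Suc j"
      using jN by (auto simp: staircase_def)
    have "(x i - x N) * H i j = x i ^ (N - 1 - j) *
        ((x i - x N) * (\<Sum>u=lam ! Suc j..lam ! j. x i ^ u * x N ^ (lam ! j - u)))"
      by (simp add: H_def h_def power_add sum_distrib_left mult_ac)
    also have "\<dots> = x i ^ (N - 1 - j) * (x i ^ Suc (lam ! j) - x i ^ (lam ! Suc j) * x N ^ (Suc (lam ! j) - lam ! Suc j))"
      by (simp only: geometric_sum_product[OF step[OF jN]])
    also have "\<dots> = x i ^ ?L j - x i ^ ?L (Suc j) * x N ^ (?L j - ?L (Suc j))"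
      unfolding L by (simp add: power_add right_diff_distrib mult.assoc)
    finally show "(x i - x N) * H i (p i) = x i ^ ?L (p i) - x i ^ ?L (Suc (p i)) * x N ^ (?L (p i) - ?L (Suc (p i)))"
      by (simp only: j_def)
  qed
  also have "x N ^ (lam ! N) * \<dots> = alternant (Suc N) ?L x"
    by (subst alternant_last_row) (use step in \<open>auto simp: staircase_def\<close>, fastforce simp: staircase_def)
  finally show ?thesis .
qed

section \<open>The bialternant formula\<close>

lemma finite_pairs_less: "finite {(i, j). i < j \<and> j < (N :: nat)}"
  by (rule finite_subset[of _ "{..<N} \<times> {..<N}"]) auto

lemma vandermonde_Suc: "vandermonde (Suc N) x = vandermonde N x * (\<Prod>i<N. x i - x N)"
proof -
  have "{(i, j). i < j \<and> j < Suc N} = {(i, j). i < j \<and> j < N} \<union> (\<lambda>i. (i, N)) ` {..<N}"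
    by auto
  then have "vandermonde (Suc N) x = vandermonde N x * (\<Prod>(i, j)\<in>(\<lambda>i. (i, N)) ` {..<N}. x i - x j)"
    unfolding vandermonde_def by (simp only:) (rule prod.union_disjoint, auto simp: finite_pairs_less)
  also have "(\<Prod>(i, j)\<in>(\<lambda>i. (i, N)) ` {..<N}. x i - x j) = (\<Prod>i<N. x i - x N)"
    by (subst prod.reindex) (auto simp: inj_on_def)
  finally show ?thesis .
qed

lemma sorted_interlacing:
  assumes "mu \<in> interlacing lam"
  shows "sorted_wrt (\<ge>) mu"
  using assms unfolding interlacing_def
  by (auto simp: sorted_wrt_iff_nth_Suc_transp transp_on_def)
    (metis Suc_lessD order_trans)

text \<open>Both sides obey the same branching rule in the last variable: the product of the
  \<open>x i - x N\<close> is the ratio of consecutive Vandermonde products.\<close>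

theorem schur_bialternant:
  assumes "length lam = N" and "sorted_wrt (\<ge>) lam"
  shows "schur lam N x * vandermonde N x = alternant N (staircase N lam) x"
  using assms
proof (induction N arbitrary: lam)
  case 0
  have "ssyt [] 0 = {\<lambda>_. 0}" by (auto simp: ssyt_def cells_def)
  then show ?case using 0 by (simp add: schur_def vandermonde_def alternant_def cells_def sign_id)
next
  case (Suc N)
  have "schur mu N x * vandermonde N x = alternant N (staircase N mu) x"
    if "mu \<in> interlacing lam" for mu
    using Suc.IH[OF _ sorted_interlacing[OF that]] that Suc.prems(1) by (simp add: interlacing_def)
  then have "(\<Prod>i<N. x i - x N)
      * (\<Sum>mu\<in>interlacing lam. schur mu N x * vandermonde N x * x N ^ (sum_list lam - sum_list mu))
    = alternant (Suc N) (staircase (Suc N) lam) x"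
    by (simp add: alternant_branching[OF Suc.prems, symmetric] cong: sum.cong)
  then show ?case
    by (simp add: schur_branching[OF Suc.prems] vandermonde_Suc sum_distrib_left sum_distrib_right mult_ac)
qed

lemma schur_zero: "schur (replicate N 0) N x = 1"
proof -
  have c: "cells (replicate N 0) = {}" by (auto simp: cells_def)
  have "ssyt (replicate N 0) N = {\<lambda>_. 0}" by (auto simp: ssyt_def c)
  then show ?thesis by (simp add: schur_def c)
qed

text \<open>The bialternant formula for the empty partition, whose Schur polynomial is 1.\<close>

lemma vandermonde_alternant: "vandermonde N x = alternant N (\<lambda>j. N - 1 - j) x"
proof -
  have "vandermonde N x = alternant N (staircase N (replicate N 0)) x"
    using schur_bialternant[of "replicate N 0" N x]
    by (simp add: schur_zero sorted_wrt_iff_nth_less)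
  also have "\<dots> = alternant N (\<lambda>j. N - 1 - j) x"
    unfolding alternant_def
  proof (intro sum.cong refl arg_cong2[where f = "(*)"] prod.cong)
    fix p i assume "p \<in> {p. p permutes {..<N}}" "i \<in> {..<N}"
    then have "p i < N" using permutes_in_image[of p "{..<N}" i] by simp
    then show "x i ^ staircase N (replicate N 0) (p i) = x i ^ (N - 1 - p i)"
      by (simp add: staircase_def)
  qed
  finally show ?thesis .
qed

section \<open>Expanding symmetric polynomials in Schur polynomials\<close>

lemma alternant_cong:
  assumes "\<And>j. j < N \<Longrightarrow> e j = e' j" and "\<And>j. j < N \<Longrightarrow> x j = x' j"
  shows "alternant N e x = alternant N e' x'"
  unfolding alternant_def
proof (intro sum.cong refl arg_cong2[where f = "(*)"] prod.cong)
  fix p i assume "p \<in> {p. p permutes {..<N}}" "i \<in> {..<N}"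
  then have "p i < N" "i < N" using permutes_in_image[of p "{..<N}" i] by auto
  then show "x i ^ e (p i) = x' i ^ e' (p i)" using assms by simp
qed

lemma sign_compose_lessThan:
  assumes "p permutes {..<N :: nat}" and "q permutes {..<N}"
  shows "sign (p \<circ> q) = sign p * sign q"
  using assms by (intro sign_compose) (auto intro: permutation_permutes[THEN iffD2])

lemma alternant_permute_variables:
  assumes "\<pi> permutes {..<N}"
  shows "alternant N e (x \<circ> \<pi>) = of_int (sign \<pi>) * alternant N e x"
proof -
  have "alternant N e (x \<circ> \<pi>)
      = (\<Sum>p | p permutes {..<N}. of_int (sign (p \<circ> \<pi>)) * (\<Prod>i<N. x (\<pi> i) ^ e ((p \<circ> \<pi>) i)))"
    unfolding alternant_def comp_def[of x] by (rule sum_permutations_compose_right[OF assms])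
  also have "\<dots> = (\<Sum>p | p permutes {..<N}. of_int (sign \<pi>) * (of_int (sign p) * (\<Prod>i<N. x i ^ e (p i))))"
  proof (rule sum.cong)
    fix p assume "p \<in> {p. p permutes {..<N}}"
    moreover have "(\<Prod>i<N. x (\<pi> i) ^ e ((p \<circ> \<pi>) i)) = (\<Prod>i<N. x i ^ e (p i))"
      using prod.permute[OF assms, of "\<lambda>i. x i ^ e (p i)"] by simp
    ultimately show "of_int (sign (p \<circ> \<pi>)) * (\<Prod>i<N. x (\<pi> i) ^ e ((p \<circ> \<pi>) i))
        = of_int (sign \<pi>) * (of_int (sign p) * (\<Prod>i<N. x i ^ e (p i)))"
      by (simp add: sign_compose_lessThan[OF _ assms])
  qed simp
  finally show ?thesis by (simp add: alternant_def sum_distrib_left)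
qed

lemma alternant_permute_exponents:
  assumes "\<pi> permutes {..<N}"
  shows "alternant N (e \<circ> \<pi>) x = of_int (sign \<pi>) * alternant N e x"
proof -
  have "of_int (sign \<pi>) * alternant N e x
      = (\<Sum>p | p permutes {..<N}. of_int (sign \<pi>) * (of_int (sign (\<pi> \<circ> p)) * (\<Prod>i<N. x i ^ e ((\<pi> \<circ> p) i))))"
    unfolding alternant_def sum_distrib_left
    by (rule setum_permutations_compose_left[OF assms])
  also have "\<dots> = alternant N (e \<circ> \<pi>) x"
    unfolding alternant_def
  proof (rule sum.cong)
    fix p assume "p \<in> {p. p permutes {..<N}}"
    moreover have "real_of_int (sign \<pi>) * of_int (sign \<pi>) = 1"
      by (metis of_int_1 of_int_mult sign_idempotent)
    ultimately show "of_int (sign \<pi>) * (of_int (sign (\<pi> \<circ> p)) * (\<Prod>i<N. x i ^ e ((\<pi> \<circ> p) i)))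
        = of_int (sign p) * (\<Prod>i<N. x i ^ (e \<circ> \<pi>) (p i))"
      by (simp add: sign_compose_lessThan[OF assms] mult.assoc[symmetric])
  qed simp
  finally show ?thesis by simp
qed

lemma alternant_not_inj:
  assumes "\<not> inj_on e {..<N}"
  shows "alternant N e x = 0"
proof -
  obtain a b where ab: "a < N" "b < N" "a \<noteq> b" "e a = e b"
    using assms by (auto simp: inj_on_def)
  define t where "t = transpose a b"
  have t: "t permutes {..<N}" using ab by (simp add: t_def permutes_swap_id)
  have "e \<circ> t = e" using ab by (auto simp: t_def fun_eq_iff Transposition.transpose_def)
  then show ?thesis using alternant_permute_exponents[OF t, of e x] ab by (simp add: t_def sign_swap_id)
qed

lemma vandermonde_permute:
  assumes "\<pi> permutes {..<N}"
  shows "vandermonde N (x \<circ> \<pi>) = of_int (sign \<pi>) * vandermonde N x"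
  by (simp add: vandermonde_alternant alternant_permute_variables[OF assms])

text \<open>The line \<open>t \<mapsto> x + t (0, 1, 2, \<dots>)\<close> leaves the zero set of the Vandermonde product at once,
  so that identities divided by that product extend to all points by continuity.\<close>

lemma eventually_vandermonde_nonzero:
  "eventually (\<lambda>t. vandermonde N (\<lambda>i. x i + t * real i) \<noteq> 0) (at 0)"
proof -
  have "eventually (\<lambda>t. \<forall>(i, j)\<in>{(i, j). i < j \<and> j < N}. (x i + t * real i) - (x j + t * real j) \<noteq> 0) (at 0)"
  proof (rule eventually_ball_finite[OF finite_pairs_less], rule ballI, clarify)
    fix i j :: nat assume "i < j"
    have "eventually (\<lambda>t. t \<noteq> (x i - x j) / (real j - real i)) (at 0)"
      by (rule eventually_neq_at_within)
    then show "eventually (\<lambda>t. (x i + t * real i) - (x j + t * real j) \<noteq> 0) (at 0)"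
      by eventually_elim (use \<open>i < j\<close> in \<open>auto simp: field_simps\<close>)
  qed
  then show ?thesis
    by eventually_elim (auto simp: vandermonde_def prod_zero_iff finite_pairs_less)
qed

lemma tendsto_schur:
  assumes "\<And>k. ((\<lambda>t. z t k) \<longlongrightarrow> w k) F"
  shows "((\<lambda>t. schur lam N (z t)) \<longlongrightarrow> schur lam N w) F"
  unfolding schur_def by (intro tendsto_sum tendsto_prod assms)

lemma tendsto_shift_at_0: "((\<lambda>t. x i + t * real i) \<longlongrightarrow> x i) (at 0)"
proof -
  have "((\<lambda>t. x i + t * real i) \<longlongrightarrow> x i + 0 * real i) (at 0)" by (intro tendsto_intros)
  then show ?thesis by simp
qed

lemma schur_cong:
  assumes "\<And>k. k < N \<Longrightarrow> x k = y k"
  shows "schur lam N x = schur lam N y"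
  unfolding schur_def by (intro sum.cong prod.cong assms) (auto simp: ssyt_def)

text \<open>A quotient of two alternating functions is symmetric; where the Vandermonde product
  vanishes the identity follows by a limit.\<close>

lemma schur_symmetric:
  assumes "length lam = N" and "sorted_wrt (\<ge>) lam" and p: "\<pi> permutes {..<N}"
  shows "schur lam N (x \<circ> \<pi>) = schur lam N x"
proof -
  define X where "X t i = x i + t * real i" for t :: real and i
  have ev: "eventually (\<lambda>t. schur lam N (X t \<circ> \<pi>) = schur lam N (X t)) (at 0)"
    using eventually_vandermonde_nonzero[of N x, folded X_def]
  proof eventually_elim
    case (elim t)
    have "schur lam N (X t \<circ> \<pi>) * (of_int (sign \<pi>) * vandermonde N (X t))
        = of_int (sign \<pi>) * alternant N (staircase N lam) (X t)"
      by (simp only: vandermonde_permute[OF p, symmetric] schur_bialternant[OF assms(1,2)]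
          alternant_permute_variables[OF p])
    then show ?case
      using elim by (simp add: schur_bialternant[OF assms(1,2), symmetric] sign_nz)
  qed
  have l1: "((\<lambda>t. schur lam N (X t \<circ> \<pi>)) \<longlongrightarrow> schur lam N (x \<circ> \<pi>)) (at 0)"
    unfolding X_def by (rule tendsto_schur) (simp add: tendsto_shift_at_0)
  have l2: "((\<lambda>t. schur lam N (X t)) \<longlongrightarrow> schur lam N x) (at 0)"
    unfolding X_def by (rule tendsto_schur) (simp add: tendsto_shift_at_0)
  show ?thesis
    using tendsto_unique[OF at_neq_bot Lim_transform_eventually[OF l1 ev] l2] by simp
qed

text \<open>Each Leibniz term of the Vandermonde product is multiplied by \<open>s\<close> written
  in correspondingly permuted variables. For a fixed monomial of \<open>s\<close> the terms then
  assemble to one alternant.\<close>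

lemma vandermonde_mult_symmetric:
  assumes sym: "\<And>x \<pi>. \<pi> permutes {..<n} \<Longrightarrow> s (x \<circ> \<pi>) = s x"
    and s: "\<And>x. s x = (\<Sum>T\<in>S. c T * (\<Prod>i<n. x i ^ e T i))"
  shows "vandermonde n x * s x = (\<Sum>T\<in>S. c T * alternant n (\<lambda>j. e T j + (n - 1 - j)) x)"
proof -
  have "of_int (sign p) * (\<Prod>i<n. x i ^ (n - 1 - p i)) * s x
      = (\<Sum>T\<in>S. c T * (of_int (sign p) * (\<Prod>i<n. x i ^ (e T (p i) + (n - 1 - p i)))))"
    if p: "p permutes {..<n}" for p
  proof -
    \<comment> \<open>Symmetry is applied with a different permutation for every Leibniz
      term.\<close>
    have "s x = s (x \<circ> inv_into UNIV p)" using sym[OF permutes_inv[OF p]] by simp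
    also have "\<dots> = (\<Sum>T\<in>S. c T * (\<Prod>i<n. x i ^ e T (p i)))"
    proof -
      have "(\<Prod>i<n. (x \<circ> inv_into UNIV p) i ^ e T i) = (\<Prod>i<n. x i ^ e T (p i))" for T
        using prod.permute[OF p, of "\<lambda>i. (x \<circ> inv_into UNIV p) i ^ e T i"]
        by (simp add: permutes_inverses[OF p])
      then show ?thesis by (simp add: s)
    qed
    finally show ?thesis
      by (simp add: power_add prod.distrib sum_distrib_left mult_ac)
  qed
  then have "vandermonde n x * s x = (\<Sum>p | p permutes {..<n}. \<Sum>T\<in>S.
      c T * (of_int (sign p) * (\<Prod>i<n. x i ^ (e T (p i) + (n - 1 - p i)))))"
    by (simp add: vandermonde_alternant alternant_def sum_distrib_right)
  also have "\<dots> = (\<Sum>T\<in>S. c T * alternant n (\<lambda>j. e T j + (n - 1 - j)) x)"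
    by (subst sum.swap) (simp add: alternant_def sum_distrib_left)
  finally show ?thesis .
qed

section \<open>Straightening of exponent vectors\<close>

lemma strict_decreasing_gap:
  fixes l :: "nat \<Rightarrow> nat"
  assumes "\<And>i j. i < j \<Longrightarrow> j < n \<Longrightarrow> l j < l i" and "i \<le> j" and "j < n"
  shows "l j + (j - i) \<le> l i"
  using assms(2,3)
proof (induction j rule: dec_induct)
  case (step j)
  then show ?case using assms(1)[of j "Suc j"] by simp
qed simp

text \<open>Repeated exponents make the alternant vanish. Distinct ones can be sorted decreasingly
  at the cost of a sign, and subtracting the staircase leaves a partition.\<close>

lemma alternant_straighten:
  assumes "0 < n" and sum_e: "(\<Sum>i<n. e i) = k + (\<Sum>i<n. n - 1 - i)"
  shows "\<exists>a\<in>partitions_len n k. \<exists>s. \<forall>x. alternant n e x = s * alternant n (staircase n a) x"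
proof (cases "inj_on e {..<n}")
  case False
  \<comment> \<open>Any partition serves here, with \<open>s = 0\<close>; the one-row partition
    shows that there is one.\<close>
  have "k # replicate (n - 1) 0 \<in> partitions_len n k"
    using assms(1) by (auto simp: partitions_len_def sum_list_replicate sorted_wrt_iff_nth_less)
  then show ?thesis using alternant_not_inj[OF False] by (metis mult_zero_left)
next
  case True
  define l where "l = rev (sorted_list_of_set (e ` {..<n}))"
  have len: "length l = n" using True by (simp add: l_def card_image)
  have set_l: "set l = e ` {..<n}" by (simp add: l_def)
  have "sorted_wrt (>) l" unfolding l_def by (simp add: sorted_wrt_rev)
  then have dec: "l ! j < l ! i" if "i < j" "j < n" for i j
    using that len by (simp add: sorted_wrt_iff_nth_less)
  have gap: "l ! j + (j - i) \<le> l ! i" if "i \<le> j" "j < n" for i j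
    by (rule strict_decreasing_gap[of n "nth l"]) (use dec that in auto)
  define \<pi> where "\<pi> i = (if i < n then inv_into {..<n} e (l ! i) else i)" for i
  have "bij_betw (nth l) {..<n} (e ` {..<n})"
    by (rule bij_betw_nth) (simp_all add: len set_l, simp add: l_def)
  moreover have "bij_betw (inv_into {..<n} e) (e ` {..<n}) {..<n}"
    using True by (simp add: bij_betw_inv_into bij_betw_imageI)
  ultimately have "bij_betw (inv_into {..<n} e \<circ> nth l) {..<n} {..<n}" by (rule bij_betw_trans)
  then have "bij_betw \<pi> {..<n} {..<n}"
    by (rule bij_betw_cong[THEN iffD1, rotated]) (simp add: \<pi>_def)
  then have perm: "\<pi> permutes {..<n}" by (rule bij_imp_permutes) (simp add: \<pi>_def)
  have e\<pi>: "e (\<pi> i) = l ! i" if "i < n" for i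
  proof -
    have "l ! i \<in> e ` {..<n}" using that set_l len by (metis nth_mem)
    then show ?thesis using that by (simp add: \<pi>_def f_inv_into_f)
  qed
  \<comment> \<open>No truncation occurs: \<open>gap\<close> against the last index gives
    \<open>n - 1 - i \<le> l ! i\<close>.\<close>
  define a where "a = map (\<lambda>i. l ! i - (n - 1 - i)) [0..<n]"
  have ge: "n - 1 - i \<le> l ! i" if "i < n" for i using gap[of i "n - 1"] that by linarith
  have stair: "staircase n a i = e (\<pi> i)" if "i < n" for i
    using that ge[OF that] e\<pi>[OF that] by (simp add: staircase_def a_def)
  have "sorted_wrt (\<ge>) a"
    unfolding sorted_wrt_iff_nth_less
  proof (intro allI impI)
    fix i j assume "i < j" "j < length a"
    then have ij: "i < n" "j < n" "i \<le> j" by (simp_all add: a_def)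
    have "a ! j + (n - 1 - j) = l ! j" "a ! i + (n - 1 - i) = l ! i"
      using ij ge[of i] ge[of j] by (simp_all add: a_def)
    moreover have "n - 1 - i = (n - 1 - j) + (j - i)" using ij by simp
    ultimately show "a ! j \<le> a ! i" using gap[OF ij(3,2)] by simp
  qed
  moreover have "sum_list a = k"
  proof -
    have "sum_list a = (\<Sum>i<n. a ! i)" by (simp add: sum_list_sum_nth a_def atLeast0LessThan)
    then have "sum_list a + (\<Sum>i<n. n - 1 - i) = (\<Sum>i<n. a ! i + (n - 1 - i))"
      by (simp only: sum.distrib)
    also have "\<dots> = (\<Sum>i<n. e (\<pi> i))" using stair by (intro sum.cong) (auto simp: staircase_def)
    also have "\<dots> = (\<Sum>i<n. e i)" using sum.permute[OF perm, of e] by (simp add: comp_def)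
    finally show ?thesis using sum_e by simp
  qed
  ultimately have "a \<in> partitions_len n k" by (simp add: partitions_len_def a_def)
  moreover have "alternant n e x = of_int (sign \<pi>) * alternant n (staircase n a) x" for x
  proof -
    have "alternant n (staircase n a) x = alternant n (e \<circ> \<pi>) x"
      by (rule alternant_cong) (simp_all add: stair)
    moreover have "real_of_int (sign \<pi>) * of_int (sign \<pi>) = 1"
      by (metis of_int_1 of_int_mult sign_idempotent)
    ultimately show ?thesis
      by (simp add: alternant_permute_exponents[OF perm] mult.assoc[symmetric])
  qed
  ultimately show ?thesis by blast
qed

lemma finite_partitions_len: "finite (partitions_len n k)"
proof (rule finite_subset)
  show "partitions_len n k \<subseteq> {a. set a \<subseteq> {..k} \<and> length a = n}"
    by (auto simp: partitions_len_def dest: member_le_sum_list)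
qed (simp add: finite_lists_length_eq)

lemma prod_group_power:
  fixes x :: "nat \<Rightarrow> real"
  assumes "finite A" and "\<And>c. c \<in> A \<Longrightarrow> f c < n"
  shows "(\<Prod>c\<in>A. x (f c)) = (\<Prod>i<n. x i ^ card {c \<in> A. f c = i})"
proof -
  have "(\<Prod>c\<in>A. x (f c)) = (\<Prod>i<n. \<Prod>c\<in>{c \<in> A. f c = i}. x (f c))"
    by (rule prod.group[symmetric]) (use assms in auto)
  also have "\<dots> = (\<Prod>i<n. x i ^ card {c \<in> A. f c = i})"
    by (intro prod.cong refl) simp
  finally show ?thesis .
qed

lemma sum_card_fibres:
  assumes "finite A" and "\<And>c. c \<in> A \<Longrightarrow> f c < (n :: nat)"
  shows "(\<Sum>i<n. card {c \<in> A. f c = i}) = card A"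
proof -
  have "(\<Sum>i<n. \<Sum>c\<in>{c \<in> A. f c = i}. 1) = (\<Sum>c\<in>A. 1 :: nat)"
    by (rule sum.group) (use assms in auto)
  then show ?thesis by simp
qed

section \<open>Schur expansion in the variables \<open>x i * y j\<close>\<close>

definition prodvar :: "nat \<Rightarrow> (nat \<Rightarrow> real) \<Rightarrow> (nat \<Rightarrow> real) \<Rightarrow> nat \<Rightarrow> real" where
  "prodvar m x y k = x (k div m) * y (k mod m)"

lemma index_pair_less: "i < n \<Longrightarrow> j < m \<Longrightarrow> i * m + j < n * (m :: nat)"
proof -
  assume "i < n" "j < m"
  then have "i * m + j < Suc i * m" by simp
  also have "\<dots> \<le> n * m" using \<open>i < n\<close> by (intro mult_le_mono1) simp
  finally show ?thesis .
qed

text \<open>Permuting the rows and the columns of the grid permutes its \<open>n * m\<close> cells,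
  so ordinary symmetry in all variables applies.\<close>

lemma schur_prodvar_symmetric:
  assumes "length lam = n * m" and "sorted_wrt (\<ge>) lam" and "0 < m"
    and p: "\<pi> permutes {..<n}" and t: "\<tau> permutes {..<m}"
  shows "schur lam (n * m) (prodvar m (x \<circ> \<pi>) (y \<circ> \<tau>)) = schur lam (n * m) (prodvar m x y)"
proof -
  define \<rho> where "\<rho> \<pi> \<tau> k = (if k < n * m then \<pi> (k div m) * m + \<tau> (k mod m) else k)"
    for \<pi> \<tau> :: "nat \<Rightarrow> nat" and k
  have lt: "k div m < n" if "k < n * m" for k
    using that assms(3) by (simp add: less_mult_imp_div_less)
  have in_range: "\<rho> \<pi> \<tau> k < n * m" "\<rho> \<pi> \<tau> k div m = \<pi> (k div m)" "\<rho> \<pi> \<tau> k mod m = \<tau> (k mod m)"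
    if "\<pi> permutes {..<n}" "\<tau> permutes {..<m}" "k < n * m" for \<pi> \<tau> k
  proof -
    have "\<pi> (k div m) < n" using permutes_in_image[OF that(1), of "k div m"] lt[OF that(3)] by simp
    moreover have t: "\<tau> (k mod m) < m" using permutes_in_image[OF that(2), of "k mod m"] assms(3) by simp
    ultimately show "\<rho> \<pi> \<tau> k < n * m" using that(3) by (simp add: \<rho>_def index_pair_less)
    show "\<rho> \<pi> \<tau> k div m = \<pi> (k div m)" "\<rho> \<pi> \<tau> k mod m = \<tau> (k mod m)"
      using that(3) t by (auto simp: \<rho>_def)
  qed
  note p' = permutes_inv[OF p] and t' = permutes_inv[OF t]
  let ?\<rho>' = "\<rho> (inv_into UNIV \<pi>) (inv_into UNIV \<tau>)"
  have "bij_betw (\<rho> \<pi> \<tau>) {..<n * m} {..<n * m}"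
  proof (rule bij_betw_byWitness[where f' = ?\<rho>'])
    show "\<forall>k\<in>{..<n * m}. ?\<rho>' (\<rho> \<pi> \<tau> k) = k"
      using in_range[OF p t] permutes_inverses[OF p] permutes_inverses[OF t]
      by (simp add: \<rho>_def[of "inv_into UNIV \<pi>"])
    show "\<forall>k\<in>{..<n * m}. \<rho> \<pi> \<tau> (?\<rho>' k) = k"
      using in_range[OF p' t'] permutes_inverses[OF p] permutes_inverses[OF t]
      by (simp add: \<rho>_def[of \<pi>])
  qed (use in_range[OF p t] in_range[OF p' t'] in auto)
  then have "\<rho> \<pi> \<tau> permutes {..<n * m}" by (rule bij_imp_permutes) (simp add: \<rho>_def)
  then have "schur lam (n * m) (prodvar m x y \<circ> \<rho> \<pi> \<tau>) = schur lam (n * m) (prodvar m x y)"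
    by (rule schur_symmetric[OF assms(1,2)])
  moreover have "schur lam (n * m) (prodvar m (x \<circ> \<pi>) (y \<circ> \<tau>)) = schur lam (n * m) (prodvar m x y \<circ> \<rho> \<pi> \<tau>)"
    by (rule schur_cong) (simp add: prodvar_def in_range[OF p t])
  ultimately show ?thesis by simp
qed

lemma sum_fibre_coefficients:
  fixes s :: "'t \<Rightarrow> real" and F :: "'d \<Rightarrow> real"
  assumes "finite S" and "finite D" and "\<And>T. T \<in> S \<Longrightarrow> g T \<in> D"
  shows "(\<Sum>T\<in>S. s T * F (g T)) = (\<Sum>d\<in>D. (\<Sum>T\<in>{T \<in> S. g T = d}. s T) * F d)"
proof -
  have "(\<Sum>T\<in>S. s T * F (g T)) = (\<Sum>d\<in>D. \<Sum>T\<in>{T \<in> S. g T = d}. s T * F (g T))"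
    by (rule sum.group[symmetric]) (use assms in auto)
  then show ?thesis by (simp add: sum_distrib_right)
qed

text \<open>Antisymmetrising the tableau sum in \<open>x\<close> and then in \<open>y\<close>
  replaces every tableau by a product of two alternants, whose exponents count its entries in each
  row and column of the grid. Straightening both and collecting equal pairs yields the
  coefficients.\<close>

lemma schur_prodvar_alternants:
  assumes "length lam = n * m" and "sorted_wrt (\<ge>) lam" and "0 < n" and "0 < m"
  defines "D \<equiv> partitions_len n (sum_list lam) \<times> partitions_len m (sum_list lam)"
  shows "\<exists>c. (\<forall>a b. (a, b) \<notin> D \<longrightarrow> c a b = 0) \<and> (\<forall>x y.
      vandermonde m y * (vandermonde n x * schur lam (n * m) (prodvar m x y))
      = (\<Sum>(a, b)\<in>D. c a b * (alternant n (staircase n a) x * alternant m (staircase m b) y)))"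
proof -
  define S where "S = ssyt lam (n * m)"
  have finS: "finite S" by (simp add: S_def finite_ssyt)
  define P where "P T i = card {c \<in> cells lam. T c div m = i}" for T :: "nat \<times> nat \<Rightarrow> nat" and i
  define Q where "Q T j = card {c \<in> cells lam. T c mod m = j}" for T :: "nat \<times> nat \<Rightarrow> nat" and j
  have T_div: "T c div m < n" if "T \<in> S" "c \<in> cells lam" for T c
    using that by (auto simp: S_def ssyt_def less_mult_imp_div_less)
  have T_mod: "T c mod m < m" for T :: "nat \<times> nat \<Rightarrow> nat" and c using assms(4) by simp
  have s: "schur lam (n * m) (prodvar m x y)
      = (\<Sum>T\<in>S. (\<Prod>j<m. y j ^ Q T j) * (\<Prod>i<n. x i ^ P T i))" for x y
  proof -
    have "(\<Prod>c\<in>cells lam. prodvar m x y (T c)) = (\<Prod>j<m. y j ^ Q T j) * (\<Prod>i<n. x i ^ P T i)"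
      if "T \<in> S" for T
      unfolding prodvar_def prod.distrib P_def Q_def
      using prod_group_power[OF finite_cells, of lam "\<lambda>c. T c div m" n x]
        prod_group_power[OF finite_cells, of lam "\<lambda>c. T c mod m" m y] T_div[OF that] T_mod by simp
    then show ?thesis by (simp add: schur_def S_def[symmetric])
  qed
  have x_step: "vandermonde n x * schur lam (n * m) (prodvar m x y)
      = (\<Sum>T\<in>S. (\<Prod>j<m. y j ^ Q T j) * alternant n (\<lambda>j. P T j + (n - 1 - j)) x)" for x y
    by (rule vandermonde_mult_symmetric[of n "\<lambda>x. schur lam (n * m) (prodvar m x y)"])
      (use schur_prodvar_symmetric[OF assms(1,2,4) _ permutes_id, of _ _ y] s in auto)
  have y_step: "vandermonde m y * (vandermonde n x * schur lam (n * m) (prodvar m x y))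
      = (\<Sum>T\<in>S. alternant n (\<lambda>j. P T j + (n - 1 - j)) x * alternant m (\<lambda>j. Q T j + (m - 1 - j)) y)" for x y
  proof (rule vandermonde_mult_symmetric[of m "\<lambda>y. vandermonde n x * schur lam (n * m) (prodvar m x y)"])
    show "vandermonde n x * schur lam (n * m) (prodvar m x (y \<circ> \<tau>))
        = vandermonde n x * schur lam (n * m) (prodvar m x y)" if "\<tau> permutes {..<m}" for y \<tau>
      using schur_prodvar_symmetric[OF assms(1,2,4) permutes_id that, of x y] by simp
  qed (unfold x_step, rule sum.cong, simp_all add: mult.commute)
  have "\<exists>a\<in>partitions_len n (sum_list lam). \<exists>s. \<forall>x.
      alternant n (\<lambda>j. P T j + (n - 1 - j)) x = s * alternant n (staircase n a) x" if "T \<in> S" for T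
    by (rule alternant_straighten[OF assms(3)])
      (use sum_card_fibres[OF finite_cells, of lam "\<lambda>c. T c div m" n] T_div[OF that]
        in \<open>simp only: sum.distrib P_def card_cells_sum_list\<close>)
  then obtain a s1 where a: "\<And>T. T \<in> S \<Longrightarrow> a T \<in> partitions_len n (sum_list lam)"
    "\<And>T x. T \<in> S \<Longrightarrow> alternant n (\<lambda>j. P T j + (n - 1 - j)) x = s1 T * alternant n (staircase n (a T)) x"
    by metis
  have "\<exists>b\<in>partitions_len m (sum_list lam). \<exists>s. \<forall>y.
      alternant m (\<lambda>j. Q T j + (m - 1 - j)) y = s * alternant m (staircase m b) y" if "T \<in> S" for T
    by (rule alternant_straighten[OF assms(4)])
      (use sum_card_fibres[OF finite_cells, of lam "\<lambda>c. T c mod m" m] T_mod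
        in \<open>simp only: sum.distrib Q_def card_cells_sum_list\<close>)
  then obtain b s2 where b: "\<And>T. T \<in> S \<Longrightarrow> b T \<in> partitions_len m (sum_list lam)"
    "\<And>T y. T \<in> S \<Longrightarrow> alternant m (\<lambda>j. Q T j + (m - 1 - j)) y = s2 T * alternant m (staircase m (b T)) y"
    by metis
  define c where "c a' b' = (\<Sum>T\<in>{T \<in> S. (a T, b T) = (a', b')}. s1 T * s2 T)" for a' b'
  have "c a' b' = 0" if "(a', b') \<notin> D" for a' b'
  proof -
    have "{T \<in> S. (a T, b T) = (a', b')} = {}" using that a(1) b(1) by (auto simp: D_def)
    then show ?thesis by (simp only: c_def sum.empty)
  qed
  moreover have "vandermonde m y * (vandermonde n x * schur lam (n * m) (prodvar m x y))
      = (\<Sum>(a, b)\<in>D. c a b * (alternant n (staircase n a) x * alternant m (staircase m b) y))" for x y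
  proof -
    let ?F = "\<lambda>(a, b). alternant n (staircase n a) x * alternant m (staircase m b) y"
    have "vandermonde m y * (vandermonde n x * schur lam (n * m) (prodvar m x y))
        = (\<Sum>T\<in>S. s1 T * s2 T * ?F (a T, b T))"
      unfolding y_step by (rule sum.cong[OF refl]) (simp only: a(2) b(2) prod.case mult_ac)
    also have "\<dots> = (\<Sum>d\<in>D. (\<Sum>T\<in>{T \<in> S. (a T, b T) = d}. s1 T * s2 T) * ?F d)"
      by (rule sum_fibre_coefficients[OF finS, of D "\<lambda>T. (a T, b T)" "\<lambda>T. s1 T * s2 T" ?F])
        (use a(1) b(1) in \<open>auto simp: D_def finite_partitions_len\<close>)
    also have "\<dots> = (\<Sum>(a, b)\<in>D. c a b * (alternant n (staircase n a) x * alternant m (staircase m b) y))"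
      by (rule sum.cong) (auto simp: c_def)
    finally show ?thesis .
  qed
  ultimately show ?thesis by blast
qed

text \<open>The existence half of the description defining \<open>kron\<close>. Both Vandermonde
  products are cancelled where they are nonzero, and the identity extends by continuity.\<close>

lemma schur_prodvar_expansion:
  assumes "length lam = n * m" and "sorted_wrt (\<ge>) lam" and "0 < n" and "0 < m"
  defines "D \<equiv> partitions_len n (sum_list lam) \<times> partitions_len m (sum_list lam)"
  shows "\<exists>c. (\<forall>a b. (a, b) \<notin> D \<longrightarrow> c a b = 0) \<and> (\<forall>x y.
      schur lam (n * m) (prodvar m x y) = (\<Sum>(a, b)\<in>D. c a b * schur a n x * schur b m y))"
proof -
  obtain c where c: "\<And>a b. (a, b) \<notin> D \<Longrightarrow> c a b = 0"
    "\<And>x y. vandermonde m y * (vandermonde n x * schur lam (n * m) (prodvar m x y))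
      = (\<Sum>(a, b)\<in>D. c a b * (alternant n (staircase n a) x * alternant m (staircase m b) y))"
    using schur_prodvar_alternants[OF assms(1-4)] unfolding D_def by blast
  have mult: "vandermonde m y * (vandermonde n x * schur lam (n * m) (prodvar m x y))
      = vandermonde m y * (vandermonde n x * (\<Sum>(a, b)\<in>D. c a b * schur a n x * schur b m y))" for x y
  proof -
    have "c a b * (alternant n (staircase n a) x * alternant m (staircase m b) y)
        = vandermonde m y * (vandermonde n x * (c a b * schur a n x * schur b m y))" if "(a, b) \<in> D" for a b
    proof -
      have ab: "length a = n" "sorted_wrt (\<ge>) a" "length b = m" "sorted_wrt (\<ge>) b"
        using that by (auto simp: D_def partitions_len_def)
      show ?thesis
        unfolding schur_bialternant[OF ab(1,2), symmetric] schur_bialternant[OF ab(3,4), symmetric]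
        by (simp add: mult_ac)
    qed
    then have "(\<Sum>(a, b)\<in>D. c a b * (alternant n (staircase n a) x * alternant m (staircase m b) y))
        = (\<Sum>(a, b)\<in>D. vandermonde m y * (vandermonde n x * (c a b * schur a n x * schur b m y)))"
      by (intro sum.cong) auto
    then show ?thesis
      unfolding c(2) by (simp add: sum_distrib_left case_prod_unfold)
  qed
  have "schur lam (n * m) (prodvar m x y) = (\<Sum>(a, b)\<in>D. c a b * schur a n x * schur b m y)" for x y
  proof -
    define X where "X t i = x i + t * real i" for t :: real and i
    define Y where "Y t i = y i + t * real i" for t :: real and i
    have lim: "((\<lambda>t. X t i) \<longlongrightarrow> x i) (at 0)" "((\<lambda>t. Y t i) \<longlongrightarrow> y i) (at 0)" for i
      by (simp_all add: X_def Y_def tendsto_shift_at_0)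
    have ev: "eventually (\<lambda>t. schur lam (n * m) (prodvar m (X t) (Y t))
        = (\<Sum>(a, b)\<in>D. c a b * schur a n (X t) * schur b m (Y t))) (at 0)"
      using eventually_vandermonde_nonzero[of n x, folded X_def]
        eventually_vandermonde_nonzero[of m y, folded Y_def]
      by eventually_elim (use mult in auto)
    have l1: "((\<lambda>t. schur lam (n * m) (prodvar m (X t) (Y t)))
        \<longlongrightarrow> schur lam (n * m) (prodvar m x y)) (at 0)"
      by (rule tendsto_schur) (unfold prodvar_def, intro tendsto_mult lim)
    have l2: "((\<lambda>t. \<Sum>(a, b)\<in>D. c a b * schur a n (X t) * schur b m (Y t))
        \<longlongrightarrow> (\<Sum>(a, b)\<in>D. c a b * schur a n x * schur b m y)) (at 0)"
      unfolding case_prod_unfold by (intro tendsto_sum tendsto_mult tendsto_const tendsto_schur lim)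
    show ?thesis
      using tendsto_unique[OF at_neq_bot Lim_transform_eventually[OF l1 ev] l2] by simp
  qed
  with c(1) show ?thesis by blast
qed

section \<open>Coefficient functionals of Laurent polynomials\<close>

definition lmono :: "nat \<Rightarrow> (nat \<Rightarrow> int) \<Rightarrow> (nat \<Rightarrow> real) \<Rightarrow> real" where
  "lmono r v w = (\<Prod>i<r. w i powi v i)"

lemma lmono_add:
  assumes "\<And>i. 0 < w i"
  shows "lmono r (\<lambda>i. u i + v i) w = lmono r u w * lmono r v w"
  using assms by (simp add: lmono_def power_int_add prod.distrib less_imp_neq[symmetric])

lemma lmono_times: "lmono r v (\<lambda>i. w i * z i) = lmono r v w * lmono r v z"
  by (simp add: lmono_def power_int_mult_distrib prod.distrib)

lemma lmono_single:
  assumes "i < r"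
  shows "lmono r v (\<lambda>j. if j = i then 2 else 1) = 2 powi v i"
proof -
  have "lmono r v (\<lambda>j. if j = i then 2 else 1) = (\<Prod>j<r. if j = i then 2 powi v i else 1)"
    unfolding lmono_def by (rule prod.cong) auto
  then show ?thesis using assms by simp
qed

text \<open>Distinct monomials are distinct characters of the multiplicative group of positive vectors,
  hence linearly independent.\<close>

lemma lmono_independent:
  assumes "finite S" and "\<And>v i. v \<in> S \<Longrightarrow> r \<le> i \<Longrightarrow> v i = 0"
    and "\<And>w. (\<And>i. 0 < w i) \<Longrightarrow> (\<Sum>v\<in>S. c v * lmono r v w) = 0" and "v \<in> S"
  shows "c v = 0"
  using assms
proof (induction S arbitrary: c v rule: finite_induct)
  case (insert u S)
  have zero: "c v = 0" if v: "v \<in> S" for v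
  proof -
    have "v \<noteq> u" using insert.hyps v by blast
    then obtain i where i: "v i \<noteq> u i" by blast
    have "i < r" using insert.prems(1)[of v i] insert.prems(1)[of u i] i v by (metis insertCI not_less)
    \<comment> \<open>Scaling by \<open>z\<close> multiplies the monomial of \<open>u\<close> by
      \<open>lmono r u z\<close>; subtracting that multiple of the original relation eliminates
      \<open>u\<close>. Coordinate \<open>i\<close>, where \<open>u\<close> and \<open>v\<close>
      differ, keeps the factor at \<open>v\<close> nonzero.\<close>
    define z :: "nat \<Rightarrow> real" where "z = (\<lambda>j. if j = i then 2 else 1)"
    have "c v * (lmono r v z - lmono r u z) = 0"
    proof (rule insert.IH[where c = "\<lambda>v. c v * (lmono r v z - lmono r u z)"])
      fix w :: "nat \<Rightarrow> real" assume w: "\<And>i. 0 < w i"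
      have "(\<Sum>v\<in>insert u S. c v * lmono r v (\<lambda>i. w i * z i)) = 0"
        by (rule insert.prems(2)) (use w in \<open>auto simp: z_def\<close>)
      moreover have "(\<Sum>v\<in>insert u S. c v * lmono r v w) = 0"
        by (rule insert.prems(2)) (use w in auto)
      ultimately have "(\<Sum>v\<in>insert u S. c v * lmono r v w * lmono r v z)
          - lmono r u z * (\<Sum>v\<in>insert u S. c v * lmono r v w) = 0"
        by (simp add: lmono_times mult.assoc)
      then show "(\<Sum>v\<in>S. c v * (lmono r v z - lmono r u z) * lmono r v w) = 0"
        using insert.hyps by (simp add: sum_distrib_left sum_subtractf algebra_simps)
    qed (use insert.prems v in auto)
    moreover have "lmono r v z \<noteq> lmono r u z"
      using i power_int_strict_increasing[of "v i" "u i" "2 :: real"]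
        power_int_strict_increasing[of "u i" "v i" "2 :: real"]
      by (cases "v i" "u i" rule: linorder_cases) (auto simp: z_def lmono_single[OF \<open>i < r\<close>])
    ultimately show ?thesis by simp
  qed
  \<comment> \<open>At the all-ones vector every monomial is 1, so the one remaining coefficient is
    isolated.\<close>
  have "(\<Sum>v\<in>insert u S. c v * lmono r v (\<lambda>_. 1)) = 0" by (rule insert.prems(2)) simp
  then have "c u = 0" using zero insert.hyps by (simp add: lmono_def)
  then show ?case using zero insert.prems(3) by blast
qed simp

text \<open>\<open>L\<close> pairs the coefficients of the Laurent polynomial \<open>f\<close> with
  a test function: \<open>L g\<close> is the sum of coefficient times \<open>g\<close> at the
  exponent. Coefficients are never named outside, and products are handled by transforming
  \<open>g\<close>.\<close>

definition lrep :: "nat \<Rightarrow> ((nat \<Rightarrow> real) \<Rightarrow> real) \<Rightarrow> (((nat \<Rightarrow> int) \<Rightarrow> real) \<Rightarrow> real) \<Rightarrow> bool" where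
  "lrep r f L \<longleftrightarrow> (\<exists>S c. finite S \<and> (\<forall>v\<in>S. \<forall>i\<ge>r. v i = 0)
     \<and> (\<forall>w. (\<forall>i. 0 < w i) \<longrightarrow> f w = (\<Sum>v\<in>S. c v * lmono r v w))
     \<and> (\<forall>g. L g = (\<Sum>v\<in>S. c v * g v)))"

lemma lrep_mono:
  assumes "\<And>i. r \<le> i \<Longrightarrow> v i = 0"
  shows "lrep r (lmono r v) (\<lambda>g. g v)"
  unfolding lrep_def using assms by (intro exI[of _ "{v}"] exI[of _ "\<lambda>_. 1"]) auto

lemma lrep_zero: "lrep r (\<lambda>w. 0) (\<lambda>g. 0)"
  unfolding lrep_def by (intro exI[of _ "{}"]) auto

lemma lrep_smult:
  assumes "lrep r f L"
  shows "lrep r (\<lambda>w. a * f w) (\<lambda>g. a * L g)"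
proof -
  obtain S c where S: "finite S" "\<forall>v\<in>S. \<forall>i\<ge>r. v i = 0"
    "\<forall>w. (\<forall>i. 0 < w i) \<longrightarrow> f w = (\<Sum>v\<in>S. c v * lmono r v w)" "\<forall>g. L g = (\<Sum>v\<in>S. c v * g v)"
    using assms unfolding lrep_def by blast
  then show ?thesis unfolding lrep_def
    by (intro exI[of _ S] exI[of _ "\<lambda>v. a * c v"]) (auto simp: sum_distrib_left mult.assoc)
qed

lemma lrep_add:
  assumes "lrep r f L" and "lrep r f' L'"
  shows "lrep r (\<lambda>w. f w + f' w) (\<lambda>g. L g + L' g)"
proof -
  obtain S c where S: "finite S" "\<forall>v\<in>S. \<forall>i\<ge>r. v i = 0"
    "\<And>w. (\<forall>i. 0 < w i) \<Longrightarrow> f w = (\<Sum>v\<in>S. c v * lmono r v w)" "\<And>g. L g = (\<Sum>v\<in>S. c v * g v)"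
    using assms(1) unfolding lrep_def by blast
  obtain S' c' where S': "finite S'" "\<forall>v\<in>S'. \<forall>i\<ge>r. v i = 0"
    "\<And>w. (\<forall>i. 0 < w i) \<Longrightarrow> f' w = (\<Sum>v\<in>S'. c' v * lmono r v w)" "\<And>g. L' g = (\<Sum>v\<in>S'. c' v * g v)"
    using assms(2) unfolding lrep_def by blast
  define e where "e v = of_bool (v \<in> S) * c v + of_bool (v \<in> S') * c' v" for v
  have e: "(\<Sum>v\<in>S \<union> S'. e v * h v) = (\<Sum>v\<in>S. c v * h v) + (\<Sum>v\<in>S'. c' v * h v)" for h
  proof -
    have "(\<Sum>v\<in>S. c v * h v) = (\<Sum>v\<in>S \<union> S'. of_bool (v \<in> S) * c v * h v)"
      by (rule sum.mono_neutral_cong_left) (use S(1) S'(1) in auto)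
    moreover have "(\<Sum>v\<in>S'. c' v * h v) = (\<Sum>v\<in>S \<union> S'. of_bool (v \<in> S') * c' v * h v)"
      by (rule sum.mono_neutral_cong_left) (use S(1) S'(1) in auto)
    ultimately show ?thesis by (simp only: e_def distrib_right sum.distrib)
  qed
  show ?thesis unfolding lrep_def
    by (intro exI[of _ "S \<union> S'"] exI[of _ e]) (use S S' in \<open>auto simp: e\<close>)
qed

lemma lrep_sum:
  assumes "finite I" and "\<And>i. i \<in> I \<Longrightarrow> lrep r (f i) (L i)"
  shows "lrep r (\<lambda>w. \<Sum>i\<in>I. f i w) (\<lambda>g. \<Sum>i\<in>I. L i g)"
  using assms
proof (induction I rule: finite_induct)
  case empty
  then show ?case by (simp add: lrep_zero)
next
  case (insert i I)
  then show ?case using lrep_add[of r "f i" "L i" "\<lambda>w. \<Sum>i\<in>I. f i w" "\<lambda>g. \<Sum>i\<in>I. L i g"] by simp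
qed

lemma lrep_cong:
  assumes "lrep r f L" and "\<And>w. (\<And>i. 0 < w i) \<Longrightarrow> f' w = f w" and "\<And>g. L' g = L g"
  shows "lrep r f' L'"
proof -
  obtain S c where S: "finite S" "\<forall>v\<in>S. \<forall>i\<ge>r. v i = 0"
    "\<forall>w. (\<forall>i. 0 < w i) \<longrightarrow> f w = (\<Sum>v\<in>S. c v * lmono r v w)" "\<forall>g. L g = (\<Sum>v\<in>S. c v * g v)"
    using assms(1) unfolding lrep_def by blast
  then show ?thesis unfolding lrep_def
    using assms(2,3) by (intro exI[of _ S] exI[of _ c]) simp
qed

lemma lrep_shift:
  assumes "lrep r f L" and p: "\<And>i. r \<le> i \<Longrightarrow> p i = 0"
  shows "lrep r (\<lambda>w. f w * lmono r p w) (\<lambda>g. L (\<lambda>v. g (\<lambda>i. v i + p i)))"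
proof -
  obtain S c where S: "finite S" "\<forall>v\<in>S. \<forall>i\<ge>r. v i = 0"
    "\<And>w. (\<forall>i. 0 < w i) \<Longrightarrow> f w = (\<Sum>v\<in>S. c v * lmono r v w)" "\<And>g. L g = (\<Sum>v\<in>S. c v * g v)"
    using assms(1) unfolding lrep_def by blast
  define sh where "sh v = (\<lambda>i. v i + p i)" for v
  have inj: "inj_on sh S" by (auto simp: inj_on_def sh_def fun_eq_iff)
  have "(\<lambda>i. sh v i - p i) = v" for v by (simp add: sh_def)
  then have e: "(\<Sum>v\<in>sh ` S. c (\<lambda>i. v i - p i) * h v) = (\<Sum>v\<in>S. c v * h (sh v))" for h
    by (simp add: sum.reindex[OF inj])
  show ?thesis unfolding lrep_def
  proof (intro exI[of _ "sh ` S"] exI[of _ "\<lambda>v. c (\<lambda>i. v i - p i)"] conjI allI impI)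
    fix w :: "nat \<Rightarrow> real" assume w: "\<forall>i. 0 < w i"
    then have "f w * lmono r p w = (\<Sum>v\<in>S. c v * lmono r (sh v) w)"
      unfolding S(3)[OF w] sh_def by (simp add: lmono_add sum_distrib_right mult.assoc)
    then show "f w * lmono r p w = (\<Sum>v\<in>sh ` S. c (\<lambda>i. v i - p i) * lmono r v w)"
      by (simp only: e)
  qed (use S(1,2) p in \<open>auto simp: sh_def e[unfolded sh_def] S(4)\<close>)
qed

lemma lrep_diff:
  assumes "lrep r f L"
  shows "L (\<lambda>v. g v - h v) = L g - L h"
  using assms unfolding lrep_def by (auto simp: right_diff_distrib sum_subtractf)

lemma lrep_mult_binomial:
  assumes "lrep r f L" and "\<And>i. r \<le> i \<Longrightarrow> p i = 0" and "\<And>i. r \<le> i \<Longrightarrow> q i = 0"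
  shows "lrep r (\<lambda>w. f w * (lmono r p w - lmono r q w))
    (\<lambda>g. L (\<lambda>v. g (\<lambda>i. v i + p i) - g (\<lambda>i. v i + q i)))"
  using lrep_add[OF lrep_shift[OF assms(1,2)] lrep_smult[OF lrep_shift[OF assms(1,3)], where a = "-1"]]
  by (rule lrep_cong) (auto simp: algebra_simps lrep_diff[OF assms(1)])

text \<open>Comparison of coefficients: equal functions give equal functionals, by linear
  independence of the monomials.\<close>

lemma lrep_unique:
  assumes "lrep r f L" and "lrep r f' L'" and "\<And>w. (\<And>i. 0 < w i) \<Longrightarrow> f w = f' w"
  shows "L g = L' g"
proof -
  have "lrep r (\<lambda>w. f w + - 1 * f' w) (\<lambda>g. L g + - 1 * L' g)"
    by (intro lrep_add lrep_smult assms)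
  then obtain S c where S: "finite S" "\<forall>v\<in>S. \<forall>i\<ge>r. v i = 0"
    "\<And>w. (\<forall>i. 0 < w i) \<Longrightarrow> f w + - 1 * f' w = (\<Sum>v\<in>S. c v * lmono r v w)"
    "\<And>g. L g + - 1 * L' g = (\<Sum>v\<in>S. c v * g v)"
    unfolding lrep_def by blast
  have "c v = 0" if "v \<in> S" for v
    by (rule lmono_independent[OF S(1) _ _ that, of r]) (use S(2,3) assms(3) in auto)
  then have "L g + - 1 * L' g = 0" using S(4)[of g] by simp
  then show ?thesis by simp
qed

text \<open>The adjoint of multiplication by the product of the binomials with exponent pairs in
  \<open>A\<close>: one difference operator per binomial.\<close>

fun binomial_dual ::
  "((nat \<Rightarrow> int) \<times> (nat \<Rightarrow> int)) list \<Rightarrow> ((nat \<Rightarrow> int) \<Rightarrow> real) \<Rightarrow> (nat \<Rightarrow> int) \<Rightarrow> real" where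
  "binomial_dual [] g = g"
| "binomial_dual ((p, q) # A) g = binomial_dual A (\<lambda>v. g (\<lambda>i. v i + p i) - g (\<lambda>i. v i + q i))"

lemma lrep_mult_binomials:
  assumes "lrep r f L" and "\<And>p q i. (p, q) \<in> set A \<Longrightarrow> r \<le> i \<Longrightarrow> p i = 0 \<and> q i = 0"
  shows "lrep r (\<lambda>w. f w * (\<Prod>(p, q)\<leftarrow>A. lmono r p w - lmono r q w)) (\<lambda>g. L (binomial_dual A g))"
  using assms(2)
proof (induction A)
  case Nil
  then show ?case using assms(1) by simp
next
  case (Cons pq A)
  obtain p q where pq: "pq = (p, q)" by (cases pq)
  have "lrep r (\<lambda>w. f w * (\<Prod>(p, q)\<leftarrow>A. lmono r p w - lmono r q w)) (\<lambda>g. L (binomial_dual A g))"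
    using Cons by auto
  moreover have "p i = 0" "q i = 0" if "r \<le> i" for i using Cons.prems[of p q i] that pq by auto
  ultimately have "lrep r (\<lambda>w. f w * (\<Prod>(p, q)\<leftarrow>A. lmono r p w - lmono r q w) * (lmono r p w - lmono r q w))
    (\<lambda>g. L (binomial_dual A (\<lambda>v. g (\<lambda>i. v i + p i) - g (\<lambda>i. v i + q i))))"
    by (rule lrep_mult_binomial)
  then show ?case
    by (simp add: pq mult_ac)
qed

section \<open>Vector partition functions\<close>

text \<open>\<open>vpf \<phi> P A\<close> counts the ways to write a vector as a nonnegative combination of \<open>A\<close> and a rest
  counted by \<open>P\<close>; the linear form \<open>\<phi>\<close> is positive on \<open>A\<close> and bounds the coefficients.\<close>

fun vpf :: "((nat \<Rightarrow> int) \<Rightarrow> int) \<Rightarrow> ((nat \<Rightarrow> int) \<Rightarrow> real) \<Rightarrow> (nat \<Rightarrow> int) list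
    \<Rightarrow> (nat \<Rightarrow> int) \<Rightarrow> real" where
  "vpf \<phi> P [] b = P b"
| "vpf \<phi> P (a # A) b = (\<Sum>k\<in>{0..\<phi> b}. vpf \<phi> P A (\<lambda>i. b i - k * a i))"

lemma vpf_negative:
  assumes "\<And>b. \<phi> b < 0 \<Longrightarrow> P b = 0" and "\<phi> b < 0"
  shows "vpf \<phi> P A b = 0"
  using assms by (cases A) auto

text \<open>The count at \<open>b - a\<close> is the count at \<open>b\<close> restricted to
  multiplicity at least one of \<open>a\<close>, so only multiplicity zero survives. The cut-off at
  \<open>\<phi> b\<close> is harmless, as larger multiplicities make \<open>\<phi>\<close>
  negative.\<close>

lemma vpf_difference:
  assumes lin: "\<And>b k. \<phi> (\<lambda>i. b i - k * a i) = \<phi> b - k * \<phi> a" and pos: "1 \<le> \<phi> a"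
    and P: "\<And>b. \<phi> b < 0 \<Longrightarrow> P b = 0"
  shows "vpf \<phi> P (a # A) b - vpf \<phi> P (a # A) (\<lambda>i. b i - a i) = vpf \<phi> P A b"
proof -
  \<comment> \<open>A common range for both sums; the maximum with 0 covers negative
    \<open>\<phi> b\<close>, where the defining sums are empty.\<close>
  define M where "M = max 0 (\<phi> b)"
  define F where "F k = vpf \<phi> P A (\<lambda>i. b i - k * a i)" for k
  have F0: "F k = 0" if "\<phi> b < k" "0 \<le> k" for k
  proof -
    have "k * 1 \<le> k * \<phi> a" using pos that(2) by (rule mult_left_mono)
    then show ?thesis unfolding F_def using lin[of b k] that(1) by (intro vpf_negative P) auto
  qed
  have "vpf \<phi> P (a # A) b = (\<Sum>k\<in>{0..M + 1}. F k)"
    unfolding vpf.simps F_def[symmetric]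
    by (rule sum.mono_neutral_left) (auto simp: M_def intro!: F0)
  moreover have "vpf \<phi> P (a # A) (\<lambda>i. b i - a i) = (\<Sum>k\<in>{1..M + 1}. F k)"
  proof -
    have sh: "(\<lambda>i. b i - a i - k * a i) = (\<lambda>i. b i - (k + 1) * a i)" for k
      by (simp add: algebra_simps)
    have "\<phi> (\<lambda>i. b i - a i) = \<phi> b - \<phi> a" using lin[of b 1] by simp
    then have "vpf \<phi> P (a # A) (\<lambda>i. b i - a i) = (\<Sum>k\<in>{0..\<phi> b - \<phi> a}. F (k + 1))"
      by (simp add: sh F_def)
    also have "\<dots> = (\<Sum>k\<in>{1..\<phi> b - \<phi> a + 1}. F k)"
      by (rule sum.reindex_bij_witness[of _ "\<lambda>k. k - 1" "\<lambda>k. k + 1"]) auto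
    also have "\<dots> = (\<Sum>k\<in>{1..M + 1}. F k)"
    proof (rule sum.mono_neutral_left)
      show "\<forall>k\<in>{1..M + 1} - {1..\<phi> b - \<phi> a + 1}. F k = 0"
      proof
        fix k assume k: "k \<in> {1..M + 1} - {1..\<phi> b - \<phi> a + 1}"
        then have k': "1 \<le> k" "\<phi> b - \<phi> a + 1 < k" by auto
        have "0 \<le> (k - 1) * (\<phi> a - 1)" using k' pos by simp
        then have "\<phi> b - k * \<phi> a < 0" using k' by (simp add: algebra_simps)
        then show "F k = 0" unfolding F_def using lin[of b k] by (intro vpf_negative P) auto
      qed
    qed (use pos in \<open>auto simp: M_def\<close>)
    finally show ?thesis .
  qed
  moreover have "{0..M + 1} = insert 0 {1..M + 1}" by (auto simp: M_def)
  ultimately show ?thesis by (simp add: F_def)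
qed

text \<open>The partition function inverts the difference operators: each binomial of
  \<open>A\<close> strips off the generator \<open>p - q\<close>. The test function is translated by
  the sum of the \<open>p\<close>, so that the two evaluation points become \<open>b\<close> and
  \<open>b - (p - q)\<close>. The free shift \<open>u\<close> leaves room for the operators of
  \<open>B\<close>.\<close>

lemma binomial_dual_vpf:
  assumes lin: "\<And>a b k. \<phi> (\<lambda>i. b i - k * a i) = \<phi> b - k * \<phi> a"
    and pos: "\<And>p q. (p, q) \<in> set A \<Longrightarrow> 1 \<le> \<phi> (\<lambda>i. p i - q i)"
    and P: "\<And>b. \<phi> b < 0 \<Longrightarrow> P b = 0"
  shows "binomial_dual (A @ B)
      (\<lambda>v. vpf \<phi> P (map (\<lambda>(p, q) i. p i - q i) A) (\<lambda>i. v i - (\<Sum>(p, q)\<leftarrow>A. p i) - u i))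
    = binomial_dual B (\<lambda>v. P (\<lambda>i. v i - u i))"
  using pos
proof (induction A)
  case (Cons pq A)
  obtain p q where pq: "pq = (p, q)" by (cases pq)
  define f where "f = vpf \<phi> P (map (\<lambda>(p, q) i. p i - q i) A)"
  define g where "g = vpf \<phi> P (map (\<lambda>(p, q) i. p i - q i) (pq # A))"
  let ?s = "\<lambda>i. \<Sum>(p, q)\<leftarrow>A. p i"
  have diff: "g b - g (\<lambda>i. b i - (p i - q i)) = f b" for b
    unfolding f_def g_def pq using vpf_difference[of \<phi> "\<lambda>i. p i - q i" P, OF lin _ P] Cons.prems[of p q] pq
    by simp
  have "g (\<lambda>i. v i + p i - (p i + ?s i) - u i) - g (\<lambda>i. v i + q i - (p i + ?s i) - u i)
      = f (\<lambda>i. v i - ?s i - u i)" for v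
    using diff[of "\<lambda>i. v i - ?s i - u i"] by (simp add: algebra_simps)
  then show ?case using Cons by (simp add: pq g_def[unfolded pq] f_def)
qed simp

lemma sp_cong:
  assumes "f \<in> step_poly N d" and eq: "\<And>i. i < N \<Longrightarrow> x i = y i"
  shows "f x = f y"
  using assms(1)
proof (induction rule: step_poly.induct)
  case (sp_term Cs Qs c)
  have "q x = q y" if "q \<in> set Cs \<union> set Qs" for q
    by (rule qa_cong[of q N]) (use sp_term that eq in auto)
  note q = this
  have "map (\<lambda>q. real_of_int (q x)) Qs = map (\<lambda>q. real_of_int (q y)) Qs" using q by simp
  moreover have "(\<forall>q\<in>set Cs. 0 \<le> q x) \<longleftrightarrow> (\<forall>q\<in>set Cs. 0 \<le> q y)" using q by (metis UnI1)
  ultimately show ?case by (simp only:)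
next
  case (sp_add f g)
  then show ?case by simp
qed

text \<open>The base \<open>P\<close> has degree 0 and every generator costs one summation, hence
  one degree.\<close>

lemma vpf_step_poly:
  assumes "P \<in> step_poly r 0" and phi: "\<phi> \<in> quasi_affine r"
  shows "vpf \<phi> P A \<in> step_poly r (length A)"
proof (induction A)
  case Nil
  then show ?case using assms by (metis list.size(3) vpf.simps(1) ext)
next
  case (Cons a A)
  \<comment> \<open>Coordinate \<open>r\<close>, just beyond those of the vector, holds the
    multiplicity of \<open>a\<close>.\<close>
  define f where "f x = vpf \<phi> P A (\<lambda>i. x i - x r * a i)" for x :: "nat \<Rightarrow> int"
  have "(\<lambda>x. x i - x r * a i) \<in> quasi_affine (Suc r)" if "i < r" for i
    using qa_diff[OF qa_coord[of i "Suc r"] qa_smult[OF qa_coord[of r "Suc r"], of "a i"]] that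
    by (simp add: mult.commute)
  then have "f \<in> step_poly (Suc r) (length A)"
    unfolding f_def by (rule sp_subst[OF Cons.IH])
  then have "(\<lambda>x. \<Sum>t\<in>{0..\<phi> x}. f (x(r := t))) \<in> step_poly r (Suc (length A))"
    by (rule sp_sum_last_variable[OF _ phi])
  moreover have "f (x(r := t)) = vpf \<phi> P A (\<lambda>i. x i - t * a i)" for x t
    unfolding f_def by (rule sp_cong[OF Cons.IH]) simp
  ultimately show ?case by (simp add: fun_eq_iff[symmetric] vpf.simps(2)[abs_def])
qed

section \<open>The Kronecker coefficient as a signed sum of vector partition functions\<close>

text \<open>Exponent vectors have \<open>n + m\<close> coordinates, first those of the \<open>x i\<close>, then those of the \<open>y j\<close>;
  \<open>evec n m k\<close> is the exponent of \<open>x (k div m) * y (k mod m)\<close>.\<close>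

definition evec :: "nat \<Rightarrow> nat \<Rightarrow> nat \<Rightarrow> nat \<Rightarrow> int" where
  "evec n m k i = of_bool (i = k div m) + of_bool (i = n + k mod m)"

text \<open>Partial sums within the \<open>x\<close> block or the \<open>y\<close> block. For
  \<open>s\<close> in \<open>simple_index\<close> this is the coefficient of the simple root with
  entry 1 at \<open>s\<close> and -1 at \<open>Suc s\<close>; at \<open>n - 1\<close> and
  \<open>n + m - 1\<close> it is a full block sum, which vanishes on the span of the roots.\<close>

definition psum :: "nat \<Rightarrow> nat \<Rightarrow> (nat \<Rightarrow> int) \<Rightarrow> int" where
  "psum n s b = (\<Sum>i\<in>{(if s < n then 0 else n)..s}. b i)"

definition simple_index :: "nat \<Rightarrow> nat \<Rightarrow> nat set" where
  "simple_index n m = {s. s < n + m \<and> s \<noteq> n - 1 \<and> s \<noteq> n + m - 1}"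

text \<open>For \<open>J\<close> inside \<open>simple_index\<close>, the number of ways to write
  \<open>b\<close> as a nonnegative combination of the simple roots in \<open>J\<close>.
  Independence of these roots makes it 0 or 1, a function of degree 0. A variable \<open>J\<close>
  lets the roots be removed one at a time.\<close>

definition root_count :: "nat \<Rightarrow> nat \<Rightarrow> nat set \<Rightarrow> (nat \<Rightarrow> int) \<Rightarrow> real" where
  "root_count n m J b = of_bool (\<forall>s<n + m. if s \<in> J then 0 \<le> psum n s b else psum n s b = 0)"

text \<open>The weights \<open>m\<close> and 1 are chosen so that the exponent with index
  \<open>k = i * m + j\<close> has height \<open>n * m - 1 - k\<close>. Thus
  \<open>evec n m k - evec n m l\<close> has height \<open>l - k\<close>, positive for
  \<open>k < l\<close>.\<close>

definition height :: "nat \<Rightarrow> nat \<Rightarrow> (nat \<Rightarrow> int) \<Rightarrow> int" where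
  "height n m b = int m * (\<Sum>s<n - 1. psum n s b) + (\<Sum>s\<in>{n..<n + m - 1}. psum n s b)"

text \<open>Pairs \<open>(k, l)\<close> for which \<open>evec n m k - evec n m l\<close> is a simple root of \<open>GL n\<close> or \<open>GL m\<close>. They lie in
  column 1 and row 1, since row 0 and column 0 are used up by the division in \<open>factor_pairs\<close>.\<close>

definition simple_pair :: "nat \<Rightarrow> nat \<Rightarrow> nat \<Rightarrow> nat \<times> nat" where
  "simple_pair n m s = (if s < n then (s * m + 1, Suc s * m + 1) else (m + (s - n), m + (s - n) + 1))"

text \<open>The factors of the Vandermonde product in the variables \<open>x i * y j\<close> that remain, up to a monomial,
  after division by the Vandermonde products in \<open>x\<close> and in \<open>y\<close>.\<close>

definition factor_pairs :: "nat \<Rightarrow> nat \<Rightarrow> (nat \<times> nat) set" where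
  "factor_pairs n m = {(k, l). k < l \<and> l < n * m} - {(k, l). k < l \<and> l < m}
     - (\<lambda>(i, j). (i * m, j * m)) ` {(i, j). i < j \<and> j < n}"

section \<open>Coordinates with respect to the simple roots\<close>

lemma index_pair_div_mod:
  fixes m :: nat
  assumes "j < m"
  shows "(i * m + j) div m = i" and "(i * m + j) mod m = j"
  using assms by auto

lemma psum_linear: "psum n s (\<lambda>i. b i - k * a i) = psum n s b - k * psum n s a"
  by (simp add: psum_def sum_subtractf sum_distrib_left)

lemma height_linear: "height n m (\<lambda>i. b i - k * a i) = height n m b - k * height n m a"
  by (simp add: height_def psum_linear sum_subtractf sum_distrib_left algebra_simps)

lemma sum_of_bool_eq: "finite A \<Longrightarrow> (\<Sum>i\<in>A. of_bool (i = t) :: int) = of_bool (t \<in> A)"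
  by (simp add: of_bool_def)

lemma psum_simple_root:
  assumes "t \<in> simple_index n m" and "s < n + m"
  shows "psum n s (\<lambda>i. of_bool (i = t) - of_bool (i = Suc t)) = of_bool (s = t)"
proof -
  have "psum n s (\<lambda>i. of_bool (i = t) - of_bool (i = Suc t))
      = of_bool (t \<in> {(if s < n then 0 else n)..s}) - of_bool (Suc t \<in> {(if s < n then 0 else n)..s})"
    unfolding psum_def sum_subtractf by (simp only: sum_of_bool_eq finite_atLeastAtMost)
  then show ?thesis using assms by (auto simp: simple_index_def)
qed

text \<open>Subtracting \<open>a\<close> lowers only the partial sum at \<open>t\<close>, by one;
  \<open>0 \<le>\<close> minus \<open>1 \<le>\<close> leaves \<open>= 0\<close>, so \<open>t\<close>
  leaves the index set. This is the counterpart of \<open>vpf_difference\<close> without a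
  summation.\<close>

lemma root_count_difference:
  assumes "t \<notin> J" and "t < n + m" and a: "\<And>s. s < n + m \<Longrightarrow> psum n s a = of_bool (s = t)"
  shows "root_count n m (insert t J) b - root_count n m (insert t J) (\<lambda>i. b i - a i) = root_count n m J b"
proof -
  define Q where "Q = (\<forall>s<n + m. s \<noteq> t \<longrightarrow> (if s \<in> J then 0 \<le> psum n s b else psum n s b = 0))"
  have sh: "psum n s (\<lambda>i. b i - a i) = psum n s b - of_bool (s = t)" if "s < n + m" for s
    using psum_linear[of n s b 1 a] a[OF that] by simp
  have "root_count n m (insert t J) b = of_bool (Q \<and> 0 \<le> psum n t b)"
    unfolding root_count_def Q_def using assms(2) by (intro arg_cong[of _ _ of_bool]) auto
  moreover have "root_count n m (insert t J) (\<lambda>i. b i - a i) = of_bool (Q \<and> 1 \<le> psum n t b)"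
  proof -
    have "(if s \<in> insert t J then 0 \<le> psum n s (\<lambda>i. b i - a i) else psum n s (\<lambda>i. b i - a i) = 0)
      \<longleftrightarrow> (if s = t then 1 \<le> psum n t b else if s \<in> J then 0 \<le> psum n s b else psum n s b = 0)"
      if "s < n + m" for s
      using sh[OF that] by auto
    then show ?thesis
      unfolding root_count_def Q_def using assms(2) by (intro arg_cong[of _ _ of_bool]) (simp, blast)
  qed
  moreover have "root_count n m J b = of_bool (Q \<and> psum n t b = 0)"
    unfolding root_count_def Q_def using assms(1,2) by (intro arg_cong[of _ _ of_bool]) auto
  ultimately show ?thesis by auto
qed

text \<open>Each binomial belonging to a simple root removes that root from the index set, until the
  empty set remains.\<close>

lemma binomial_dual_root_count:
  assumes "distinct ss" and "set ss \<subseteq> {..<n + m}"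
    and "\<And>s t. s \<in> set ss \<Longrightarrow> t < n + m \<Longrightarrow> psum n t (\<lambda>i. p s i - q s i) = of_bool (t = s)"
  shows "binomial_dual (map (\<lambda>s. (p s, q s)) ss)
      (\<lambda>v. root_count n m (set ss) (\<lambda>i. v i - (\<Sum>s\<leftarrow>ss. p s i) - u i))
    = (\<lambda>v. root_count n m {} (\<lambda>i. v i - u i))"
  using assms
proof (induction ss)
  case (Cons t ss)
  let ?s = "\<lambda>i. \<Sum>s\<leftarrow>ss. p s i"
  have diff: "root_count n m (insert t (set ss)) b
      - root_count n m (insert t (set ss)) (\<lambda>i. b i - (p t i - q t i)) = root_count n m (set ss) b" for b
    by (rule root_count_difference) (use Cons.prems in auto)
  have "root_count n m (insert t (set ss)) (\<lambda>i. v i + p t i - (p t i + ?s i) - u i)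
      - root_count n m (insert t (set ss)) (\<lambda>i. v i + q t i - (p t i + ?s i) - u i)
      = root_count n m (set ss) (\<lambda>i. v i - ?s i - u i)" for v
    using diff[of "\<lambda>i. v i - ?s i - u i"] by (simp add: algebra_simps)
  then show ?case using Cons by simp
qed simp

text \<open>Neighbouring partial sums in a block differ by one coordinate. With no root left the
  count is therefore the indicator of the zero vector, which extracts a coefficient.\<close>

lemma root_count_empty: "root_count n m {} b = of_bool (\<forall>i<n + m. b i = 0)"
proof -
  have "b i = 0" if z: "\<forall>s<n + m. psum n s b = 0" and i: "i < n + m" for i
  proof (cases "i = 0 \<or> i = n")
    case True
    then have "psum n i b = b i" by (auto simp: psum_def)
    then show ?thesis using z i by simp
  next
    case False
    define c where "c = (if i < n then 0 else n)"
    have "{c..i} = insert i {c..i - 1}" "i \<notin> {c..i - 1}" using False by (auto simp: c_def)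
    then have "psum n i b = b i + psum n (i - 1) b"
      using False by (simp add: psum_def c_def) (auto simp: not_less)
    then show ?thesis using z i by (metis add.right_neutral less_imp_diff_less)
  qed
  moreover have "psum n s b = 0" if "\<forall>i<n + m. b i = 0" "s < n + m" for s
    unfolding psum_def using that by (intro sum.neutral) auto
  ultimately show ?thesis unfolding root_count_def by (intro arg_cong[of _ _ of_bool]) auto
qed

lemma root_count_negative_height:
  assumes "height n m b < 0" and "0 < n"
  shows "root_count n m (simple_index n m) b = 0"
proof (rule ccontr)
  assume "root_count n m (simple_index n m) b \<noteq> 0"
  then have nonneg: "0 \<le> psum n s b" if "s \<in> simple_index n m" for s
    using that by (auto simp: root_count_def simple_index_def split: if_splits)
  have "0 \<le> height n m b"
    unfolding height_def by (intro add_nonneg_nonneg mult_nonneg_nonneg sum_nonneg nonneg)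
      (use assms(2) in \<open>auto simp: simple_index_def\<close>)
  then show False using assms by simp
qed

lemma psum_evec:
  assumes "k < n * m" and "s < n + m"
  shows "psum n s (evec n m k) = of_bool (if s < n then k div m \<le> s else n + k mod m \<le> s)"
proof -
  have "k div m < n" using assms(1) by (simp add: less_mult_imp_div_less)
  then show ?thesis
    by (auto simp: psum_def evec_def sum.distrib sum_of_bool_eq)
qed

lemma sum_of_bool_ge:
  assumes "a \<le> i" and "i \<le> c"
  shows "(\<Sum>s\<in>{a..<c}. of_bool (i \<le> s) :: int) = int c - int i"
proof -
  have "(\<Sum>s\<in>{a..<c}. of_bool (i \<le> s) :: int) = (\<Sum>s\<in>{i..<c}. 1)"
    using assms by (intro sum.mono_neutral_cong_right) auto
  then show ?thesis using assms by simp
qed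

lemma height_evec:
  assumes "k < n * m"
  shows "height n m (evec n m k) = int (n * m) - 1 - int k"
proof -
  have "m > 0" using assms by (cases m) auto
  have i: "k div m < n" using assms by (simp add: less_mult_imp_div_less)
  have j: "k mod m < m" using \<open>m > 0\<close> by simp
  have "(\<Sum>s<n - 1. psum n s (evec n m k)) = (\<Sum>s\<in>{0..<n - 1}. of_bool (k div m \<le> s))"
    unfolding atLeast0LessThan by (rule sum.cong) (auto simp: psum_evec[OF assms])
  also have "\<dots> = int n - 1 - int (k div m)" using i by (subst sum_of_bool_ge) auto
  finally have 1: "(\<Sum>s<n - 1. psum n s (evec n m k)) = int n - 1 - int (k div m)" .
  have "(\<Sum>s\<in>{n..<n + m - 1}. psum n s (evec n m k)) = (\<Sum>s\<in>{n..<n + m - 1}. of_bool (n + k mod m \<le> s))"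
    by (rule sum.cong) (auto simp: psum_evec[OF assms])
  also have "\<dots> = int m - 1 - int (k mod m)" using j by (subst sum_of_bool_ge) auto
  finally have 2: "(\<Sum>s\<in>{n..<n + m - 1}. psum n s (evec n m k)) = int m - 1 - int (k mod m)" .
  have "int k = int m * int (k div m) + int (k mod m)"
    by (metis mult_div_mod_eq of_nat_add of_nat_mult)
  then show ?thesis unfolding height_def 1 2 by (simp add: algebra_simps)
qed

section \<open>Simple pairs and the factors left after division\<close>

lemma simple_pair_cases:
  assumes "s \<in> simple_index n m" and "2 \<le> m"
  obtains (row) "s < n - 1" "simple_pair n m s = (s * m + 1, Suc s * m + 1)"
  | (col) j where "s = n + j" "j < m - 1" "simple_pair n m s = (m + j, m + j + 1)"
proof (cases "s < n")
  case True
  then show ?thesis using assms row by (auto simp: simple_index_def simple_pair_def)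
next
  case False
  then show ?thesis using assms col[of "s - n"] by (auto simp: simple_index_def simple_pair_def)
qed

lemma evec_simple_pair:
  assumes "s \<in> simple_index n m" and "2 \<le> m"
  shows "evec n m (fst (simple_pair n m s)) i - evec n m (snd (simple_pair n m s)) i
    = of_bool (i = s) - of_bool (i = Suc s)"
  using assms
proof (cases rule: simple_pair_cases)
  case row
  have "(s * m + 1) div m = s" "(s * m + 1) mod m = 1"
    "(Suc s * m + 1) div m = Suc s" "(Suc s * m + 1) mod m = 1"
    using index_pair_div_mod[of 1 m s] index_pair_div_mod[of 1 m "Suc s"] assms(2) by (simp_all only:)
  then show ?thesis unfolding row(2) by (simp add: evec_def)
next
  case (col j)
  have "(m + j) div m = 1" "(m + j) mod m = j" "(m + j + 1) div m = 1" "(m + j + 1) mod m = j + 1"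
    using index_pair_div_mod[of j m 1] index_pair_div_mod[of "j + 1" m 1] col(2)
    by (simp_all only: mult_1 add.assoc)
  then show ?thesis unfolding col(3) by (simp add: evec_def col(1))
qed

text \<open>Row 1 and column 1 of the grid exist because \<open>n\<close> and \<open>m\<close> are
  at least 2. A pair in column 1 is not in column 0 and ends below row 0; a pair in row 1 cannot
  have both indices divisible by \<open>m\<close>.\<close>

lemma simple_pair_in_factor_pairs:
  assumes "s \<in> simple_index n m" and "2 \<le> n" "2 \<le> m"
  shows "simple_pair n m s \<in> factor_pairs n m"
  using assms(1,3)
proof (cases rule: simple_pair_cases)
  case row
  have "Suc s * m + 1 < n * m" using index_pair_less[of "Suc s" n 1 m] row(1) assms by simp
  moreover have "s * m + 1 \<noteq> i * m" for i
  proof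
    assume "s * m + 1 = i * m"
    then have "(s * m + 1) mod m = 0" by simp
    then show False using index_pair_div_mod(2)[of 1 m s] assms(3) by simp
  qed
  ultimately show ?thesis unfolding row(2) using assms(3) by (auto simp: factor_pairs_def)
next
  case (col j)
  have "m + j + 1 < n * m" using index_pair_less[of 1 n "j + 1" m] col(2) assms by simp
  moreover have "\<not> (m + j = i * m \<and> m + j + 1 = i' * m)" for i i'
  proof
    assume h: "m + j = i * m \<and> m + j + 1 = i' * m"
    have "(1 * m + (j + 1)) mod m = j + 1" using col(2) by (intro index_pair_div_mod) simp
    moreover have "1 * m + (j + 1) = i' * m" using h by simp
    ultimately show False by (metis mod_mult_self2_is_0 add_is_0 zero_neq_one)
  qed
  ultimately show ?thesis unfolding col(3) by (auto simp: factor_pairs_def)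
qed

lemma inj_on_simple_pair:
  assumes "2 \<le> m"
  shows "inj_on (simple_pair n m) (simple_index n m)"
proof (rule inj_onI)
  fix s t assume s: "s \<in> simple_index n m" and t: "t \<in> simple_index n m"
    and eq: "simple_pair n m s = simple_pair n m t"
  show "s = t"
    using s assms
  proof (cases rule: simple_pair_cases)
    case row
    from t assms show ?thesis
      by (cases rule: simple_pair_cases) (use row eq assms in auto)
  next
    case (col j)
    from t assms show ?thesis
      by (cases rule: simple_pair_cases) (use col eq assms in auto)
  qed
qed

lemma card_simple_index:
  assumes "2 \<le> n" "2 \<le> m"
  shows "card (simple_index n m) = n + m - 2"
proof -
  have "simple_index n m = {..<n + m} - {n - 1, n + m - 1}"
    by (auto simp: simple_index_def)
  then show ?thesis using assms by (simp add: card_Diff_subset)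
qed

lemma card_pairs_less: "card {(i, j). i < j \<and> j < (N :: nat)} = N choose 2"
proof (induction N)
  case (Suc N)
  have "{(i, j). i < j \<and> j < Suc N} = {(i, j). i < j \<and> j < N} \<union> (\<lambda>i. (i, N)) ` {..<N}"
    by auto
  then have "card {(i, j). i < j \<and> j < Suc N}
      = card {(i, j). i < j \<and> j < N} + card ((\<lambda>i. (i, N)) ` {..<N})"
    by (simp only:) (rule card_Un_disjoint, auto simp: finite_pairs_less)
  also have "\<dots> = (N choose 2) + N" using Suc by (subst card_image) (auto simp: inj_on_def)
  finally show ?case by (simp add: numeral_2_eq_2)
qed simp

lemma factor_pairs_decomposition:
  assumes "0 < n" "0 < m"
  defines "K1 \<equiv> {(k, l). k < l \<and> l < m}"
    and "K2 \<equiv> (\<lambda>(i, j). (i * m, j * m)) ` {(i, j). i < j \<and> j < n}"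
  shows "{(k, l). k < l \<and> l < n * m} = K1 \<union> K2 \<union> factor_pairs n m"
    and "K1 \<inter> K2 = {}" and "(K1 \<union> K2) \<inter> factor_pairs n m = {}"
    and "inj_on (\<lambda>(i, j). (i * m, j * m)) {(i, j). i < j \<and> j < n}"
    and "finite K1" and "finite K2" and "finite (factor_pairs n m)"
proof -
  have "K1 \<subseteq> {(k, l). k < l \<and> l < n * m}"
    using assms(1) by (auto simp: K1_def intro: order_less_le_trans)
  moreover have "K2 \<subseteq> {(k, l). k < l \<and> l < n * m}" using assms(2) by (auto simp: K2_def)
  ultimately show "{(k, l). k < l \<and> l < n * m} = K1 \<union> K2 \<union> factor_pairs n m"
    unfolding factor_pairs_def K1_def[symmetric] K2_def[symmetric] by blast
  show "K1 \<inter> K2 = {}" by (auto simp: K1_def K2_def)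
  show "(K1 \<union> K2) \<inter> factor_pairs n m = {}"
    unfolding factor_pairs_def K1_def[symmetric] K2_def[symmetric] by blast
  show "inj_on (\<lambda>(i, j). (i * m, j * m)) {(i, j). i < j \<and> j < n}"
    using assms(2) by (auto simp: inj_on_def)
  show "finite K1" "finite K2" "finite (factor_pairs n m)"
    by (auto simp: K1_def K2_def factor_pairs_def finite_pairs_less)
qed

lemma card_factor_pairs:
  assumes "0 < n" "0 < m"
  shows "card (factor_pairs n m) + (m choose 2) + (n choose 2) = (n * m) choose 2"
proof -
  note D = factor_pairs_decomposition[OF assms]
  have "card {(k, l). k < l \<and> l < n * m}
      = card ({(k, l). k < l \<and> l < m} \<union> (\<lambda>(i, j). (i * m, j * m)) ` {(i, j). i < j \<and> j < n})
        + card (factor_pairs n m)"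
    unfolding D(1) using D(3,5,6,7) by (intro card_Un_disjoint) auto
  also have "card ({(k, l). k < l \<and> l < m} \<union> (\<lambda>(i, j). (i * m, j * m)) ` {(i, j). i < j \<and> j < n})
      = card {(k, l). k < l \<and> l < m} + card ((\<lambda>(i, j). (i * m, j * m)) ` {(i, j). i < j \<and> j < n})"
    by (rule card_Un_disjoint[OF D(5,6,2)])
  finally show ?thesis using card_image[OF D(4)] by (simp add: card_pairs_less)
qed

text \<open>Pairs inside row 0 contribute \<open>x 0 * (y k - y l)\<close> and pairs inside column 0
  contribute \<open>y 0 * (x i - x j)\<close>; collecting them gives the two Vandermonde products
  and the monomial.\<close>

lemma vandermonde_prodvar:
  assumes "0 < n" "0 < m"
  shows "vandermonde (n * m) (prodvar m x y) = vandermonde n x * vandermonde m y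
    * (x 0 ^ (m choose 2) * y 0 ^ (n choose 2))
    * (\<Prod>(k, l)\<in>factor_pairs n m. prodvar m x y k - prodvar m x y l)"
proof -
  note D = factor_pairs_decomposition[OF assms]
  let ?f = "\<lambda>(k, l). prodvar m x y k - prodvar m x y l"
  have "vandermonde (n * m) (prodvar m x y)
      = prod ?f ({(k, l). k < l \<and> l < m} \<union> (\<lambda>(i, j). (i * m, j * m)) ` {(i, j). i < j \<and> j < n})
        * prod ?f (factor_pairs n m)"
    unfolding vandermonde_def D(1) using D(3,5,6,7) by (intro prod.union_disjoint) auto
  also have "prod ?f ({(k, l). k < l \<and> l < m} \<union> (\<lambda>(i, j). (i * m, j * m)) ` {(i, j). i < j \<and> j < n})
      = prod ?f {(k, l). k < l \<and> l < m} * prod ?f ((\<lambda>(i, j). (i * m, j * m)) ` {(i, j). i < j \<and> j < n})"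
    by (rule prod.union_disjoint[OF D(5,6,2)])
  also have "prod ?f {(k, l). k < l \<and> l < m} = (\<Prod>(k, l)\<in>{(k, l). k < l \<and> l < m}. x 0 * (y k - y l))"
    by (rule prod.cong) (auto simp: prodvar_def right_diff_distrib)
  also have "\<dots> = x 0 ^ (m choose 2) * vandermonde m y"
    by (simp add: case_prod_unfold prod.distrib vandermonde_def card_pairs_less[unfolded case_prod_unfold])
  also have "prod ?f ((\<lambda>(i, j). (i * m, j * m)) ` {(i, j). i < j \<and> j < n})
      = (\<Prod>(i, j)\<in>{(i, j). i < j \<and> j < n}. y 0 * (x i - x j))"
    unfolding prod.reindex[OF D(4)]
    by (rule prod.cong) (use assms in \<open>auto simp: prodvar_def algebra_simps\<close>)
  also have "\<dots> = y 0 ^ (n choose 2) * vandermonde n x"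
    by (simp add: case_prod_unfold prod.distrib vandermonde_def card_pairs_less[unfolded case_prod_unfold])
  finally show ?thesis by (simp add: mult_ac)
qed

section \<open>Monomials and alternants as coefficient functionals\<close>

definition pairvec :: "nat \<Rightarrow> nat \<Rightarrow> (nat \<Rightarrow> int) \<Rightarrow> (nat \<Rightarrow> int) \<Rightarrow> nat \<Rightarrow> int" where
  "pairvec n m e f i = (if i < n then e i else if i < n + m then f (i - n) else 0)"

lemma prod_lessThan_add:
  fixes f :: "nat \<Rightarrow> real"
  shows "(\<Prod>i<n + m. f i) = (\<Prod>i<n. f i) * (\<Prod>j<m. f (n + j))"
  by (induction m) (auto simp: mult_ac)

lemma lmono_pairvec:
  "lmono (n + m) (pairvec n m (\<lambda>i. int (e i)) (\<lambda>j. int (f j))) w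
    = (\<Prod>i<n. w i ^ e i) * (\<Prod>j<m. w (n + j) ^ f j)"
  by (simp add: lmono_def prod_lessThan_add pairvec_def)

lemma prod_power_of_bool:
  fixes w :: "nat \<Rightarrow> real"
  assumes "a < n"
  shows "(\<Prod>i<n. w i ^ of_bool (i = a)) = w a"
proof -
  have "(\<Prod>i<n. w i ^ of_bool (i = a)) = (\<Prod>i<n. if i = a then w i else 1)"
    by (rule prod.cong) auto
  then show ?thesis using assms by simp
qed

lemma lmono_evec:
  assumes "k < n * m"
  shows "lmono (n + m) (evec n m k) w = prodvar m w (\<lambda>j. w (n + j)) k"
proof -
  have "m > 0" using assms by (cases m) auto
  have k: "k div m < n" "k mod m < m"
    using assms \<open>m > 0\<close> by (auto simp: less_mult_imp_div_less)
  have "evec n m k = pairvec n m (\<lambda>i. int (of_bool (i = k div m))) (\<lambda>j. int (of_bool (j = k mod m)))"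
    using k by (auto simp: fun_eq_iff evec_def pairvec_def)
  then show ?thesis
    by (simp only: lmono_pairvec prod_power_of_bool[OF k(1)] prod_power_of_bool[OF k(2), of "\<lambda>j. w (n + j)"]
        prodvar_def)
qed

lemma evec_zero: "k < n * m \<Longrightarrow> n + m \<le> i \<Longrightarrow> evec n m k i = 0"
proof -
  assume k: "k < n * m" and i: "n + m \<le> i"
  have "m > 0" using k by (cases m) auto
  then have "k div m < n" "k mod m < m" using k by (auto simp: less_mult_imp_div_less)
  then show ?thesis using i by (simp add: evec_def)
qed

lemma lmono_nat_mult: "lmono r (\<lambda>i. int a * u i) w = lmono r u w ^ a"
proof -
  have "w i powi (int a * u i) = (w i powi u i) ^ a" for i
    by (metis mult.commute power_int_mult power_int_of_nat)
  then show ?thesis by (simp add: lmono_def prod_power_distrib)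
qed

lemma lmono_sum:
  assumes "finite K" and "\<And>i. 0 < w i"
  shows "lmono r (\<lambda>i. \<Sum>k\<in>K. int (a k) * u k i) w = (\<Prod>k\<in>K. lmono r (u k) w ^ a k)"
  using assms(1)
proof (induction K rule: finite_induct)
  case empty
  then show ?case by (simp add: lmono_def)
next
  case (insert k K)
  then show ?case
    using lmono_add[of w r "\<lambda>i. int (a k) * u k i" "\<lambda>i. \<Sum>k\<in>K. int (a k) * u k i", OF assms(2)]
    by (simp add: lmono_nat_mult)
qed

lemma lrep_alternant_product:
  "lrep (n + m) (\<lambda>w. alternant n e w * alternant m f (\<lambda>j. w (n + j)))
    (\<lambda>g. \<Sum>p | p permutes {..<n}. \<Sum>q | q permutes {..<m}. of_int (sign p) * of_int (sign q)
        * g (pairvec n m (\<lambda>i. int (e (p i))) (\<lambda>j. int (f (q j)))))"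
proof -
  have "lrep (n + m) (\<lambda>w. \<Sum>p | p permutes {..<n}. \<Sum>q | q permutes {..<m}.
      of_int (sign p) * of_int (sign q) * lmono (n + m) (pairvec n m (\<lambda>i. int (e (p i))) (\<lambda>j. int (f (q j)))) w)
    (\<lambda>g. \<Sum>p | p permutes {..<n}. \<Sum>q | q permutes {..<m}. of_int (sign p) * of_int (sign q)
        * g (pairvec n m (\<lambda>i. int (e (p i))) (\<lambda>j. int (f (q j)))))"
    by (intro lrep_sum lrep_smult lrep_mono) (auto simp: finite_permutations pairvec_def)
  then show ?thesis
    by (rule lrep_cong) (simp_all add: alternant_def sum_product lmono_pairvec mult_ac)
qed

lemma lrep_alternant_prodvar:
  "lrep (n + m) (\<lambda>w. alternant (n * m) e (prodvar m w (\<lambda>j. w (n + j))))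
    (\<lambda>g. \<Sum>\<sigma> | \<sigma> permutes {..<n * m}. of_int (sign \<sigma>)
        * g (\<lambda>i. \<Sum>k<n * m. int (e (\<sigma> k)) * evec n m k i))"
proof -
  have "lrep (n + m) (\<lambda>w. \<Sum>\<sigma> | \<sigma> permutes {..<n * m}. of_int (sign \<sigma>)
      * lmono (n + m) (\<lambda>i. \<Sum>k<n * m. int (e (\<sigma> k)) * evec n m k i) w)
    (\<lambda>g. \<Sum>\<sigma> | \<sigma> permutes {..<n * m}. of_int (sign \<sigma>)
        * g (\<lambda>i. \<Sum>k<n * m. int (e (\<sigma> k)) * evec n m k i))"
    by (intro lrep_sum lrep_smult lrep_mono) (auto simp: finite_permutations evec_zero)
  then show ?thesis
  proof (rule lrep_cong)
    fix w :: "nat \<Rightarrow> real" assume w: "\<And>i. 0 < w i"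
    have "lmono (n + m) (\<lambda>i. \<Sum>k<n * m. int (e (\<sigma> k)) * evec n m k i) w
        = (\<Prod>k<n * m. prodvar m w (\<lambda>j. w (n + j)) k ^ e (\<sigma> k))" for \<sigma>
      unfolding lmono_sum[of "{..<n * m}" w "n + m" "\<lambda>k. e (\<sigma> k)" "evec n m", OF finite_lessThan w]
      by (rule prod.cong) (simp_all add: lmono_evec)
    then show "alternant (n * m) e (prodvar m w (\<lambda>j. w (n + j)))
        = (\<Sum>\<sigma> | \<sigma> permutes {..<n * m}. of_int (sign \<sigma>)
            * lmono (n + m) (\<lambda>i. \<Sum>k<n * m. int (e (\<sigma> k)) * evec n m k i) w)"
      by (simp add: alternant_def)
  qed simp
qed

section \<open>Extraction of one Kronecker coefficient\<close>

lemma staircase_strict: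
  assumes "length a = n" and "sorted_wrt (\<ge>) a" and "i < j" "j < n"
  shows "staircase n a j < staircase n a i"
proof -
  have "a ! j \<le> a ! i" using assms by (simp add: sorted_wrt_iff_nth_less)
  then show ?thesis using assms(3,4) by (simp add: staircase_def)
qed

text \<open>Both staircases are strictly decreasing, so a permutation matching them is increasing,
  hence the identity.\<close>

lemma staircase_permuted_eq:
  assumes a: "length a = n" "sorted_wrt (\<ge>) a" and b: "length b = n" "sorted_wrt (\<ge>) b"
    and p: "p permutes {..<n}" and eq: "\<And>i. i < n \<Longrightarrow> staircase n a (p i) = staircase n b i"
  shows "p = id" and "a = b"
proof -
  have mono: "p i < p j" if "i < j" "j < n" for i j
  proof (rule ccontr)
    assume "\<not> p i < p j"
    moreover have "p i \<noteq> p j" using permutes_inj[OF p] that by (metis injD less_irrefl)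
    ultimately have "p j < p i" by simp
    moreover have "p i < n" using permutes_in_image[OF p, of i] that by simp
    ultimately have "staircase n a (p i) < staircase n a (p j)" using staircase_strict[OF a] by blast
    then show False using eq[of i] eq[of j] staircase_strict[OF b that] that by simp
  qed
  have "i \<le> p i" if "i < n" for i
    using that
  proof (induction i)
    case (Suc i)
    then show ?case using mono[of i "Suc i"] by simp
  qed simp
  then show "p = id" by (intro permutes_natset_ge[OF p]) auto
  then have "a ! i = b ! i" if "i < n" for i
    using eq[OF that] by (simp only: staircase_def id_apply add_right_cancel)
  then show "a = b" using a(1) b(1) by (intro nth_equalityI) auto
qed

lemma sum_sign_delta:
  assumes "finite S"
  shows "(\<Sum>p | p permutes S. of_int (sign p) * of_bool (p = id) :: real) = 1"
proof -
  have "(\<Sum>p | p permutes S. of_int (sign p) * of_bool (p = id) :: real)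
      = (\<Sum>p | p permutes S. if p = id then 1 else 0)"
    by (rule sum.cong) auto
  then show ?thesis using assms by (simp add: finite_permutations permutes_id)
qed

text \<open>The sum of the first exponents of all binomials, simple ones included, plus the exponent
  of the monomial split off from the Vandermonde quotient.\<close>

definition kron_shift :: "nat \<Rightarrow> nat \<Rightarrow> (nat \<times> nat) list \<Rightarrow> nat list \<Rightarrow> nat \<Rightarrow> int" where
  "kron_shift n m As ss i = (\<Sum>(k, l)\<leftarrow>As. evec n m k i)
     + (\<Sum>s\<leftarrow>ss. evec n m (fst (simple_pair n m s)) i)
     + (if i = 0 then int (m choose 2) else if i = n then int (n choose 2) else 0)"

abbreviation root_vpf :: "nat \<Rightarrow> nat \<Rightarrow> (nat \<times> nat) list \<Rightarrow> (nat \<Rightarrow> int) \<Rightarrow> real" where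
  "root_vpf n m As \<equiv> vpf (height n m) (root_count n m (simple_index n m))
     (map (\<lambda>(k, l) i. evec n m k i - evec n m l i) As)"

text \<open>The expansion, multiplied by the Vandermonde product in \<open>z\<close>, is an identity
  of Laurent polynomials and is tested against one function \<open>g\<close>. On the side of the
  products of alternants only the coefficient of \<open>(mu, nu)\<close> survives; on the side of
  the alternant in \<open>z\<close> the values of \<open>g\<close> are the stated partition
  functions.\<close>

lemma kron_coefficient_formula:
  fixes c :: "nat list \<Rightarrow> nat list \<Rightarrow> real"
  assumes nm: "2 \<le> n" "2 \<le> m" and lam: "length lam = n * m" "sorted_wrt (\<ge>) lam"
    and D: "D = partitions_len n (sum_list lam) \<times> partitions_len m (sum_list lam)"
    and c: "\<And>x y. schur lam (n * m) (prodvar m x y) = (\<Sum>(a, b)\<in>D. c a b * schur a n x * schur b m y)"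
    and mu: "(mu, nu) \<in> D"
    and As: "distinct As" "set As = factor_pairs n m - simple_pair n m ` simple_index n m"
    and ss: "distinct ss" "set ss = simple_index n m"
  shows "c mu nu = (\<Sum>\<sigma> | \<sigma> permutes {..<n * m}. of_int (sign \<sigma>) *
    root_vpf n m As
      (\<lambda>i. (\<Sum>k<n * m. int (staircase (n * m) lam (\<sigma> k)) * evec n m k i)
        - pairvec n m (\<lambda>i. int (staircase n mu i)) (\<lambda>j. int (staircase m nu j)) i
        - kron_shift n m As ss i))"
proof -
  define \<kappa> :: "nat \<Rightarrow> int" where
    "\<kappa> i = (if i = 0 then int (m choose 2) else if i = n then int (n choose 2) else 0)" for i
  define e where "e = evec n m"
  define A where "A = map (\<lambda>(k, l). (e k, e l)) As"
  define p where "p s = e (fst (simple_pair n m s))" for s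
  define q where "q s = e (snd (simple_pair n m s))" for s
  define B where "B = map (\<lambda>s. (p s, q s)) ss"
  define t where "t = pairvec n m (\<lambda>i. int (staircase n mu i)) (\<lambda>j. int (staircase m nu j))"
  \<comment> \<open>Translated so that after all difference operators the indicator sits at
    \<open>t + \<kappa>\<close>, the exponent of \<open>mu\<close> and \<open>nu\<close> shifted by
    the monomial of the quotient.\<close>
  define g where "g v = vpf (height n m) (root_count n m (simple_index n m))
      (map (\<lambda>(p, q) i. p i - q i) A)
      (\<lambda>i. v i - (\<Sum>(p, q)\<leftarrow>A. p i) - ((\<Sum>s\<leftarrow>ss. p s i) + (t i + \<kappa> i)))" for v
  define L where "L g = (\<Sum>(a, b)\<in>D. c a b * (\<Sum>p | p permutes {..<n}. \<Sum>q | q permutes {..<m}.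
      of_int (sign p) * of_int (sign q)
        * g (pairvec n m (\<lambda>i. int (staircase n a (p i))) (\<lambda>j. int (staircase m b (q j))))))"
    for g :: "(nat \<Rightarrow> int) \<Rightarrow> real"
  define f where "f w = (\<Sum>(a, b)\<in>D. c a b
      * (alternant n (staircase n a) w * alternant m (staircase m b) (\<lambda>j. w (n + j))))" for w
  have finD: "finite D" by (simp add: D finite_partitions_len)
  have part: "length a = n" "sorted_wrt (\<ge>) a" "length b = m" "sorted_wrt (\<ge>) b" if "(a, b) \<in> D" for a b
    using that by (auto simp: D partitions_len_def)
  have pairs: "k < n * m" "l < n * m" "k < l" if "(k, l) \<in> factor_pairs n m" for k l
    using that by (auto simp: factor_pairs_def)
  have simple: "simple_pair n m s \<in> factor_pairs n m" if "s \<in> simple_index n m" for s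
    using simple_pair_in_factor_pairs[OF that nm] .
  have zero: "(p, q) \<in> set (A @ B) \<Longrightarrow> n + m \<le> i \<Longrightarrow> p i = 0 \<and> q i = 0" for p q i
    using pairs simple ss(2) As(2) unfolding A_def B_def e_def p_def q_def
    by (auto simp: evec_zero) (metis evec_zero pairs(1,2) prod.collapse)+
  have f: "lrep (n + m) f L"
    unfolding f_def[abs_def] L_def[abs_def] case_prod_unfold
    by (intro lrep_sum finD lrep_smult lrep_alternant_product)
  \<comment> \<open>\<open>f\<close> is the expansion times the Vandermonde products in
    \<open>x\<close> and \<open>y\<close>; the monomial and the binomials supply the rest of the one
    in \<open>z\<close>.\<close>
  have "lrep (n + m) (\<lambda>w. f w * lmono (n + m) \<kappa> w * (\<Prod>(p, q)\<leftarrow>A @ B. lmono (n + m) p w - lmono (n + m) q w))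
      (\<lambda>g. L (\<lambda>v. binomial_dual (A @ B) g (\<lambda>i. v i + \<kappa> i)))"
    by (intro lrep_mult_binomials[OF lrep_shift[OF f]] zero) (use nm in \<open>auto simp: \<kappa>_def\<close>)
  moreover have "f w * lmono (n + m) \<kappa> w * (\<Prod>(p, q)\<leftarrow>A @ B. lmono (n + m) p w - lmono (n + m) q w)
      = alternant (n * m) (staircase (n * m) lam) (prodvar m w (\<lambda>j. w (n + j)))" for w
  proof -
    define y where "y = (\<lambda>j. w (n + j))"
    let ?z = "prodvar m w y"
    have "f w = vandermonde n w * vandermonde m y * schur lam (n * m) ?z"
      unfolding f_def c sum_distrib_left y_def[symmetric] case_prod_unfold
    proof (rule sum.cong[OF refl])
      fix d assume "d \<in> D"
      then have ab: "length (fst d) = n" "sorted_wrt (\<ge>) (fst d)" "length (snd d) = m" "sorted_wrt (\<ge>) (snd d)"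
        using part[of "fst d" "snd d"] by auto
      show "c (fst d) (snd d) * (alternant n (staircase n (fst d)) w * alternant m (staircase m (snd d)) y)
          = vandermonde n w * vandermonde m y * (c (fst d) (snd d) * schur (fst d) n w * schur (snd d) m y)"
        unfolding schur_bialternant[OF ab(1,2), symmetric] schur_bialternant[OF ab(3,4), symmetric]
        by (simp add: mult_ac)
    qed
    moreover have "lmono (n + m) \<kappa> w = w 0 ^ (m choose 2) * y 0 ^ (n choose 2)"
    proof -
      have "\<kappa> = pairvec n m (\<lambda>i. int (if i = 0 then m choose 2 else 0)) (\<lambda>j. int (if j = 0 then n choose 2 else 0))"
        using nm by (auto simp: fun_eq_iff \<kappa>_def pairvec_def)
      moreover have "(\<Prod>i<N. h i ^ (if i = 0 then k else 0)) = h 0 ^ k" if "0 < N" for h :: "nat \<Rightarrow> real" and N k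
      proof -
        have "(\<Prod>i<N. h i ^ (if i = 0 then k else 0)) = (\<Prod>i<N. if i = 0 then h 0 ^ k else 1)"
          by (rule prod.cong) auto
        then show ?thesis using that by simp
      qed
      ultimately show ?thesis using nm by (simp only: lmono_pairvec y_def)
    qed
    moreover have "(\<Prod>(p, q)\<leftarrow>A @ B. lmono (n + m) p w - lmono (n + m) q w)
        = (\<Prod>(k, l)\<in>factor_pairs n m. ?z k - ?z l)"
    proof -
      define R where "R = As @ map (simple_pair n m) ss"
      have "distinct R" "set R = factor_pairs n m"
        using As ss inj_on_simple_pair[OF nm(2)] simple by (auto simp: R_def distinct_map)
      moreover have "A @ B = map (\<lambda>(k, l). (e k, e l)) R"
        by (simp add: R_def A_def B_def p_def q_def case_prod_unfold)
      moreover have "(\<Prod>(k, l)\<leftarrow>R. lmono (n + m) (e k) w - lmono (n + m) (e l) w) = (\<Prod>(k, l)\<leftarrow>R. ?z k - ?z l)"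
      proof (rule arg_cong[of _ _ prod_list], rule map_cong[OF refl], clarify)
        fix k l assume "(k, l) \<in> set R"
        then show "lmono (n + m) (e k) w - lmono (n + m) (e l) w = ?z k - ?z l"
          using pairs[of k l] \<open>set R = factor_pairs n m\<close> by (simp add: e_def lmono_evec y_def)
      qed
      ultimately show ?thesis
        using prod.distinct_set_conv_list[of R "\<lambda>(k, l). ?z k - ?z l"]
        by (simp add: comp_def case_prod_unfold)
    qed
    ultimately have "f w * lmono (n + m) \<kappa> w * (\<Prod>(p, q)\<leftarrow>A @ B. lmono (n + m) p w - lmono (n + m) q w)
        = schur lam (n * m) ?z * vandermonde (n * m) ?z"
      using vandermonde_prodvar[of n m w y] nm by (simp add: mult_ac)
    then show ?thesis by (simp add: schur_bialternant[OF lam] y_def)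
  qed
  ultimately have "L (\<lambda>v. binomial_dual (A @ B) g (\<lambda>i. v i + \<kappa> i))
      = (\<Sum>\<sigma> | \<sigma> permutes {..<n * m}. of_int (sign \<sigma>)
        * g (\<lambda>i. \<Sum>k<n * m. int (staircase (n * m) lam (\<sigma> k)) * evec n m k i))"
    by (rule lrep_unique[OF _ lrep_alternant_prodvar])
  moreover have "L (\<lambda>v. binomial_dual (A @ B) g (\<lambda>i. v i + \<kappa> i)) = c mu nu"
  proof -
    \<comment> \<open>The binomials of \<open>A\<close> undo the summations; those of
      \<open>B\<close> then undo the inequalities on the simple-root coordinates.\<close>
    have "binomial_dual (A @ B) g = binomial_dual B (\<lambda>v. root_count n m (simple_index n m)
        (\<lambda>i. v i - ((\<Sum>s\<leftarrow>ss. p s i) + (t i + \<kappa> i))))"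
      unfolding g_def[abs_def]
    proof (rule binomial_dual_vpf)
      fix p' q' assume "(p', q') \<in> set A"
      then obtain k l where kl: "(k, l) \<in> factor_pairs n m" "p' = e k" "q' = e l"
        using As(2) by (auto simp: A_def)
      have "height n m (\<lambda>i. p' i - 1 * q' i) = int l - int k"
        unfolding height_linear kl(2,3) e_def using pairs[OF kl(1)] by (simp add: height_evec)
      then show "1 \<le> height n m (\<lambda>i. p' i - q' i)" using pairs(3)[OF kl(1)] by simp
    next
      fix b assume "height n m b < 0"
      then show "root_count n m (simple_index n m) b = 0"
        using root_count_negative_height nm by simp
    qed (rule height_linear)
    also have "\<dots> = (\<lambda>v. root_count n m {} (\<lambda>i. v i - (t i + \<kappa> i)))"
      unfolding B_def ss(2)[symmetric] diff_diff_eq[symmetric, of _ "\<Sum>s\<leftarrow>ss. p s _"]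
    proof (rule binomial_dual_root_count[OF ss(1)])
      show "set ss \<subseteq> {..<n + m}" by (auto simp: ss(2) simple_index_def)
      fix s r assume "s \<in> set ss" "r < n + m"
      then show "psum n r (\<lambda>i. p s i - q s i) = of_bool (r = s)"
        unfolding p_def q_def e_def
        using evec_simple_pair[of s n m] psum_simple_root[of s n m r] nm(2) ss(2) by simp
    qed
    finally have dual: "binomial_dual (A @ B) g (\<lambda>i. v i + \<kappa> i) = of_bool (\<forall>i<n + m. v i = t i)" for v
      by (simp add: root_count_empty)
    \<comment> \<open>The exponent \<open>t\<close> is strictly decreasing in each block, so it
      occurs in a product of alternants only for \<open>(mu, nu)\<close> itself and identity
      permutations.\<close>
    have "(\<Sum>p | p permutes {..<n}. \<Sum>q | q permutes {..<m}. of_int (sign p) * of_int (sign q)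
        * of_bool (\<forall>i<n + m. pairvec n m (\<lambda>i. int (staircase n a (p i))) (\<lambda>j. int (staircase m b (q j))) i = t i))
      = (of_bool ((a, b) = (mu, nu)) :: real)" if ab: "(a, b) \<in> D" for a b
    proof -
      have "(\<forall>i<n + m. pairvec n m (\<lambda>i. int (staircase n a (p i))) (\<lambda>j. int (staircase m b (q j))) i = t i)
          \<longleftrightarrow> (a, b) = (mu, nu) \<and> p = id \<and> q = id" if pq: "p permutes {..<n}" "q permutes {..<m}" for p q
      proof
        assume eq: "\<forall>i<n + m. pairvec n m (\<lambda>i. int (staircase n a (p i))) (\<lambda>j. int (staircase m b (q j))) i = t i"
        have "staircase n a (p i) = staircase n mu i" if "i < n" for i
          using eq[rule_format, of i] that by (simp add: pairvec_def t_def)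
        moreover have "staircase m b (q j) = staircase m nu j" if "j < m" for j
          using eq[rule_format, of "n + j"] that by (simp add: pairvec_def t_def)
        ultimately show "(a, b) = (mu, nu) \<and> p = id \<and> q = id"
          using staircase_permuted_eq[OF part(1,2)[OF ab] part(1,2)[OF mu] pq(1)]
            staircase_permuted_eq[OF part(3,4)[OF ab] part(3,4)[OF mu] pq(2)] by simp
      qed (auto simp: t_def)
      then have "(\<Sum>p | p permutes {..<n}. \<Sum>q | q permutes {..<m}. of_int (sign p) * of_int (sign q)
        * of_bool (\<forall>i<n + m. pairvec n m (\<lambda>i. int (staircase n a (p i))) (\<lambda>j. int (staircase m b (q j))) i = t i))
        = (\<Sum>p | p permutes {..<n}. \<Sum>q | q permutes {..<m}. of_bool ((a, b) = (mu, nu))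
            * ((of_int (sign p) * of_bool (p = id)) * (of_int (sign q) * of_bool (q = id))))"
        by (intro sum.cong refl) auto
      also have "\<dots> = (of_bool ((a, b) = (mu, nu)) :: real)"
        by (simp only: sum_distrib_left[symmetric] sum_distrib_right[symmetric] sum_sign_delta finite_lessThan mult_1_right)
      finally show ?thesis .
    qed
    then have "L (\<lambda>v. binomial_dual (A @ B) g (\<lambda>i. v i + \<kappa> i)) = (\<Sum>(a, b)\<in>D. c a b * of_bool ((a, b) = (mu, nu)))"
      unfolding dual L_def by (intro sum.cong) auto
    also have "\<dots> = (\<Sum>d\<in>D. if d = (mu, nu) then c mu nu else 0)"
      by (rule sum.cong) auto
    also have "\<dots> = c mu nu" using finD mu by simp
    finally show ?thesis .
  qed
  moreover have "g v = root_vpf n m As (\<lambda>i. v i - t i - kron_shift n m As ss i)" for v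
  proof -
    have "map (\<lambda>(p, q) i. p i - q i) A = map (\<lambda>(k, l) i. evec n m k i - evec n m l i) As"
      by (simp add: A_def e_def case_prod_unfold)
    moreover have "(\<lambda>i. v i - (\<Sum>(p, q)\<leftarrow>A. p i) - ((\<Sum>s\<leftarrow>ss. p s i) + (t i + \<kappa> i)))
        = (\<lambda>i. v i - t i - kron_shift n m As ss i)"
      by (simp add: fun_eq_iff kron_shift_def A_def p_def e_def \<kappa>_def comp_def case_prod_unfold)
    ultimately show ?thesis by (simp only: g_def)
  qed
  ultimately show ?thesis by (simp add: t_def)
qed

text \<open>Every coefficient function satisfying the defining property is given by the same
  expression on \<open>D\<close> and is 0 elsewhere. That settles uniqueness, so the definite
  description denotes the expansion already constructed.\<close>

lemma kron_formula:
  assumes nm: "2 \<le> n" "2 \<le> m" and lam: "length lam = n * m" "sorted_wrt (\<ge>) lam"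
    and mu: "mu \<in> partitions_len n (sum_list lam)" and nu: "nu \<in> partitions_len m (sum_list lam)"
    and As: "distinct As" "set As = factor_pairs n m - simple_pair n m ` simple_index n m"
    and ss: "distinct ss" "set ss = simple_index n m"
  shows "kron n m mu nu lam = (\<Sum>\<sigma> | \<sigma> permutes {..<n * m}. of_int (sign \<sigma>) *
    root_vpf n m As
      (\<lambda>i. (\<Sum>k<n * m. int (staircase (n * m) lam (\<sigma> k)) * evec n m k i)
        - pairvec n m (\<lambda>i. int (staircase n mu i)) (\<lambda>j. int (staircase m nu j)) i
        - kron_shift n m As ss i))"
    (is "_ = ?F mu nu")
proof -
  define D where "D = partitions_len n (sum_list lam) \<times> partitions_len m (sum_list lam)"
  define Q where "Q c \<longleftrightarrow> (\<forall>a b. (a, b) \<notin> D \<longrightarrow> c a b = 0) \<and>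
      (\<forall>x y. schur lam (n * m) (prodvar m x y) = (\<Sum>(a, b)\<in>D. c a b * schur a n x * schur b m y))"
    for c :: "nat list \<Rightarrow> nat list \<Rightarrow> real"
  have F: "c a b = (if (a, b) \<in> D then ?F a b else 0)" if "Q c" for c a b
    using kron_coefficient_formula[OF nm lam D_def _ _ As ss, of c a b] that by (auto simp: Q_def)
  obtain c where c: "Q c"
    using schur_prodvar_expansion[OF lam] nm unfolding Q_def D_def by auto
  have "(THE c. Q c) = c"
  proof (rule the_equality)
    fix c' assume "Q c'"
    then show "c' = c" using F[OF c] F[of c'] by (intro ext) (simp only:)
  qed (rule c)
  moreover have "(\<lambda>k. x (k div m) * y (k mod m)) = prodvar m x y" for x y
    by (simp add: fun_eq_iff prodvar_def)
  ultimately have "kron n m mu nu lam = c mu nu"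
    by (simp add: kron_def Q_def D_def)
  then show ?thesis using F[OF c, of mu nu] mu nu by (simp add: D_def)
qed

text \<open>The formula with the parts of the three partitions replaced by integer variables, so
  that it makes sense on all of the lattice and not only on the domain.\<close>

definition kron_step :: "nat \<Rightarrow> nat \<Rightarrow> (nat \<times> nat) list \<Rightarrow> nat list \<Rightarrow> (nat \<Rightarrow> int) \<Rightarrow> real" where
  "kron_step n m As ss x = (\<Sum>\<sigma> | \<sigma> permutes {..<n * m}. of_int (sign \<sigma>) *
    root_vpf n m As
      (\<lambda>i. (\<Sum>k<n * m. (x (n + m + \<sigma> k) + int (n * m - 1 - \<sigma> k)) * evec n m k i)
        - pairvec n m (\<lambda>i. x i + int (n - 1 - i)) (\<lambda>j. x (n + j) + int (m - 1 - j)) i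
        - kron_shift n m As ss i))"

section \<open>The formula is a step polynomial\<close>

lemma qa_psum:
  assumes "s < n + m"
  shows "psum n s \<in> quasi_affine (n + m)"
  unfolding psum_def[abs_def] by (intro qa_sum qa_coord) (use assms in auto)

lemma qa_height: "height n m \<in> quasi_affine (n + m)"
  unfolding height_def[abs_def] by (intro qa_add qa_smult qa_sum qa_psum) auto

lemma sp_root_count: "root_count n m J \<in> step_poly (n + m) 0"
proof -
  define Cs where "Cs = map (psum n) [0..<n + m] @ map (\<lambda>s b. - psum n s b) (filter (\<lambda>s. s \<notin> J) [0..<n + m])"
  have "(\<lambda>x. of_rat 1 * of_bool (\<forall>q\<in>set Cs. 0 \<le> q x) * (\<Prod>q\<leftarrow>[]. real_of_int (q x))) \<in> step_poly (n + m) 0"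
    by (rule sp_term) (auto simp: Cs_def intro!: qa_psum qa_uminus)
  moreover have "(\<forall>q\<in>set Cs. 0 \<le> q x)
      \<longleftrightarrow> (\<forall>s<n + m. if s \<in> J then 0 \<le> psum n s x else psum n s x = 0)" for x
  proof -
    have "(\<forall>q\<in>set Cs. 0 \<le> q x)
        \<longleftrightarrow> (\<forall>s<n + m. 0 \<le> psum n s x) \<and> (\<forall>s<n + m. s \<notin> J \<longrightarrow> psum n s x \<le> 0)"
      unfolding Cs_def set_append set_map ball_Un ball_simps by auto
    then show ?thesis by (auto intro: order_antisym)
  qed
  ultimately show ?thesis by (simp add: root_count_def[abs_def])
qed

lemma kron_step_step_poly: "kron_step n m As ss \<in> step_poly (n + m + n * m) (length As)"
  unfolding kron_step_def[abs_def]
proof (intro sp_sum sp_int_mult)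
  fix \<sigma> assume \<sigma>: "\<sigma> \<in> {\<sigma>. \<sigma> permutes {..<n * m}}"
  let ?v = "\<lambda>x i. (\<Sum>k<n * m. (x (n + m + \<sigma> k) + int (n * m - 1 - \<sigma> k)) * evec n m k i)
        - pairvec n m (\<lambda>i. x i + int (n - 1 - i)) (\<lambda>j. x (n + j) + int (m - 1 - j)) i
        - kron_shift n m As ss i"
  have "(\<lambda>x. ?v x i) \<in> quasi_affine (n + m + n * m)" if i: "i < n + m" for i
  proof -
    have "(\<lambda>x. \<Sum>k<n * m. evec n m k i * (x (n + m + \<sigma> k) + int (n * m - 1 - \<sigma> k)))
        \<in> quasi_affine (n + m + n * m)"
    proof (intro qa_sum qa_smult qa_add qa_const qa_coord)
      fix k assume "k \<in> {..<n * m}"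
      then show "n + m + \<sigma> k < n + m + n * m" using \<sigma> permutes_in_image[of \<sigma> "{..<n * m}" k] by simp
    qed simp
    moreover have "(\<lambda>x. pairvec n m (\<lambda>i. x i + int (n - 1 - i)) (\<lambda>j. x (n + j) + int (m - 1 - j)) i)
        \<in> quasi_affine (n + m + n * m)"
      using i by (cases "i < n") (auto simp: pairvec_def intro!: qa_add qa_const qa_coord)
    ultimately show ?thesis
      by (intro qa_diff qa_const) (simp_all add: mult.commute)
  qed
  then have "(\<lambda>x. root_vpf n m As (?v x)) \<in> step_poly (n + m + n * m)
      (length (map (\<lambda>(k, l) i. evec n m k i - evec n m l i) As))"
    by (rule sp_subst[OF vpf_step_poly[OF sp_root_count qa_height]])
  then show "(\<lambda>x. root_vpf n m As (?v x)) \<in> step_poly (n + m + n * m) (length As)"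
    by simp
qed (simp add: finite_permutations)

section \<open>The domain of the Kronecker function\<close>

definition polyhedral :: "nat \<Rightarrow> int list set \<Rightarrow> bool" where
  "polyhedral N S \<longleftrightarrow> (\<exists>A. int_polyhedron N A = S)"

lemma polyhedral_halfspace: "polyhedral N {xs. length xs = N \<and> 0 \<le> affine_form N l (nth xs)}"
proof -
  have "int_polyhedron N [(map (\<lambda>i. - fst l i) [0..<N], snd l)]
      = {xs. length xs = N \<and> 0 \<le> affine_form N l (nth xs)}"
    by (auto simp: int_polyhedron_def affine_form_def sum_negf)
  then show ?thesis unfolding polyhedral_def by blast
qed

lemma polyhedral_Int:
  assumes "polyhedral N S" and "polyhedral N T"
  shows "polyhedral N (S \<inter> T)"
proof -
  obtain A B where "int_polyhedron N A = S" "int_polyhedron N B = T"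
    using assms unfolding polyhedral_def by blast
  then have "int_polyhedron N (A @ B) = S \<inter> T" by (auto simp: int_polyhedron_def)
  then show ?thesis unfolding polyhedral_def by blast
qed

lemma polyhedral_UNIV: "polyhedral N {xs. length xs = N}"
  unfolding polyhedral_def by (rule exI[of _ "[]"]) (simp add: int_polyhedron_def)

lemma polyhedral_Ball:
  assumes "finite I" and "\<And>i. i \<in> I \<Longrightarrow> polyhedral N {xs. length xs = N \<and> Q i xs}"
  shows "polyhedral N {xs. length xs = N \<and> (\<forall>i\<in>I. Q i xs)}"
  using assms
proof (induction I rule: finite_induct)
  case empty
  then show ?case by (simp add: polyhedral_UNIV)
next
  case (insert i I)
  then have "polyhedral N ({xs. length xs = N \<and> Q i xs} \<inter> {xs. length xs = N \<and> (\<forall>i\<in>I. Q i xs)})"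
    by (intro polyhedral_Int) auto
  then show ?case by (rule back_subst) auto
qed

lemma polyhedral_affine:
  assumes "\<And>xs. length xs = N \<Longrightarrow> Q xs \<longleftrightarrow> 0 \<le> affine_form N l (nth xs)"
  shows "polyhedral N {xs. length xs = N \<and> Q xs}"
proof -
  have "{xs. length xs = N \<and> Q xs} = {xs. length xs = N \<and> 0 \<le> affine_form N l (nth xs)}"
    using assms by auto
  then show ?thesis using polyhedral_halfspace[of N l] by simp
qed

lemma affine_form_block:
  assumes "s + L \<le> N"
  shows "affine_form N (\<lambda>j. c * of_bool (s \<le> j \<and> j < s + L), 0) x = c * (\<Sum>i<L. x (s + i))"
proof -
  have "(\<Sum>j<N. c * of_bool (s \<le> j \<and> j < s + L) * x j) = (\<Sum>j\<in>{s..<s + L}. c * x j)"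
    using assms by (intro sum.mono_neutral_cong_right) auto
  also have "\<dots> = (\<Sum>i<L. c * x (s + i))"
    by (rule sum.reindex_bij_witness[of _ "\<lambda>i. s + i" "\<lambda>j. j - s"]) auto
  finally show ?thesis by (simp add: affine_form_def sum_distrib_left)
qed

lemma affine_form_add:
  "affine_form N l x + affine_form N l' x = affine_form N (\<lambda>i. fst l i + fst l' i, snd l + snd l') x"
  by (simp add: affine_form_def sum.distrib algebra_simps)

text \<open>One shape of inequality covers the whole domain: blocks of length 1 compare single
  parts, an empty block gives nonnegativity, and full blocks give the equal sizes.\<close>

lemma polyhedral_block_le:
  assumes "s + L \<le> N" and "s' + L' \<le> N"
  shows "polyhedral N {xs. length xs = N \<and> (\<Sum>i<L. xs ! (s + i)) \<le> (\<Sum>i<L'. xs ! (s' + i))}"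
proof (rule polyhedral_affine)
  fix xs :: "int list"
  show "(\<Sum>i<L. xs ! (s + i)) \<le> (\<Sum>i<L'. xs ! (s' + i)) \<longleftrightarrow>
    0 \<le> affine_form N (\<lambda>j. - 1 * of_bool (s \<le> j \<and> j < s + L) + 1 * of_bool (s' \<le> j \<and> j < s' + L'), 0) (nth xs)"
    using affine_form_add[of N "(\<lambda>j. - 1 * of_bool (s \<le> j \<and> j < s + L), 0)" "nth xs"
        "(\<lambda>j. 1 * of_bool (s' \<le> j \<and> j < s' + L'), 0)"]
    unfolding affine_form_block[OF assms(1)] affine_form_block[OF assms(2)] by simp linarith
qed

lemma polyhedral_block_eq:
  assumes "s + L \<le> N" and "s' + L' \<le> N"
  shows "polyhedral N {xs. length xs = N \<and> (\<Sum>i<L. xs ! (s + i)) = (\<Sum>i<L'. xs ! (s' + i))}"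
  using polyhedral_Int[OF polyhedral_block_le[OF assms] polyhedral_block_le[OF assms(2,1)]]
  by (rule back_subst) auto

lemma polyhedral_partition_block:
  assumes "s + L \<le> N"
  shows "polyhedral N {xs. length xs = N \<and> is_partition_vec (take L (drop s xs))}"
proof -
  have iff: "is_partition_vec (take L (drop s xs))
    \<longleftrightarrow> (\<forall>i\<in>{..<L}. 0 \<le> xs ! (s + i)) \<and> (\<forall>(i, j)\<in>{(i, j). i < j \<and> j < L}. xs ! (s + j) \<le> xs ! (s + i))"
    if "length xs = N" for xs
    using that assms
    by (auto simp: is_partition_vec_def sorted_wrt_iff_nth_less all_set_conv_all_nth)
  have "polyhedral N {xs. length xs = N \<and> 0 \<le> xs ! (s + i)}" if "i < L" for i
    using polyhedral_block_le[of 0 0 N "s + i" 1] that assms by simp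
  moreover have "polyhedral N {xs. length xs = N \<and> xs ! (s + j) \<le> xs ! (s + i)}" if "i < L" "j < L" for i j
    using polyhedral_block_le[of "s + j" 1 N "s + i" 1] that assms by simp
  ultimately have "polyhedral N ({xs. length xs = N \<and> (\<forall>i\<in>{..<L}. 0 \<le> xs ! (s + i))}
    \<inter> {xs. length xs = N \<and> (\<forall>d\<in>{(i, j). i < j \<and> j < L}. xs ! (s + snd d) \<le> xs ! (s + fst d))})"
    by (intro polyhedral_Int polyhedral_Ball) (auto simp: finite_pairs_less)
  then show ?thesis by (rule back_subst) (auto simp: iff case_prod_unfold)
qed

lemma sum_list_block:
  fixes xs :: "int list"
  assumes "s + L \<le> length xs"
  shows "sum_list (take L (drop s xs)) = (\<Sum>i<L. xs ! (s + i))"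
  using assms by (simp add: sum_list_sum_nth atLeast0LessThan)

lemma polyhedral_kron_domain: "polyhedral (n + m + n * m) (kron_domain n m)"
proof -
  define N where "N = n + m + n * m"
  have "polyhedral N ({xs. length xs = N \<and> is_partition_vec (take n (drop 0 xs))}
    \<inter> ({xs. length xs = N \<and> is_partition_vec (take m (drop n xs))}
    \<inter> ({xs. length xs = N \<and> is_partition_vec (take (n * m) (drop (n + m) xs))}
    \<inter> ({xs. length xs = N \<and> (\<Sum>i<n. xs ! (0 + i)) = (\<Sum>i<n * m. xs ! (n + m + i))}
    \<inter> {xs. length xs = N \<and> (\<Sum>i<m. xs ! (n + i)) = (\<Sum>i<n * m. xs ! (n + m + i))}))))"
    by (intro polyhedral_Int polyhedral_partition_block polyhedral_block_eq) (auto simp: N_def)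
  moreover have "xs \<in> kron_domain n m \<longleftrightarrow> length xs = N \<and> is_partition_vec (take n (drop 0 xs))
    \<and> is_partition_vec (take m (drop n xs)) \<and> is_partition_vec (take (n * m) (drop (n + m) xs))
    \<and> (\<Sum>i<n. xs ! (0 + i)) = (\<Sum>i<n * m. xs ! (n + m + i))
    \<and> (\<Sum>i<m. xs ! (n + i)) = (\<Sum>i<n * m. xs ! (n + m + i))" for xs
  proof (cases "length xs = N")
    case True
    then have "drop (n + m) xs = take (n * m) (drop (n + m) xs)" by (simp add: N_def)
    moreover note sum_list_block[of 0 n xs] sum_list_block[of n m xs] sum_list_block[of "n + m" "n * m" xs]
    ultimately show ?thesis using True by (auto simp: kron_domain_def N_def)
  qed (simp add: kron_domain_def N_def)
  ultimately show ?thesis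
    unfolding N_def by (elim back_subst[of "polyhedral _"]) blast
qed

lemma map_nat_partition_block:
  assumes "is_partition_vec v" and "length v = L"
  shows "map nat v \<in> partitions_len L (nat (sum_list v))"
    and "\<And>i. i < L \<Longrightarrow> int (staircase L (map nat v) i) = v ! i + int (L - 1 - i)"
proof -
  have nonneg: "0 \<le> v ! i" if "i < L" for i
    using assms that by (auto simp: is_partition_vec_def)
  have "int (sum_list (map nat v)) = sum_list v"
    using nonneg assms(2) by (simp add: sum_list_sum_nth)
  then have "sum_list (map nat v) = nat (sum_list v)" by linarith
  moreover have "sorted_wrt (\<ge>) (map nat v)"
    using assms by (auto simp: is_partition_vec_def sorted_wrt_iff_nth_less intro!: nat_mono)
  ultimately show "map nat v \<in> partitions_len L (nat (sum_list v))"
    using assms(2) by (simp add: partitions_len_def)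
  show "int (staircase L (map nat v) i) = v ! i + int (L - 1 - i)" if "i < L" for i
    using nonneg[OF that] that assms(2) by (simp add: staircase_def)
qed

lemma kron_fun_eq_kron_step:
  assumes nm: "2 \<le> n" "2 \<le> m"
    and As: "distinct As" "set As = factor_pairs n m - simple_pair n m ` simple_index n m"
    and ss: "distinct ss" "set ss = simple_index n m"
    and xs: "xs \<in> kron_domain n m"
  shows "kron_fun n m xs = kron_step n m As ss (nth xs)"
proof -
  define u where "u = take n xs"
  define v where "v = take m (drop n xs)"
  define w where "w = drop (n + m) xs"
  have len: "length u = n" "length v = m" "length w = n * m"
    using xs by (auto simp: kron_domain_def u_def v_def w_def)
  have parts: "is_partition_vec u" "is_partition_vec v" "is_partition_vec w"
    and sums: "sum_list u = sum_list w" "sum_list v = sum_list w"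
    using xs by (auto simp: kron_domain_def u_def v_def w_def)
  note U = map_nat_partition_block[OF parts(1) len(1)]
    and V = map_nat_partition_block[OF parts(2) len(2)]
    and W = map_nat_partition_block[OF parts(3) len(3)]
  have W': "length (map nat w) = n * m" "sorted_wrt (\<ge>) (map nat w)" "sum_list (map nat w) = nat (sum_list w)"
    using W(1) by (auto simp: partitions_len_def)
  have "kron_fun n m xs = kron n m (map nat u) (map nat v) (map nat w)"
    by (simp add: kron_fun_def u_def v_def w_def)
  also have "\<dots> = kron_step n m As ss (nth xs)"
    unfolding kron_formula[OF nm W'(1,2), unfolded W'(3), OF U(1)[unfolded sums] V(1)[unfolded sums] As ss]
      kron_step_def
  proof (intro sum.cong refl arg_cong2[where f = "(*)"] arg_cong2[where f = "vpf _ _"] ext arg_cong2[where f = "(-)"])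
    fix \<sigma> i assume \<sigma>: "\<sigma> \<in> {\<sigma>. \<sigma> permutes {..<n * m}}"
    {
      fix k assume "k \<in> {..<n * m}"
      then have "\<sigma> k < n * m" using \<sigma> permutes_in_image[of \<sigma> "{..<n * m}" k] by simp
      then show "int (staircase (n * m) (map nat w) (\<sigma> k)) = xs ! (n + m + \<sigma> k) + int (n * m - 1 - \<sigma> k)"
        using W(2)[of "\<sigma> k"] len(3) by (simp add: w_def)
    }
    show "pairvec n m (\<lambda>i. int (staircase n (map nat u) i)) (\<lambda>j. int (staircase m (map nat v) j)) i
        = pairvec n m (\<lambda>i. xs ! i + int (n - 1 - i)) (\<lambda>j. xs ! (n + j) + int (m - 1 - j)) i"
      using U(2)[of i] V(2)[of "i - n"] xs by (auto simp: pairvec_def u_def v_def kron_domain_def)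
  qed
  finally show ?thesis .
qed

theorem theorem4p3:
  fixes n m :: nat
  assumes "n \<ge> 2" and "m \<ge> 2"
  shows "piecewise_quasipoly_deg_le (n + m + n * m)
           (int ((n * m) choose 2) - int (n choose 2) - int (m choose 2) - (int n + int m - 2))
           (kron_domain n m) (kron_fun n m)"
proof -
  have fin: "finite (factor_pairs n m)" using factor_pairs_decomposition(7)[of n m] assms by simp
  obtain As where As: "distinct As" "set As = factor_pairs n m - simple_pair n m ` simple_index n m"
    using finite_distinct_list[of "factor_pairs n m - simple_pair n m ` simple_index n m"] fin by auto
  obtain ss where ss: "distinct ss" "set ss = simple_index n m"
    using finite_distinct_list[of "simple_index n m"] by (auto simp: simple_index_def)
  have sub: "simple_pair n m ` simple_index n m \<subseteq> factor_pairs n m"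
    using simple_pair_in_factor_pairs[OF _ assms] by auto
  \<comment> \<open>Each pair in \<open>As\<close> costs one summation; the simple pairs entered
    through \<open>root_count\<close>, of degree 0.\<close>
  have "length As = card (factor_pairs n m) - card (simple_pair n m ` simple_index n m)"
    using distinct_card[OF As(1)] As(2) card_Diff_subset[OF finite_subset[OF sub fin] sub] by simp
  moreover have "card (simple_pair n m ` simple_index n m) = n + m - 2"
    by (simp add: card_image[OF inj_on_simple_pair[OF assms(2)]] card_simple_index[OF assms])
  moreover have "card (simple_pair n m ` simple_index n m) \<le> card (factor_pairs n m)"
    by (rule card_mono[OF fin sub])
  moreover have "card (factor_pairs n m) + (m choose 2) + (n choose 2) = (n * m) choose 2"
    using card_factor_pairs[of n m] assms by simp
  ultimately have deg: "int (length As)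
      = int ((n * m) choose 2) - int (n choose 2) - int (m choose 2) - (int n + int m - 2)"
    using assms by linarith
  obtain K E where "chamber_poly (n + m + n * m) (length As) (kron_step n m As ss) K E"
    using step_poly_chamber_poly[OF kron_step_step_poly] by blast
  moreover obtain A where "int_polyhedron (n + m + n * m) A = kron_domain n m"
    using polyhedral_kron_domain unfolding polyhedral_def by blast
  ultimately have "piecewise_quasipoly_deg_le (n + m + n * m) (int (length As)) (kron_domain n m)
      (\<lambda>xs. kron_step n m As ss (nth xs))"
    using chamber_poly_piecewise by metis
  then show ?thesis
    unfolding deg by (rule piecewise_quasipoly_cong) (rule kron_fun_eq_kron_step[OF assms As ss])
qed

end
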